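(* Fix a permutation $\pi$ and a mixed $k$-chain $\mathbf{c}$ for $\pi$. Then the Schubert polynomial satisfies \[\mathfrak{S}_\pi=\sum_{Q}\operatorname{wt}(Q),\] the sum over all biwords $Q$ whose recording chain for right insertion is $\mathbf{c}$, i.e. such that $\mathcal{R}(Q)=(D,\mathbf c)$ for some BPD $D$.
   Context: Permutations are in one-line notation, $\ell$ is length, $\pi t_{ab}$ swaps the entries of $\pi$ in positions $a,b$; $\rho\lessdot_k\pi$ means $\pi=\rho t_{ab}$ with $a\le k<b$ and $\ell(\pi)=\ell(\rho)+1$. A mixed $k$-chain for $\pi$ is a chain $\mathrm{id}\lessdot_{k_1}\pi_1\lessdot_{k_2}\cdots\lessdot_{k_\ell}\pi_\ell=\pi$ together with its labels $k_i$. Bumpless pipe dreams. Cells $(i,j)$ of the $n\times n$ grid (row $i$ from the top, column $j$ from the left) carry tiles recording which cell edges are joined by pipe segments: blank (none), horizontal (W–E), vertical (S–N), cross (W–E and S–N, two pipes), r-elbow (S–E), j-elbow (W–N), and, in intermediate stages only, bump (a W–N elbow and an S–E elbow carried by two different pipes). A bumpless pipe dream (BPD) of $\pi\in S_n$ is a tiling by the first six tiles whose segments form pipes such that for each $c$ the pipe $c$ enters at the bottom of column $c$, moves only north and east, and exits at the right end of row $\pi^{-1}(c)$ ("pipe $c$ exits from row $\pi^{-1}(c)$"), any two pipes crossing at most once; $\mathrm{BPD}(\pi)$ is the set of these, $\mathrm{perm}(D)=\pi$, and $I$ is the unique BPD of the identity. The weight of $D$ is $\prod x_i$ over the blank tiles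 $(i,j)$, and $\mathfrak S_\pi=\sum_{D\in\mathrm{BPD}(\pi)}\operatorname{wt}(D)$. During the algorithm one cell may be a bump; pipes, exits and crossings are traced the same way. A pipe has an r-turn at a cell where it enters from the south and leaves east (r-elbow or SE part of a bump). Moves. min-droop at $(a,b)$, where pipe $p$ has an r-turn: let $x>0$ be smallest with $(a+x,b)$ not a cross and $y>0$ smallest with $(a,b+y)$ not a cross. Within the rectangle with corners $(a,b)$ and $(a+x,b+y)$, $p$ runs up the left column from $(a+x,b)$ to $(a,b)$ and then along the top row to $(a,b+y)$; replace this by the route along the bottom row from $(a+x,b)$ to $(a+x,b+y)$ and up the right column to $(a,b+y)$, other pipes unchanged, tiles redetermined by the segments (so $p$ gets a W–N turn at $(a+x,b+y)$, which becomes a j-elbow if it was blank and a bump if it was an r-elbow). Set $\operatorname{min-droop}(a,b)=(a+x,b+y)$. cross-bump-swap at a bump $(a,b)$ whose two pipes also cross at $(a',b')$: $(a,b)$ becomes a cross and $(a',b')$ a bump; $\operatorname{cross-bump-swap}(a,b)=(a',b')$. A biletter $b_k$ is a pair of positive integers with $b\le k$; a biword is a word of biletters; its weight is $\operatorname{wt}((b_1)_{k_1}\cdots(b_\ell)_{k_\ell})=\prod_i x_{b_i}$. Right insertion $D\leftarrow b_k$: let $(i,j)$ be the r-elbow in row $b$ with $j$ maximal. (1) min-droop at $(i,j)$; $(i_1,j_1)=\operatorname{min-droop}(i,j)$. (2) If $(i_1,j_1)$ is a j-elbow, let $(i_1,j_2)$ be the r-elbow in row $i_1$ with $j_2<j_1$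 maximal, set $(i,j)=(i_1,j_2)$, go to (1). (3) If it is a bump: (a) if its two pipes cross somewhere, perform cross-bump-swap, set $(i,j)=\operatorname{cross-bump-swap}(i_1,j_1)$, go to (1); (b) otherwise let $p$ be the pipe with the r-turn there; if $p$ exits from a row $r\le k$, set $(i,j)=(i_1,j_1)$ and go to (1); otherwise replace the bump by a cross and stop. For $D\in\mathrm{BPD}(\pi)$ the output lies in $\mathrm{BPD}(\pi t_{\alpha\beta})$ for some $\alpha\le k<\beta$ with $\pi\lessdot_k\pi t_{\alpha\beta}$. Recording chain for right insertion: $\mathcal R(\emptyset)=(I,\mathrm{id})$, and if $Q=Q'b_k$ with $\mathcal R(Q')=(D,\mathbf c')$ then $\mathcal R(Q)=(D\leftarrow b_k,\ \mathbf c'\lessdot_k\mathrm{perm}(D\leftarrow b_k))$ (the chain $\mathbf c'$ extended by one step labelled $k$). The second component is the recording chain for right insertion of $Q$. *)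

theory Defs
  imports "HOL-Library.Poly_Mapping" "HOL-Combinatorics.Permutations"
begin

section \<open>Permutations and mixed chains\<close>

text \<open>
  A permutation \<open>\<pi> \<in> S\<^sub>n\<close> is a function on \<open>nat\<close> with \<open>\<pi> permutes {1..n}\<close>; thus
  \<open>S\<^sub>n \<subseteq> S\<^sub>n\<^sub>+\<^sub>1\<close> literally. The one-line notation is \<open>\<pi> 1, \<pi> 2, \<dots>\<close>, and
  \<open>\<pi> \<circ> transpose a b\<close> swaps the entries in positions \<open>a\<close> and \<open>b\<close>.
\<close>

type_synonym perm = "nat \<Rightarrow> nat"

definition perm_length :: "perm \<Rightarrow> nat" where
  "perm_length \<pi> = card {(i, j). 1 \<le> i \<and> i < j \<and> \<pi> j < \<pi> i}"

definition k_cover :: "nat \<Rightarrow> perm \<Rightarrow> perm \<Rightarrow> bool" where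
  "k_cover k \<rho> \<pi> \<longleftrightarrow>
     (\<exists>a b. 1 \<le> a \<and> a \<le> k \<and> k < b \<and> \<pi> = \<rho> \<circ> transpose a b) \<and>
     perm_length \<pi> = perm_length \<rho> + 1"

text \<open>
  A chain \<open>id \<lessdot> \<pi>\<^sub>1 \<lessdot> \<dots> \<lessdot> \<pi>\<^sub>l\<close> with labels \<open>k\<^sub>1, \<dots>, k\<^sub>l\<close> is the list
  \<open>[(k\<^sub>1, \<pi>\<^sub>1), \<dots>, (k\<^sub>l, \<pi>\<^sub>l)]\<close>; the starting point \<open>id\<close> is implicit.
\<close>

type_synonym chain = "(nat \<times> perm) list"

fun chain_between :: "perm \<Rightarrow> chain \<Rightarrow> perm \<Rightarrow> bool" where
  "chain_between \<rho> [] \<pi> \<longleftrightarrow> \<rho> = \<pi>"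
| "chain_between \<rho> ((k, \<sigma>) # c) \<pi> \<longleftrightarrow> k_cover k \<rho> \<sigma> \<and> chain_between \<sigma> c \<pi>"

definition mixed_chain :: "chain \<Rightarrow> perm \<Rightarrow> bool" where
  "mixed_chain c \<pi> \<longleftrightarrow> chain_between id c \<pi>"

section \<open>Polynomials\<close>

type_synonym int_mpoly = "(nat \<Rightarrow>\<^sub>0 nat) \<Rightarrow>\<^sub>0 int"

definition X :: "nat \<Rightarrow> int_mpoly" where
  "X i = Poly_Mapping.single (Poly_Mapping.single i 1) 1"

section \<open>Tilings and pipes\<close>

text \<open>
  A tile is the set of its pipe segments. Pipes are traced north and east, so a
  segment is a pair (side of entry, side of exit).
\<close>

datatype side = North | East | South | West

type_synonym tile = "(side \<times> side) set"
type_synonym cell = "nat \<times> nat"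
type_synonym tiling = "cell \<Rightarrow> tile"

definition blank :: tile where "blank = {}"
definition horizontal :: tile where "horizontal = {(West, East)}"
definition vertical :: tile where "vertical = {(South, North)}"
definition cross :: tile where "cross = {(West, East), (South, North)}"
definition r_elbow :: tile where "r_elbow = {(South, East)}"
definition j_elbow :: tile where "j_elbow = {(West, North)}"
definition bump :: tile where "bump = {(West, North), (South, East)}"

text \<open>
  All tilings live on the quadrant of cells \<open>(i, j)\<close> with \<open>i, j \<ge> 1\<close>; row and column 0 are
  blank padding. The \<open>n \<times> n\<close> grid is the window \<open>{1..n} \<times> {1..n}\<close>, outside of which a
  tiling agrees with \<open>id_tiling\<close>. This is the embedding of \<open>n \<times> n\<close> tilings into
  \<open>(n+1) \<times> (n+1)\<close> tilings matching \<open>S\<^sub>n \<subseteq> S\<^sub>n\<^sub>+\<^sub>1\<close>: pipe \<open>c > n\<close> turns only at \<open>(c, c)\<close>,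
  and pipes leaving the window go straight. It makes right insertion defined for
  every biletter, whatever its label.
\<close>

definition id_tiling :: tiling where
  "id_tiling = (\<lambda>(i, j). if i = 0 \<or> j = 0 then blank
                         else if i = j then r_elbow
                         else if i < j then horizontal else vertical)"

definition outside_standard :: "nat \<Rightarrow> tiling \<Rightarrow> bool" where
  "outside_standard n D \<longleftrightarrow>
     (\<forall>i j. \<not> (i \<in> {1..n} \<and> j \<in> {1..n}) \<longrightarrow> D (i, j) = id_tiling (i, j))"

text \<open>
  Segments agree across the common edge of adjacent cells. Because of the blank padding,
  this also says that no pipe leaves through the top or starts at the left; with
  \<open>outside_standard n\<close>, every column of the window is entered from the bottom and every
  row is left on the right.
\<close>

definition edges_match :: "tiling \<Rightarrow> bool" where
  "edges_match D \<longleftrightarrow>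
     (\<forall>i j. ((\<exists>e. (e, East) \<in> D (i, j)) \<longleftrightarrow> (\<exists>f. (West, f) \<in> D (i, Suc j))) \<and>
            ((\<exists>e. (e, North) \<in> D (Suc i, j)) \<longleftrightarrow> (\<exists>f. (South, f) \<in> D (i, j))))"

text \<open>A strand is a segment together with its cell; it represents the pipe containing it.\<close>

type_synonym strand = "cell \<times> side \<times> side"

definition strands :: "tiling \<Rightarrow> strand set" where
  "strands D = {(x, s). s \<in> D x}"

inductive next_strand :: "tiling \<Rightarrow> strand \<Rightarrow> strand \<Rightarrow> bool" for D where
  east: "(e, East) \<in> D (i, j) \<Longrightarrow> (West, f) \<in> D (i, Suc j) \<Longrightarrow>
           next_strand D ((i, j), (e, East)) ((i, Suc j), (West, f))"
| north: "(e, North) \<in> D (Suc i, j) \<Longrightarrow> (South, f) \<in> D (i, j) \<Longrightarrow>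
           next_strand D ((Suc i, j), (e, North)) ((i, j), (South, f))"

definition reaches :: "tiling \<Rightarrow> strand \<Rightarrow> strand \<Rightarrow> bool" where
  "reaches D = (next_strand D)\<^sup>*\<^sup>*"

definition same_pipe :: "tiling \<Rightarrow> strand \<Rightarrow> strand \<Rightarrow> bool" where
  "same_pipe D s t \<longleftrightarrow> reaches D s t \<or> reaches D t s"

text \<open>
  Far below and far to the right of the window, every pipe runs straight, so entry and exit
  can be read off at all sufficiently distant cells.
\<close>

definition enters_column :: "tiling \<Rightarrow> strand \<Rightarrow> nat \<Rightarrow> bool" where
  "enters_column D s c \<longleftrightarrow> (\<exists>m\<^sub>0. \<forall>m\<ge>m\<^sub>0. reaches D ((m, c), (South, North)) s)"

definition exits_row :: "tiling \<Rightarrow> strand \<Rightarrow> nat \<Rightarrow> bool" where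
  "exits_row D s r \<longleftrightarrow> (\<exists>m\<^sub>0. \<forall>m\<ge>m\<^sub>0. reaches D s ((r, m), (West, East)))"

definition cross_at :: "tiling \<Rightarrow> strand \<Rightarrow> strand \<Rightarrow> cell \<Rightarrow> bool" where
  "cross_at D s t x \<longleftrightarrow> D x = cross \<and>
     (same_pipe D s (x, (West, East)) \<and> same_pipe D t (x, (South, North)) \<or>
      same_pipe D t (x, (West, East)) \<and> same_pipe D s (x, (South, North)))"

section \<open>Bumpless pipe dreams and Schubert polynomials\<close>

definition bpds :: "nat \<Rightarrow> perm \<Rightarrow> tiling set" where
  "bpds n \<pi> = {D.
     outside_standard n D \<and>
     (\<forall>x. D x \<in> {blank, horizontal, vertical, cross, r_elbow, j_elbow}) \<and>
     edges_match D \<and>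
     (\<forall>c\<in>{1..n}. \<exists>s\<in>strands D. enters_column D s c \<and> exits_row D s (inv \<pi> c)) \<and>
     (\<forall>s\<in>strands D. \<forall>t\<in>strands D. \<not> same_pipe D s t \<longrightarrow>
        (\<forall>x y. cross_at D s t x \<and> cross_at D s t y \<longrightarrow> x = y))}"

definition perm_of :: "tiling \<Rightarrow> perm" where
  "perm_of D = (THE \<pi>. \<exists>n. \<pi> permutes {1..n} \<and> D \<in> bpds n \<pi>)"

definition bpd_wt :: "nat \<Rightarrow> tiling \<Rightarrow> int_mpoly" where
  "bpd_wt n D = (\<Prod>(i, j) \<in> {x \<in> {1..n} \<times> {1..n}. D x = blank}. X i)"

definition schubert :: "nat \<Rightarrow> perm \<Rightarrow> int_mpoly" where
  "schubert n \<pi> = (\<Sum>D \<in> bpds n \<pi>. bpd_wt n D)"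

lemma finite_bpds: "finite (bpds n \<pi>)"
proof -
  let ?W = "{1..n} \<times> {1..n} :: cell set"
  let ?F = "{f :: tiling. \<forall>x. (x \<in> ?W \<longrightarrow> f x \<in> UNIV) \<and> (x \<notin> ?W \<longrightarrow> f x = {})}"
  let ?ext = "\<lambda>f x. if x \<in> ?W then f x else id_tiling x"
  have "finite (UNIV :: side set)"
    by (rule finite_subset[of _ "{North, East, South, West}"]) (auto intro: side.exhaust)
  then have "finite (UNIV :: tile set)"
    by (simp add: Finite_Set.finite_set finite_prod)
  then have "finite (?ext ` ?F)"
    by (intro finite_imageI finite_set_of_finite_funs) auto
  moreover have "bpds n \<pi> \<subseteq> ?ext ` ?F"
  proof
    fix D assume D: "D \<in> bpds n \<pi>"
    let ?f = "\<lambda>x. if x \<in> ?W then D x else {}"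
    have "D = ?ext ?f"
      using D by (auto simp: bpds_def outside_standard_def fun_eq_iff)
    moreover have "?f \<in> ?F" by auto
    ultimately show "D \<in> ?ext ` ?F" by (rule image_eqI[where f = ?ext])
  qed
  ultimately show ?thesis by (rule finite_subset[rotated])
qed

section \<open>Moves\<close>

definition droop_down :: "tiling \<Rightarrow> cell \<Rightarrow> nat" where
  "droop_down D = (\<lambda>(a, b). LEAST x. 0 < x \<and> D (a + x, b) \<noteq> cross)"

definition droop_right :: "tiling \<Rightarrow> cell \<Rightarrow> nat" where
  "droop_right D = (\<lambda>(a, b). LEAST y. 0 < y \<and> D (a, b + y) \<noteq> cross)"

text \<open>
  In the corner \<open>(a + x, b)\<close> the drooping pipe keeps its entry and now leaves east; in the
  corner \<open>(a, b + y)\<close> it keeps its exit and is now entered from the south.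
\<close>

definition min_droop :: "tiling \<Rightarrow> cell \<Rightarrow> tiling \<times> cell" where
  "min_droop D = (\<lambda>(a, b).
     let a' = a + droop_down D (a, b); b' = b + droop_right D (a, b) in
     ((\<lambda>(i, j).
         let t = D (i, j) in
         if (i, j) = (a, b) then t - {(South, East)}
         else if (i, j) = (a', b) then (\<lambda>(e, f). (e, if f = North then East else f)) ` t
         else if (i, j) = (a, b') then (\<lambda>(e, f). (if e = West then South else e, f)) ` t
         else if (i, j) = (a', b') then t \<union> {(West, North)}
         else if j = b \<and> a < i \<and> i < a' then t - {(South, North)}
         else if i = a \<and> b < j \<and> j < b' then t - {(West, East)}
         else if i = a' \<and> b < j \<and> j < b' then t \<union> {(West, East)}
         else if j = b' \<and> a < i \<and> i < a' then t \<union> {(South, North)}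
         else t),
      (a', b')))"

definition bump_pipes_cross_at :: "tiling \<Rightarrow> cell \<Rightarrow> cell \<Rightarrow> bool" where
  "bump_pipes_cross_at D x y \<longleftrightarrow> cross_at D (x, (West, North)) (x, (South, East)) y"

definition cross_bump_swap :: "tiling \<Rightarrow> cell \<Rightarrow> cell \<Rightarrow> tiling" where
  "cross_bump_swap D x y = D(x := cross, y := bump)"

section \<open>Right insertion\<close>

text \<open>
  \<open>insertion_loop k D x D'\<close>: started at step (1) with tiling \<open>D\<close> and current cell
  \<open>x = (i, j)\<close>, the algorithm terminates with result \<open>D'\<close>. The rules are steps (2),
  (3a) and the two alternatives of (3b), each preceded by the min-droop of step (1).
\<close>

inductive insertion_loop :: "nat \<Rightarrow> tiling \<Rightarrow> cell \<Rightarrow> tiling \<Rightarrow> bool" for k where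
  j_elbow:
    "\<lbrakk> min_droop D x = (D\<^sub>1, (i\<^sub>1, j\<^sub>1)); D\<^sub>1 (i\<^sub>1, j\<^sub>1) = j_elbow;
       j\<^sub>2 < j\<^sub>1; D\<^sub>1 (i\<^sub>1, j\<^sub>2) = r_elbow;
       \<forall>j. j\<^sub>2 < j \<and> j < j\<^sub>1 \<longrightarrow> D\<^sub>1 (i\<^sub>1, j) \<noteq> r_elbow;
       insertion_loop k D\<^sub>1 (i\<^sub>1, j\<^sub>2) D' \<rbrakk>
     \<Longrightarrow> insertion_loop k D x D'"
| swap:
    "\<lbrakk> min_droop D x = (D\<^sub>1, x\<^sub>1); D\<^sub>1 x\<^sub>1 = bump;
       bump_pipes_cross_at D\<^sub>1 x\<^sub>1 x\<^sub>2;
       insertion_loop k (cross_bump_swap D\<^sub>1 x\<^sub>1 x\<^sub>2) x\<^sub>2 D' \<rbrakk>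
     \<Longrightarrow> insertion_loop k D x D'"
| continue:
    "\<lbrakk> min_droop D x = (D\<^sub>1, x\<^sub>1); D\<^sub>1 x\<^sub>1 = bump;
       \<not> (\<exists>x\<^sub>2. bump_pipes_cross_at D\<^sub>1 x\<^sub>1 x\<^sub>2);
       exits_row D\<^sub>1 (x\<^sub>1, (South, East)) r; r \<le> k;
       insertion_loop k D\<^sub>1 x\<^sub>1 D' \<rbrakk>
     \<Longrightarrow> insertion_loop k D x D'"
| stop:
    "\<lbrakk> min_droop D x = (D\<^sub>1, x\<^sub>1); D\<^sub>1 x\<^sub>1 = bump;
       \<not> (\<exists>x\<^sub>2. bump_pipes_cross_at D\<^sub>1 x\<^sub>1 x\<^sub>2);
       \<not> (\<exists>r\<le>k. exits_row D\<^sub>1 (x\<^sub>1, (South, East)) r) \<rbrakk>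
     \<Longrightarrow> insertion_loop k D x (D\<^sub>1(x\<^sub>1 := cross))"

text \<open>\<open>right_insert D b k D'\<close> is \<open>D' = (D \<leftarrow> b\<^sub>k)\<close>.\<close>

definition right_insert :: "tiling \<Rightarrow> nat \<Rightarrow> nat \<Rightarrow> tiling \<Rightarrow> bool" where
  "right_insert D b k D' \<longleftrightarrow>
     (\<exists>j. D (b, j) = r_elbow \<and> (\<forall>j'>j. D (b, j') \<noteq> r_elbow) \<and> insertion_loop k D (b, j) D')"

section \<open>Biwords and recording chains\<close>

text \<open>The biletter \<open>b\<^sub>k\<close> is the pair \<open>(b, k)\<close>.\<close>

type_synonym biword = "(nat \<times> nat) list"

definition is_biword :: "biword \<Rightarrow> bool" where
  "is_biword Q \<longleftrightarrow> (\<forall>(b, k) \<in> set Q. 1 \<le> b \<and> b \<le> k)"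

definition biword_wt :: "biword \<Rightarrow> int_mpoly" where
  "biword_wt Q = prod_list (map (\<lambda>(b, k). X b) Q)"

text \<open>\<open>records Q D c\<close> is \<open>\<R>(Q) = (D, c)\<close>; biwords grow at the right end.\<close>

inductive records :: "biword \<Rightarrow> tiling \<Rightarrow> chain \<Rightarrow> bool" where
  empty: "records [] id_tiling []"
| snoc: "records Q D c \<Longrightarrow> right_insert D b k D' \<Longrightarrow>
           records (Q @ [(b, k)]) D' (c @ [(k, perm_of D')])"

lemma records_labels: "records Q D c \<Longrightarrow> map snd Q = map fst c"
  by (induction rule: records.induct) auto

lemma finite_recorded_biwords: "finite {Q. is_biword Q \<and> (\<exists>D. records Q D c)}"
proof (rule finite_subset)
  let ?K = "Max (insert 0 (fst ` set c))"
  show "{Q. is_biword Q \<and> (\<exists>D. records Q D c)} \<subseteq>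
      {Q. set Q \<subseteq> {..?K} \<times> {..?K} \<and> length Q = length c}"
  proof safe
    fix Q D assume Q: "is_biword Q" and "records Q D c"
    then have lab: "map snd Q = map fst c"
      by (simp add: records_labels)
    then show "length Q = length c"
      by (metis length_map)
    fix b k assume bk: "(b, k) \<in> set Q"
    then have "k \<in> fst ` set c"
      using lab by (metis image_eqI list.set_map snd_conv)
    then show "k \<le> ?K" by simp
    then show "b \<le> ?K" using Q bk by (fastforce simp: is_biword_def)
  qed
  show "finite {Q. set Q \<subseteq> {..?K} \<times> {..?K} \<and> length Q = length c}"
    by (rule finite_lists_length_eq) simp
qed

end

theory Submission
  imports Defs
begin

text \<open>
  Both a step north and a step east lead a pipe to the next diagonal \<open>j - i\<close>. So a pipe is a
  function from diagonals to rows, and a tiling is a family of such functions no two of which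
  agree on two consecutive diagonals. An intermediate value argument shows that two pipes cross
  an odd number of times iff their exits are inverted. Hence a tiling is reduced iff the number
  of its crossings, bumps not counted, is the length of its permutation.

  Min-droops and cross-bump-swaps preserve the permutation and the number of crossings, and each
  of them can be undone. The final replacement of a bump by a cross exchanges the tails of two
  pipes and adds one crossing. So right insertion is a bijection from pairs of a bumpless pipe
  dream of \<open>\<pi>\<close> and a number \<open>b \<le> k\<close> to the bumpless pipe dreams of the covers \<open>\<pi> \<lessdot>\<^sub>k \<sigma>\<close>. It
  multiplies the weight by \<open>x\<^sub>b\<close>, and the theorem follows by induction on the chain.
  Surjectivity needs that the inverse process terminates, while termination of the insertion
  itself is never used.
\<close>

section \<open>Pipes as functions on diagonals\<close>

text \<open>Reducedness is a statement about all pairs of pipes, but since the number of crossings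
  decides it, no move requires a look at individual pairs: a droop shifts crossings, a swap
  relocates one, and only the count matters. The same count yields the cover relation, because one
  more crossing leaves room for a length larger by at most one. Reducedness in turn makes a
  min-droop possible: an elbow inside its rectangle would belong to a pipe that crosses the drooping
  pipe twice.

  The current pipe always exits from a row at most \<open>k\<close>. This invariant identifies the
  states without a predecessor as the starts, and it bounds the row \<open>b\<close> of a start by
  \<open>k\<close>.

  The window is an obstacle. In the inverse direction the window stays fixed, so that a sum of
  columns in it can serve as a measure.\<close>

definition entry_side :: "(int \<Rightarrow> int) \<Rightarrow> int \<Rightarrow> side" where
  "entry_side f d = (if f (d - 1) = f d then West else South)"

definition exit_side :: "(int \<Rightarrow> int) \<Rightarrow> int \<Rightarrow> side" where
  "exit_side f d = (if f (d + 1) = f d then East else North)"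

text \<open>The column is the row plus the diagonal. A pipe with positive entry column has positive
  rows and columns, so \<open>nat\<close> loses nothing there.\<close>

definition cell_at :: "(int \<Rightarrow> int) \<Rightarrow> int \<Rightarrow> cell" where
  "cell_at f d = (nat (f d), nat (f d + d))"

definition strand_at :: "(int \<Rightarrow> int) \<Rightarrow> int \<Rightarrow> strand" where
  "strand_at f d = (cell_at f d, entry_side f d, exit_side f d)"

text \<open>Diagonals run over all integers because the tilings fill a quadrant. Where
  \<open>f d = int c - d\<close>, the column \<open>f d + d\<close> is constantly \<open>c\<close>:
  the last conjunct says that the pipe comes up column \<open>c\<close>.\<close>

definition pipe_path :: "nat \<Rightarrow> (int \<Rightarrow> int) \<Rightarrow> bool" where
  "pipe_path c f \<longleftrightarrow> (\<forall>d. f (d + 1) = f d \<or> f (d + 1) = f d - 1) \<and> (\<forall>d. 1 \<le> f d) \<and>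
     (\<exists>d\<^sub>0. \<forall>d\<le>d\<^sub>0. f d = int c - d)"

text \<open>Cells may be shared, edges may not: agreement on two consecutive diagonals means leaving
  a cell through the same side.\<close>

definition edge_disjoint :: "(int \<Rightarrow> int) \<Rightarrow> (int \<Rightarrow> int) \<Rightarrow> bool" where
  "edge_disjoint f g \<longleftrightarrow> (\<forall>d. \<not> (f d = g d \<and> f (d + 1) = g (d + 1)))"

text \<open>The order of the arguments is an orientation: \<open>f\<close> runs west to east and
  \<open>g\<close> south to north. In \<open>bumps\<close>, \<open>f\<close> has the W-N turn and
  \<open>g\<close> the S-E turn, so \<open>f\<close> lies above \<open>g\<close> on both adjacent
  diagonals.\<close>

definition crosses :: "(int \<Rightarrow> int) \<Rightarrow> (int \<Rightarrow> int) \<Rightarrow> int \<Rightarrow> bool" where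
  "crosses f g d \<longleftrightarrow> f d = g d \<and> f (d - 1) = f d \<and> f (d + 1) = f d \<and>
     g (d - 1) = g d + 1 \<and> g (d + 1) = g d - 1"

definition bumps :: "(int \<Rightarrow> int) \<Rightarrow> (int \<Rightarrow> int) \<Rightarrow> int \<Rightarrow> bool" where
  "bumps f g d \<longleftrightarrow> f d = g d \<and> f (d - 1) = f d \<and> f (d + 1) = f d - 1 \<and>
     g (d - 1) = g d + 1 \<and> g (d + 1) = g d"

definition exits_at :: "(int \<Rightarrow> int) \<Rightarrow> nat \<Rightarrow> bool" where
  "exits_at f r \<longleftrightarrow> (\<exists>d\<^sub>0. \<forall>d\<ge>d\<^sub>0. f d = int r)"

lemma entry_side_eq [simp]:
  "entry_side f d = West \<longleftrightarrow> f (d - 1) = f d" "West = entry_side f d \<longleftrightarrow> f (d - 1) = f d"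
  "entry_side f d = South \<longleftrightarrow> f (d - 1) \<noteq> f d" "South = entry_side f d \<longleftrightarrow> f (d - 1) \<noteq> f d"
  by (auto simp: entry_side_def)

lemma exit_side_eq [simp]:
  "exit_side f d = East \<longleftrightarrow> f (d + 1) = f d" "East = exit_side f d \<longleftrightarrow> f (d + 1) = f d"
  "exit_side f d = North \<longleftrightarrow> f (d + 1) \<noteq> f d" "North = exit_side f d \<longleftrightarrow> f (d + 1) \<noteq> f d"
  by (auto simp: exit_side_def)

lemma pipe_step: "pipe_path c f \<Longrightarrow> f (d + 1) = f d \<or> f (d + 1) = f d - 1"
  by (simp add: pipe_path_def)

lemma pipe_step_back: "pipe_path c f \<Longrightarrow> f (d - 1) = f d \<or> f (d - 1) = f d + 1"
  using pipe_step[of c f "d - 1"] by auto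

lemma pipe_row_pos: "pipe_path c f \<Longrightarrow> 1 \<le> f d"
  by (simp add: pipe_path_def)

lemma pipe_antimono_aux:
  assumes "pipe_path c f"
  shows "f (d + int k) \<le> f d \<and> f d \<le> f (d + int k) + int k"
proof (induction k)
  case (Suc k)
  then show ?case using pipe_step[OF assms, of "d + int k"] by (auto simp: algebra_simps)
qed simp

lemma pipe_antimono: "pipe_path c f \<Longrightarrow> d \<le> d' \<Longrightarrow> f d' \<le> f d"
  using pipe_antimono_aux[of c f d "nat (d' - d)"] by simp

lemma pipe_col_mono: "pipe_path c f \<Longrightarrow> d \<le> d' \<Longrightarrow> f d + d \<le> f d' + d'"
  using pipe_antimono_aux[of c f d "nat (d' - d)"] by simp

lemma pipe_col_ge:
  assumes "pipe_path c f" shows "int c \<le> f d + d"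
proof -
  obtain d0 where "\<forall>d\<le>d0. f d = int c - d" using assms by (auto simp: pipe_path_def)
  then have "f (min d d0) + min d d0 = int c" by simp
  then show ?thesis using pipe_col_mono[OF assms, of "min d d0" d] by simp
qed

lemma exits_at_le_row:
  assumes "pipe_path c f" "exits_at f r" shows "int r \<le> f d"
proof -
  obtain d0 where "\<forall>d\<ge>d0. f d = int r" using assms by (auto simp: exits_at_def)
  then have "f (max d d0) = int r" by simp
  then show ?thesis using pipe_antimono[OF assms(1), of d "max d d0"] by simp
qed

lemma exits_at_unique: "exits_at f r \<Longrightarrow> exits_at f r' \<Longrightarrow> r = r'"
  unfolding exits_at_def by (metis max.cobounded1 max.cobounded2 of_nat_eq_iff)

text \<open>Rows never increase along a pipe and are at least 1, so the smallest row is kept once it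
  is attained.\<close>

lemma exits_at_exists:
  assumes "pipe_path c f" shows "\<exists>r. exits_at f r"
proof -
  define m where "m = (LEAST m. \<exists>d. nat (f d) = m)"
  have "\<exists>d. nat (f d) = m" unfolding m_def by (rule LeastI_ex) auto
  then obtain d where d: "nat (f d) = m" by blast
  have "f d' = int m" if "d' \<ge> d" for d'
  proof -
    have "m \<le> nat (f d')" unfolding m_def by (rule Least_le) auto
    then show ?thesis
      using pipe_antimono[OF assms that] pipe_row_pos[OF assms, of d] pipe_row_pos[OF assms, of d'] d by linarith
  qed
  then show ?thesis unfolding exits_at_def by blast
qed

lemma edge_disjoint_sym: "edge_disjoint f g \<longleftrightarrow> edge_disjoint g f"
  unfolding edge_disjoint_def by metis

lemma edge_disjointD: "edge_disjoint f g \<Longrightarrow> f d = g d \<Longrightarrow> f (d + 1) \<noteq> g (d + 1)"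
  by (auto simp: edge_disjoint_def)

lemma edge_disjointD_back: "edge_disjoint f g \<Longrightarrow> f d = g d \<Longrightarrow> f (d - 1) \<noteq> g (d - 1)"
  using edge_disjointD[of f g "d - 1"] by auto

text \<open>Edge-disjoint pipes use different entry sides and different exit sides of a common cell,
  which leaves four combinations.\<close>

lemma meeting_cases:
  assumes "pipe_path c f" "pipe_path c' g" "edge_disjoint f g" "f d = g d"
  shows "crosses f g d \<or> crosses g f d \<or> bumps f g d \<or> bumps g f d"
  using pipe_step[OF assms(1), of d] pipe_step[OF assms(2), of d]
    pipe_step_back[OF assms(1), of d] pipe_step_back[OF assms(2), of d]
    edge_disjointD[OF assms(3,4)] edge_disjointD_back[OF assms(3,4)] assms(4)
  unfolding crosses_def bumps_def by auto

text \<open>The row difference changes by at most 1 per diagonal and never vanishes twice in a row.\<close>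

lemma crossing_between:
  assumes f: "pipe_path c f" and g: "pipe_path c' g" and dis: "edge_disjoint f g"
    and "d1 < d2" "f d1 < g d1" "f d2 > g d2"
  shows "\<exists>d. d1 < d \<and> d < d2 \<and> crosses f g d"
proof -
  let ?S = "{d. d1 \<le> d \<and> d \<le> d2 \<and> f d < g d}"
  \<comment> \<open>The last diagonal in the range on which \<open>f\<close> is strictly above
    \<open>g\<close>. The pipes then meet on \<open>d + 1\<close>; they cannot also meet on
    \<open>d + 2\<close>, so there \<open>f\<close> is below.\<close>
  define d where "d = Max ?S"
  have fin: "finite ?S" by (rule finite_subset[of _ "{d1..d2}"]) auto
  have "d1 \<in> ?S" using assms by auto
  then have "d \<in> ?S" unfolding d_def using fin Max_in by blast
  then have d: "d1 \<le> d" "d \<le> d2" "f d < g d" by auto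
  have "d \<noteq> d2" using d assms by auto
  have notlt: "\<not> f e < g e" if "d < e" "e \<le> d2" for e
    using that d(1) Max_ge[OF fin, of e] unfolding d_def[symmetric] by force
  have 1: "f (d + 1) = g (d + 1)" "g d = f d + 1" "f (d + 1) = f d" "g (d + 1) = g d - 1"
    using notlt[of "d + 1"] \<open>d \<noteq> d2\<close> d pipe_step[OF f, of d] pipe_step[OF g, of d] by auto
  then have "d + 1 \<noteq> d2" using assms by auto
  then have 2: "\<not> f (d + 1 + 1) < g (d + 1 + 1)" using notlt[of "d + 1 + 1"] \<open>d \<noteq> d2\<close> d by auto
  have "f (d + 1 + 1) \<noteq> g (d + 1 + 1)" using dis 1 edge_disjointD by blast
  then have "f (d + 1 + 1) = f (d + 1)" "g (d + 1 + 1) = g (d + 1) - 1"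
    using 1 2 pipe_step[OF f, of "d + 1"] pipe_step[OF g, of "d + 1"] by auto
  then have "crosses f g (d + 1)" using 1 by (auto simp: crosses_def)
  then show ?thesis using d \<open>d + 1 \<noteq> d2\<close> \<open>d \<noteq> d2\<close> by (intro exI[of _ "d + 1"]) auto
qed

locale pipes =
  fixes D :: tiling and h :: "nat \<Rightarrow> int \<Rightarrow> int"
  assumes path: "1 \<le> c \<Longrightarrow> pipe_path c (h c)"
    and disjoint: "1 \<le> c \<Longrightarrow> 1 \<le> c' \<Longrightarrow> c \<noteq> c' \<Longrightarrow> edge_disjoint (h c) (h c')"
    and mem: "s \<in> D x \<longleftrightarrow> (\<exists>c\<ge>1. \<exists>d. strand_at (h c) d = (x, s))"
begin

lemma row_pos: "1 \<le> c \<Longrightarrow> 1 \<le> h c d"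
  using path pipe_row_pos by blast

lemma col_ge: "1 \<le> c \<Longrightarrow> int c \<le> h c d + d"
  using path pipe_col_ge by blast

lemma cell_at_iff: "1 \<le> c \<Longrightarrow> cell_at (h c) d = (i, j) \<longleftrightarrow> d = int j - int i \<and> h c d = int i"
  using row_pos[of c d] col_ge[of c d] by (auto simp: cell_at_def)

lemma mem_cell: "(e, f) \<in> D (i, j) \<longleftrightarrow>
   (\<exists>c\<ge>1. h c (int j - int i) = int i \<and> e = entry_side (h c) (int j - int i) \<and> f = exit_side (h c) (int j - int i))"
  unfolding mem strand_at_def using cell_at_iff by fastforce

lemma strand_in: "1 \<le> c \<Longrightarrow> (entry_side (h c) d, exit_side (h c) d) \<in> D (cell_at (h c) d)"
  unfolding mem strand_at_def by auto

lemma sides: "(e, f) \<in> D x \<Longrightarrow> e \<in> {West, South} \<and> f \<in> {East, North}"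
  by (cases x) (auto simp: mem_cell entry_side_def exit_side_def split: if_splits)

lemma step: "1 \<le> c \<Longrightarrow> h c (d + 1) = h c d \<or> h c (d + 1) = h c d - 1"
  using path pipe_step by blast

lemma step_back: "1 \<le> c \<Longrightarrow> h c (d - 1) = h c d \<or> h c (d - 1) = h c d + 1"
  using path pipe_step_back by blast

text \<open>A common cell and a common entry side put both pipes into the same cell on the previous
  diagonal too, which is a shared edge.\<close>

lemma same_entry_pipe:
  assumes "1 \<le> c" "1 \<le> c'" "h c d = h c' d" "entry_side (h c) d = entry_side (h c') d"
  shows "c = c'"
proof (rule ccontr)
  assume "c \<noteq> c'"
  then show False
    using edge_disjointD_back[OF disjoint[OF assms(1,2)] assms(3)] assms(3,4)
      pipe_step_back[OF path[OF assms(1)], of d] pipe_step_back[OF path[OF assms(2)], of d]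
    by (auto simp: entry_side_def split: if_splits)
qed

lemma same_exit_pipe:
  assumes "1 \<le> c" "1 \<le> c'" "h c d = h c' d" "exit_side (h c) d = exit_side (h c') d"
  shows "c = c'"
proof (rule ccontr)
  assume "c \<noteq> c'"
  then show False
    using edge_disjointD[OF disjoint[OF assms(1,2)] assms(3)] assms(3,4)
      pipe_step[OF path[OF assms(1)], of d] pipe_step[OF path[OF assms(2)], of d]
    by (auto simp: exit_side_def split: if_splits)
qed

lemma entry_det: "(e, f) \<in> D x \<Longrightarrow> (e, f') \<in> D x \<Longrightarrow> f = f'"
proof -
  assume a: "(e, f) \<in> D x" "(e, f') \<in> D x"
  obtain i j where x: "x = (i, j)" by fastforce
  obtain c c' where "1 \<le> c" "1 \<le> c'" "h c (int j - int i) = h c' (int j - int i)"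
    "entry_side (h c) (int j - int i) = entry_side (h c') (int j - int i)"
    "f = exit_side (h c) (int j - int i)" "f' = exit_side (h c') (int j - int i)"
    using a unfolding x mem_cell by metis
  then show "f = f'" using same_entry_pipe[of c c'] by metis
qed

lemma exit_det: "(e, f) \<in> D x \<Longrightarrow> (e', f) \<in> D x \<Longrightarrow> e = e'"
proof -
  assume a: "(e, f) \<in> D x" "(e', f) \<in> D x"
  obtain i j where x: "x = (i, j)" by fastforce
  obtain c c' where "1 \<le> c" "1 \<le> c'" "h c (int j - int i) = h c' (int j - int i)"
    "exit_side (h c) (int j - int i) = exit_side (h c') (int j - int i)"
    "e = entry_side (h c) (int j - int i)" "e' = entry_side (h c') (int j - int i)"
    using a unfolding x mem_cell by metis
  then show "e = e'" using same_exit_pipe[of c c'] by metis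
qed

text \<open>Of the sixteen sets of the four possible segments, exactly these seven contain no two
  segments with a common entry or a common exit side.\<close>

lemma tile_cases: "D x \<in> {blank, horizontal, vertical, cross, r_elbow, j_elbow, bump}"
proof -
  have "D x \<in> Pow {(West, East), (West, North), (South, East), (South, North)}"
    using sides by fastforce
  moreover have "\<not> ((West, East) \<in> D x \<and> (West, North) \<in> D x)" "\<not> ((South, East) \<in> D x \<and> (South, North) \<in> D x)"
    "\<not> ((West, East) \<in> D x \<and> (South, East) \<in> D x)" "\<not> ((West, North) \<in> D x \<and> (South, North) \<in> D x)"
    using entry_det[of West East x North] entry_det[of South East x North]
      exit_det[of West East x South] exit_det[of West North x South] by auto
  ultimately show ?thesis
    by (simp add: Pow_insert, elim disjE)
      (simp_all add: blank_def horizontal_def vertical_def cross_def r_elbow_def j_elbow_def bump_def insert_commute)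
qed

lemma strand_at_inj:
  assumes "1 \<le> c" "1 \<le> c'" "strand_at (h c) d = strand_at (h c') d'"
  shows "c = c' \<and> d = d'"
proof -
  obtain i j where ij: "cell_at (h c) d = (i, j)" by fastforce
  moreover have "cell_at (h c') d' = (i, j)" using assms ij by (auto simp: strand_at_def)
  ultimately have "d = d'" "h c d = h c' d'" using cell_at_iff assms by auto
  then show ?thesis using same_entry_pipe[of c c' d] assms by (auto simp: strand_at_def)
qed

lemma east_west: "(\<exists>e. (e, East) \<in> D (i, j)) \<longleftrightarrow> (\<exists>f. (West, f) \<in> D (i, Suc j))"
proof -
  have *: "int (Suc j) - int i = int j - int i + 1" by simp
  show ?thesis unfolding mem_cell * by simp metis
qed

lemma north_south: "(\<exists>e. (e, North) \<in> D (Suc i, j)) \<longleftrightarrow> (\<exists>f. (South, f) \<in> D (i, j))"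
proof -
  define d where "d = int j - int i"
  have *: "int j - int (Suc i) = d - 1" by (simp add: d_def)
  have "(\<exists>e. (e, North) \<in> D (Suc i, j)) \<longleftrightarrow> (\<exists>c\<ge>1. h c (d - 1) = int i + 1 \<and> h c d \<noteq> h c (d - 1))"
    unfolding mem_cell * by (simp add: algebra_simps)
  also have "\<dots> \<longleftrightarrow> (\<exists>c\<ge>1. h c d = int i \<and> h c (d - 1) \<noteq> h c d)"
    using step_back[of _ d] by (smt (verit))
  also have "\<dots> \<longleftrightarrow> (\<exists>f. (South, f) \<in> D (i, j))"
    unfolding mem_cell d_def[symmetric] by auto
  finally show ?thesis .
qed

lemma edges_match: "edges_match D"
  unfolding edges_match_def using east_west north_south by blast

lemma cross_iff: "D (i, j) = cross \<longleftrightarrow>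
   (\<exists>c\<ge>1. \<exists>c'\<ge>1. h c (int j - int i) = int i \<and> crosses (h c) (h c') (int j - int i))"
  (is "_ \<longleftrightarrow> ?R")
proof -
  define d where "d = int j - int i"
  have "D (i, j) = cross \<longleftrightarrow> (West, East) \<in> D (i, j) \<and> (South, North) \<in> D (i, j)"
    using tile_cases[of "(i, j)"]
    by (auto simp: blank_def horizontal_def vertical_def cross_def r_elbow_def j_elbow_def bump_def)
  also have "\<dots> \<longleftrightarrow> ?R"
    unfolding mem_cell d_def[symmetric] crosses_def entry_side_eq exit_side_eq
  proof safe
    fix c c' assume "1 \<le> c" "1 \<le> c'" "h c d = int i" "h c (d - 1) = h c d" "h c (d + 1) = h c d"
      "h c' d = int i" "h c' (d - 1) \<noteq> h c' d" "h c' (d + 1) \<noteq> h c' d"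
    then show "\<exists>c\<ge>1. \<exists>c'\<ge>1. h c d = int i \<and> h c d = h c' d \<and> h c (d - 1) = h c d \<and> h c (d + 1) = h c d \<and>
       h c' (d - 1) = h c' d + 1 \<and> h c' (d + 1) = h c' d - 1"
      using step_back[of c' d] step[of c' d] by metis
  next
    fix c c' assume a: "1 \<le> c" "1 \<le> c'" "h c d = int i" "h c (d - 1) = h c d" "h c (d + 1) = h c d"
      "h c d = h c' d" "h c' (d - 1) = h c' d + 1" "h c' (d + 1) = h c' d - 1"
    show "\<exists>c\<ge>1. h c d = int i \<and> h c (d - 1) = h c d \<and> h c (d + 1) = h c d" using a by blast
    show "\<exists>c\<ge>1. h c d = int i \<and> h c (d - 1) \<noteq> h c d \<and> h c (d + 1) \<noteq> h c d"
      using a by (intro exI[of _ c']) simp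
  qed
  finally show ?thesis .
qed

lemma bump_iff: "D (i, j) = bump \<longleftrightarrow>
   (\<exists>c\<ge>1. \<exists>c'\<ge>1. h c (int j - int i) = int i \<and> bumps (h c) (h c') (int j - int i))"
  (is "_ \<longleftrightarrow> ?R")
proof -
  define d where "d = int j - int i"
  have "D (i, j) = bump \<longleftrightarrow> (West, North) \<in> D (i, j) \<and> (South, East) \<in> D (i, j)"
    using tile_cases[of "(i, j)"]
    by (auto simp: blank_def horizontal_def vertical_def cross_def r_elbow_def j_elbow_def bump_def)
  also have "\<dots> \<longleftrightarrow> ?R"
    unfolding mem_cell d_def[symmetric] bumps_def entry_side_eq exit_side_eq
  proof safe
    fix c c' assume "1 \<le> c" "1 \<le> c'" "h c d = int i" "h c (d - 1) = h c d" "h c (d + 1) \<noteq> h c d"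
      "h c' d = int i" "h c' (d - 1) \<noteq> h c' d" "h c' (d + 1) = h c' d"
    then show "\<exists>c\<ge>1. \<exists>c'\<ge>1. h c d = int i \<and> h c d = h c' d \<and> h c (d - 1) = h c d \<and> h c (d + 1) = h c d - 1 \<and>
       h c' (d - 1) = h c' d + 1 \<and> h c' (d + 1) = h c' d"
      using step_back[of c' d] step[of c d] by metis
  next
    fix c c' assume a: "1 \<le> c" "1 \<le> c'" "h c d = int i" "h c (d - 1) = h c d" "h c (d + 1) = h c d - 1"
      "h c d = h c' d" "h c' (d - 1) = h c' d + 1" "h c' (d + 1) = h c' d"
    show "\<exists>c\<ge>1. h c d = int i \<and> h c (d - 1) = h c d \<and> h c (d + 1) \<noteq> h c d"
      using a by (intro exI[of _ c]) simp
    show "\<exists>c\<ge>1. h c d = int i \<and> h c (d - 1) \<noteq> h c d \<and> h c (d + 1) = h c d"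
      using a by (intro exI[of _ c']) simp
  qed
  finally show ?thesis .
qed

text \<open>Pigeonhole: a cell has only the two entry sides west and south, and distinct pipes use
  distinct ones.\<close>

lemma at_most_two:
  assumes "1 \<le> u" "1 \<le> v" "1 \<le> c" "u \<noteq> v" "h u d = h v d" "h c d = h u d"
  shows "c = u \<or> c = v"
proof -
  have "entry_side (h c) d \<in> {West, South}" "entry_side (h u) d \<in> {West, South}"
    "entry_side (h v) d \<in> {West, South}" by (auto simp: entry_side_def)
  then show ?thesis using same_entry_pipe[of c u d] same_entry_pipe[of c v d] same_entry_pipe[of u v d] assms
    by (smt (verit, best) insertE singletonD)
qed

end

lemma pipe_initial:
  assumes "pipe_path c f"
  obtains d\<^sub>0 where "\<And>d. d \<le> d\<^sub>0 \<Longrightarrow> f d = int c - d" "d\<^sub>0 \<le> b"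
proof -
  obtain d0 where "\<forall>d\<le>d0. f d = int c - d" using assms by (auto simp: pipe_path_def)
  then show ?thesis using that[of "min d0 b"] by auto
qed

lemma exits_at_final:
  assumes "exits_at f r"
  obtains d\<^sub>0 where "\<And>d. d\<^sub>0 \<le> d \<Longrightarrow> f d = int r" "b \<le> d\<^sub>0"
proof -
  obtain d0 where "\<forall>d\<ge>d0. f d = int r" using assms by (auto simp: exits_at_def)
  then show ?thesis using that[of "max d0 b"] by auto
qed

section \<open>Reachability, entries, exits and crossings in terms of the pipe functions\<close>

context pipes
begin

lemma next_strand_step:
  assumes c: "1 \<le> c"
  shows "next_strand D (strand_at (h c) d) (strand_at (h c) (d + 1))"
proof -
  obtain i j where ij: "cell_at (h c) d = (i, j)" by fastforce
  then have d: "d = int j - int i" "h c d = int i" using cell_at_iff[OF c] by auto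
  have in1: "(entry_side (h c) d, exit_side (h c) d) \<in> D (i, j)" using strand_in[OF c, of d] ij by simp
  show ?thesis
  proof (cases "h c (d + 1) = h c d")
    case True
    have ij': "cell_at (h c) (d + 1) = (i, Suc j)" using d True by (simp add: cell_at_iff[OF c])
    have "exit_side (h c) d = East" "entry_side (h c) (d + 1) = West" using True by simp_all
    then show ?thesis
      using in1 strand_in[OF c, of "d + 1"] ij ij' by (metis strand_at_def next_strand.east)
  next
    case False
    then have h1: "h c (d + 1) = h c d - 1" using step[OF c, of d] by simp
    obtain i' where i: "i = Suc i'" using row_pos[OF c, of d] d by (cases i) auto
    have ij': "cell_at (h c) (d + 1) = (i', j)" using d h1 i by (simp add: cell_at_iff[OF c])
    have "exit_side (h c) d = North" "entry_side (h c) (d + 1) = South" using False by simp_all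
    then show ?thesis
      using in1 strand_in[OF c, of "d + 1"] ij ij' i by (metis strand_at_def next_strand.north)
  qed
qed

lemma next_strand_unique: "next_strand D s t \<Longrightarrow> next_strand D s t' \<Longrightarrow> t = t'"
  by (elim next_strand.cases) (auto dest: entry_det)

lemma next_strand_iff: "1 \<le> c \<Longrightarrow> next_strand D (strand_at (h c) d) t \<longleftrightarrow> t = strand_at (h c) (d + 1)"
  using next_strand_step next_strand_unique by blast

text \<open>Each strand of \<open>h c\<close> has exactly one successor, its strand on the next
  diagonal, so tracing the pipe is the same as increasing the diagonal.\<close>

lemma reaches_iff:
  assumes "1 \<le> c"
  shows "reaches D (strand_at (h c) d) t \<longleftrightarrow> (\<exists>d'\<ge>d. t = strand_at (h c) d')"
proof
  assume "reaches D (strand_at (h c) d) t"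
  then show "\<exists>d'\<ge>d. t = strand_at (h c) d'"
    unfolding reaches_def
  proof (induction rule: rtranclp_induct)
    case (step y z)
    then show ?case using next_strand_iff[OF assms] by (metis add_increasing2 zero_le_one)
  qed auto
next
  assume "\<exists>d'\<ge>d. t = strand_at (h c) d'"
  then obtain d' where d': "d \<le> d'" "t = strand_at (h c) d'" by blast
  have "reaches D (strand_at (h c) d) (strand_at (h c) (d + int k))" for k
  proof (induction k)
    case (Suc k)
    then show ?case using next_strand_step[OF assms, of "d + int k"] unfolding reaches_def
      by (simp add: algebra_simps)
  qed (simp add: reaches_def)
  from this[of "nat (d' - d)"] show "reaches D (strand_at (h c) d) t" using d' by simp
qed

lemma same_pipe_iff:
  assumes "1 \<le> c" "1 \<le> c'"
  shows "same_pipe D (strand_at (h c) d) (strand_at (h c') d') \<longleftrightarrow> c = c'"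
  unfolding same_pipe_def reaches_iff[OF assms(1)] reaches_iff[OF assms(2)]
  using strand_at_inj[OF assms] strand_at_inj[OF assms(2,1)] by (metis linorder_linear)

lemma strand_eq_iff:
  assumes "1 \<le> c"
  shows "((i, j), (e, f)) = strand_at (h c) d \<longleftrightarrow>
    d = int j - int i \<and> h c d = int i \<and> e = entry_side (h c) d \<and> f = exit_side (h c) d"
  using cell_at_iff[OF assms, of d i j] by (auto simp: strand_at_def)

lemma strandE:
  assumes "s \<in> D x" obtains c d where "1 \<le> c" "(x, s) = strand_at (h c) d"
  using assms mem by metis

lemma enters_column_iff:
  assumes "1 \<le> c" "1 \<le> c'"
  shows "enters_column D (strand_at (h c) d) c' \<longleftrightarrow> c = c'"
proof -
  obtain d0 where d0: "\<And>d. d \<le> d0 \<Longrightarrow> h c' d = int c' - d" "d0 \<le> d" using pipe_initial path assms(2) by metis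
  \<comment> \<open>Before diagonal \<open>d0\<close> pipe \<open>c'\<close> is still in its column,
    so these distant vertical strands belong to \<open>h c'\<close>.\<close>
  have *: "((m, c'), (South, North)) = strand_at (h c') (int c' - int m)"
    if "m > nat (int c' - d0)" for m
    using that d0(1)[of "int c' - int m"] d0(1)[of "int c' - int m - 1"] d0(1)[of "int c' - int m + 1"]
    by (simp add: strand_eq_iff[OF assms(2)])
  show ?thesis
  proof
    assume "enters_column D (strand_at (h c) d) c'"
    then obtain m0 where "\<forall>m\<ge>m0. reaches D ((m, c'), (South, North)) (strand_at (h c) d)"
      unfolding enters_column_def by blast
    then have "reaches D (strand_at (h c') (int c' - int (max m0 (nat (int c' - d0) + 1)))) (strand_at (h c) d)"
      by (subst *[symmetric]) auto
    then show "c = c'" using reaches_iff[OF assms(2)] strand_at_inj[OF assms] by blast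
  next
    assume "c = c'"
    have "reaches D ((m, c'), (South, North)) (strand_at (h c) d)" if "m > nat (int c' - d0)" for m
      unfolding *[OF that] reaches_iff[OF assms(2)] using that d0(2) \<open>c = c'\<close>
      by (intro exI[of _ d]) auto
    then show "enters_column D (strand_at (h c) d) c'"
      unfolding enters_column_def by (intro exI[of _ "nat (int c' - d0) + 1"]) auto
  qed
qed

lemma exits_row_iff:
  assumes c: "1 \<le> c"
  shows "exits_row D (strand_at (h c) d) r \<longleftrightarrow> exits_at (h c) r"
proof
  assume "exits_row D (strand_at (h c) d) r"
  then obtain m0 where m0: "\<And>m. m \<ge> m0 \<Longrightarrow> reaches D (strand_at (h c) d) ((r, m), (West, East))"
    unfolding exits_row_def by blast
  have "h c e = int r" if "e \<ge> int m0" for e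
    using m0[of "nat (e + int r)"] that unfolding reaches_iff[OF c] strand_eq_iff[OF c] by auto
  then show "exits_at (h c) r" unfolding exits_at_def by blast
next
  assume "exits_at (h c) r"
  then obtain d0 where d0: "\<And>e. d0 \<le> e \<Longrightarrow> h c e = int r" "d \<le> d0" using exits_at_final by blast
  have "reaches D (strand_at (h c) d) ((r, m), (West, East))" if "m \<ge> nat (d0 + int r + 1)" for m
    unfolding reaches_iff[OF c] strand_eq_iff[OF c]
    using that d0(2) d0(1)[of "int m - int r"] d0(1)[of "int m - int r + 1"] d0(1)[of "int m - int r - 1"]
    by (intro exI[of _ "int m - int r"]) auto
  then show "exits_row D (strand_at (h c) d) r" unfolding exits_row_def by blast
qed

lemma exits_at_distinct:
  assumes "1 \<le> c" "1 \<le> c'" "exits_at (h c) r" "exits_at (h c') r" shows "c = c'"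
proof (rule ccontr)
  assume "c \<noteq> c'"
  obtain d0 where d0: "\<And>e. d0 \<le> e \<Longrightarrow> h c e = int r" using exits_at_final assms by metis
  obtain d1 where d1: "\<And>e. d1 \<le> e \<Longrightarrow> h c' e = int r" "d0 \<le> d1" using exits_at_final assms by metis
  show False using edge_disjointD[OF disjoint[OF assms(1,2) \<open>c \<noteq> c'\<close>], of d1] d0 d1 by simp
qed

text \<open>The bridge from crossings of strands to crossings of functions. Both orientations appear
  because \<open>cross_at\<close> does not record which pipe is horizontal.\<close>

lemma cross_at_iff:
  assumes c: "1 \<le> c" and c': "1 \<le> c'"
  shows "cross_at D (strand_at (h c) d) (strand_at (h c') d') x \<longleftrightarrow>
    (\<exists>t. x = cell_at (h c) t \<and> (crosses (h c) (h c') t \<or> crosses (h c') (h c) t))"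
proof -
  obtain i j where x: "x = (i, j)" by fastforce
  define t where "t = int j - int i"
  show ?thesis
  proof
    assume a: "cross_at D (strand_at (h c) d) (strand_at (h c') d') x"
    then have "D x = cross" by (simp add: cross_at_def)
    then obtain u v where uv: "1 \<le> u" "1 \<le> v" "h u t = int i" "crosses (h u) (h v) t"
      unfolding x cross_iff t_def[symmetric] by blast
    have 1: "(x, (West, East)) = strand_at (h u) t" "(x, (South, North)) = strand_at (h v) t"
      using uv t_def unfolding x strand_eq_iff[OF uv(1)] strand_eq_iff[OF uv(2)] crosses_def by auto
    have "c = u \<and> c' = v \<or> c = v \<and> c' = u"
      using a unfolding cross_at_def 1 using same_pipe_iff c c' uv by auto
    then show "\<exists>t. x = cell_at (h c) t \<and> (crosses (h c) (h c') t \<or> crosses (h c') (h c) t)"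
      using uv(3,4) cell_at_iff[of c t i j] c x t_def by (intro exI[of _ t]) (auto simp: crosses_def)
  next
    assume "\<exists>t. x = cell_at (h c) t \<and> (crosses (h c) (h c') t \<or> crosses (h c') (h c) t)"
    then obtain t' where t': "x = cell_at (h c) t'" "crosses (h c) (h c') t' \<or> crosses (h c') (h c) t'" by blast
    then have tt: "t' = t" "h c t = int i" using cell_at_iff[OF c, of t' i j] x t_def by auto
    obtain u v where uv: "c = u \<and> c' = v \<or> c = v \<and> c' = u" "crosses (h u) (h v) t" using t' tt by blast
    then have uv1: "1 \<le> u" "1 \<le> v" "h u t = int i" using c c' tt by (auto simp: crosses_def)
    have 1: "(x, (West, East)) = strand_at (h u) t" "(x, (South, North)) = strand_at (h v) t"
      using uv uv1 t_def unfolding x strand_eq_iff[OF uv1(1)] strand_eq_iff[OF uv1(2)] crosses_def by auto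
    have "D x = cross" unfolding x cross_iff t_def[symmetric] using uv uv1 by blast
    then show "cross_at D (strand_at (h c) d) (strand_at (h c') d') x"
      unfolding cross_at_def 1 using same_pipe_iff c c' uv1 uv(1) by auto
  qed
qed

end

section \<open>Crossings and length\<close>

definition reduced :: "(nat \<Rightarrow> int \<Rightarrow> int) \<Rightarrow> bool" where
  "reduced h \<longleftrightarrow> (\<forall>c\<ge>1. \<forall>c'\<ge>1. \<forall>d d'. crosses (h c) (h c') d \<or> crosses (h c') (h c) d \<longrightarrow>
     crosses (h c) (h c') d' \<or> crosses (h c') (h c) d' \<longrightarrow> d = d')"

text \<open>Pipe \<open>\<pi> r\<close> leaves through row \<open>r\<close>, that is, pipe
  \<open>c\<close> through row \<open>inv \<pi> c\<close>. All rows are included, also those beyond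
  the window. Reducedness is kept apart from this notion, because it is derived afterwards from the
  number of crossings.\<close>

definition traced :: "nat \<Rightarrow> tiling \<Rightarrow> (nat \<Rightarrow> int \<Rightarrow> int) \<Rightarrow> perm \<Rightarrow> bool" where
  "traced n D h \<pi> \<longleftrightarrow> pipes D h \<and> outside_standard n D \<and> \<pi> permutes {1..n} \<and>
     (\<forall>r\<ge>1. exits_at (h (\<pi> r)) r)"

definition crossings :: "tiling \<Rightarrow> cell set" where
  "crossings D = {x. D x = cross}"

lemma id_tiling_not_cross: "id_tiling x \<noteq> cross"
  by (cases x) (auto simp: id_tiling_def blank_def r_elbow_def horizontal_def vertical_def cross_def)

lemma crossings_window:
  assumes "outside_standard n D" shows "crossings D \<subseteq> {1..n} \<times> {1..n}"
  using assms id_tiling_not_cross unfolding outside_standard_def crossings_def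
  by (metis (mono_tags, lifting) SigmaI mem_Collect_eq subrelI)

lemma finite_crossings: "outside_standard n D \<Longrightarrow> finite (crossings D)"
  using crossings_window finite_subset by blast

lemma permutes_ge_1: "\<pi> permutes {1..n} \<Longrightarrow> 1 \<le> r \<Longrightarrow> 1 \<le> \<pi> (r::nat)"
  by (metis atLeastAtMost_iff permutes_in_image permutes_not_in)

lemma traced_exits:
  assumes "traced n D h \<pi>" "1 \<le> c" shows "1 \<le> inv \<pi> c \<and> exits_at (h c) (inv \<pi> c)"
proof -
  have p: "\<pi> permutes {1..n}" using assms by (simp add: traced_def)
  have "1 \<le> inv \<pi> c" using permutes_ge_1[OF permutes_inv[OF p] assms(2)] .
  moreover have "\<pi> (inv \<pi> c) = c" using p permutes_inverses by metis
  ultimately show ?thesis using assms unfolding traced_def by metis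
qed

text \<open>\<open>G\<close> sends a crossing to the pair of pipes meeting there, and
  \<open>S\<close> consists of the pairs whose exits are inverted. By the intermediate value
  argument every pair in \<open>S\<close> crosses, which gives the inequality. Equality makes
  \<open>G\<close> injective, so no pair crosses twice. Conversely, a pair that crosses only once
  has its order reversed, so in a reduced system \<open>G\<close> maps the crossings bijectively
  onto \<open>S\<close>.\<close>

lemma
  assumes tr: "traced n D h \<pi>"
  shows perm_length_le_crossings: "perm_length \<pi> \<le> card (crossings D)"
    and perm_length_eq_iff_reduced: "card (crossings D) = perm_length \<pi> \<longleftrightarrow> reduced h"
proof -
  interpret pipes D h using tr by (simp add: traced_def)
  have pm: "\<pi> permutes {1..n}" and ex: "\<And>r. 1 \<le> r \<Longrightarrow> exits_at (h (\<pi> r)) r"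
    using tr by (auto simp: traced_def)
  have inj: "inj \<pi>" using pm permutes_inj by blast
  note pi1 = permutes_ge_1[OF pm]
  define Inv where "Inv = {(i, j). 1 \<le> i \<and> i < j \<and> \<pi> j < \<pi> i}"
  define S where "S = (\<lambda>(r, r'). {\<pi> r, \<pi> r'}) ` Inv"
  define G where "G = (\<lambda>(i, j). {c. 1 \<le> c \<and> h c (int j - int i) = int i})"
  have fin: "finite (crossings D)" using tr finite_crossings by (auto simp: traced_def)
  have "inj_on (\<lambda>(r, r'). {\<pi> r, \<pi> r'}) Inv"
    by (rule inj_onI) (auto simp: Inv_def doubleton_eq_iff dest: injD[OF inj])
  then have cS: "card S = perm_length \<pi>" by (simp add: S_def card_image perm_length_def Inv_def)
  have Gx: "cell_at (h c) t \<in> crossings D \<and> G (cell_at (h c) t) = {c, c'}"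
    if "1 \<le> c" "1 \<le> c'" "crosses (h c) (h c') t \<or> crosses (h c') (h c) t" for c c' t
  proof -
    obtain i j where x: "cell_at (h c) t = (i, j)" by fastforce
    then have t: "t = int j - int i" "h c t = int i" using cell_at_iff that by auto
    have "h c' t = h c t" using that by (auto simp: crosses_def)
    then have "D (i, j) = cross" unfolding cross_iff t(1)[symmetric] using that t(2) by metis
    moreover have "c \<noteq> c'" "h c' t = int i" using that t by (auto simp: crosses_def)
    moreover have "{c. 1 \<le> c \<and> h c t = int i} = {c, c'}"
      using at_most_two[of c c' _ t] that t calculation by auto
    ultimately show ?thesis by (simp add: x crossings_def G_def t(1)[symmetric])
  qed
  have SG: "S \<subseteq> G ` crossings D"
  proof
    fix X assume "X \<in> S"
    then obtain r r' where r: "1 \<le> r" "r < r'" "\<pi> r' < \<pi> r" "X = {\<pi> r, \<pi> r'}" by (auto simp: S_def Inv_def)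
    have c: "1 \<le> \<pi> r" "1 \<le> \<pi> r'" using pi1 r by auto
    obtain d0 where d0: "\<And>d. d \<le> d0 \<Longrightarrow> h (\<pi> r) d = int (\<pi> r) - d" using pipe_initial[OF path[OF c(1)]] by metis
    obtain d1 where d1: "\<And>d. d \<le> d1 \<Longrightarrow> h (\<pi> r') d = int (\<pi> r') - d" "d1 \<le> d0"
      using pipe_initial[OF path[OF c(2)]] by metis
    obtain e0 where e0: "\<And>d. e0 \<le> d \<Longrightarrow> h (\<pi> r) d = int r" using exits_at_final[OF ex[of r]] r by metis
    obtain e1 where e1: "\<And>d. e1 \<le> d \<Longrightarrow> h (\<pi> r') d = int r'" "max e0 (d1 + 1) \<le> e1"
      using exits_at_final[OF ex[of r']] r by (metis le_trans less_imp_le_nat)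
    \<comment> \<open>On diagonal \<open>d1\<close> the two pipes are ordered by entry column, on
      diagonal \<open>e1\<close> by exit row, and for an inversion these orders disagree.\<close>
    have "\<exists>d. d1 < d \<and> d < e1 \<and> crosses (h (\<pi> r')) (h (\<pi> r)) d"
      using crossing_between[OF path[OF c(2)] path[OF c(1)] disjoint[OF c(2,1)], of d1 e1]
        d0[of d1] d1(1)[of d1] e0[of e1] e1(1)[of e1] d1(2) e1(2) r by auto
    then obtain d where "crosses (h (\<pi> r')) (h (\<pi> r)) d" by blast
    then show "X \<in> G ` crossings D" using Gx[OF c, of d] r(4) by blast
  qed
  have "card S \<le> card (G ` crossings D)" using SG fin by (simp add: card_mono)
  also have le2: "\<dots> \<le> card (crossings D)" using fin card_image_le by blast
  finally show le: "perm_length \<pi> \<le> card (crossings D)" using cS by simp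
  show "card (crossings D) = perm_length \<pi> \<longleftrightarrow> reduced h"
  proof
    assume "card (crossings D) = perm_length \<pi>"
    then have "card (G ` crossings D) = card (crossings D)"
      using \<open>card S \<le> card (G ` crossings D)\<close> le2 cS by simp
    then have injG: "inj_on G (crossings D)" using fin eq_card_imp_inj_on by blast
    show "reduced h" unfolding reduced_def
    proof (intro allI impI)
      fix c c' d d' assume c: "1 \<le> c" "1 \<le> c'"
        and a: "crosses (h c) (h c') d \<or> crosses (h c') (h c) d" "crosses (h c) (h c') d' \<or> crosses (h c') (h c) d'"
      then have "cell_at (h c) d = cell_at (h c) d'"
        using Gx[OF c a(1)] Gx[OF c a(2)] injG by (auto dest: inj_onD)
      then show "d = d'" using cell_at_iff[OF c(1)] by (metis surj_pair)
    qed
  next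
    assume red: "reduced h"
    have injG: "inj_on G (crossings D)"
    proof (rule inj_onI)
      fix x x' assume xx: "x \<in> crossings D" "x' \<in> crossings D" "G x = G x'"
      obtain i j where x: "x = (i, j)" by fastforce
      obtain i' j' where x': "x' = (i', j')" by fastforce
      obtain c c' where c: "1 \<le> c" "1 \<le> c'" "h c (int j - int i) = int i" "crosses (h c) (h c') (int j - int i)"
        using xx(1) unfolding x crossings_def mem_Collect_eq cross_iff by blast
      obtain e e' where e: "1 \<le> e" "1 \<le> e'" "h e (int j' - int i') = int i'" "crosses (h e) (h e') (int j' - int i')"
        using xx(2) unfolding x' crossings_def mem_Collect_eq cross_iff by blast
      have 1: "cell_at (h c) (int j - int i) = x" "cell_at (h e) (int j' - int i') = x'"
        using c e x x' cell_at_iff by auto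
      then have "{c, c'} = {e, e'}" using Gx[of c c' "int j - int i"] Gx[of e e' "int j' - int i'"] c e xx(3) by simp
      then have "c = e \<and> c' = e' \<or> c = e' \<and> c' = e" by (auto simp: doubleton_eq_iff)
      then have "int j - int i = int j' - int i'" "h c (int j - int i) = h e (int j' - int i')"
        using red c e unfolding reduced_def by (metis, metis crosses_def)
      then show "x = x'" using c(3) e(3) x x' by auto
    qed
    have "G ` crossings D \<subseteq> S"
    proof
      fix X assume "X \<in> G ` crossings D"
      then obtain i j where x: "(i, j) \<in> crossings D" "X = G (i, j)" by (auto simp: image_iff)
      define t where "t = int j - int i"
      obtain c c' where c: "1 \<le> c" "1 \<le> c'" "h c t = int i" "crosses (h c) (h c') t"
        using x(1) unfolding crossings_def mem_Collect_eq cross_iff t_def by blast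
      have "X = {c, c'}" using Gx[of c c' t] c x(2) cell_at_iff[of c t i j] t_def by simp
      define r where "r = inv \<pi> c" define r' where "r' = inv \<pi> c'"
      have r: "1 \<le> r" "1 \<le> r'" "exits_at (h c) r" "exits_at (h c') r'" "\<pi> r = c" "\<pi> r' = c'"
        using traced_exits[OF tr] c pm permutes_inverses unfolding r_def r'_def by metis+
      have cc: "c \<noteq> c'" using c(4) by (auto simp: crosses_def)
      note dis = disjoint[OF c(2,1) cc[symmetric]]
      note cb = crossing_between[OF path[OF c(2)] path[OF c(1)] dis]
      \<comment> \<open>The only crossing of this pair is at \<open>t\<close>, with \<open>c\<close>
        horizontal. If the entries or the exits were in the wrong order, there would be another one
        with \<open>c'\<close> horizontal, before or after \<open>t\<close>.\<close>
      have no: "\<not> crosses (h c') (h c) d" for d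
        using red c unfolding reduced_def by (metis crosses_def zero_neq_one add_cancel_left_right)
      have "c < c'"
      proof (rule ccontr)
        assume "\<not> c < c'"
        obtain d0 where d0: "\<And>d. d \<le> d0 \<Longrightarrow> h c d = int c - d" using pipe_initial[OF path[OF c(1)]] by metis
        obtain d1 where d1: "\<And>d. d \<le> d1 \<Longrightarrow> h c' d = int c' - d" "d1 \<le> min d0 (t - 2)"
          using pipe_initial[OF path[OF c(2)]] by metis
        show False using cb[of d1 "t - 1"] no d0[of d1] d1(1)[of d1] d1(2) c(4) \<open>\<not> c < c'\<close> cc
          by (auto simp: crosses_def)
      qed
      moreover have "r' < r"
      proof (rule ccontr)
        assume "\<not> r' < r"
        then have "r < r'" using r cc by (metis linorder_neqE_nat)
        obtain d0 where d0: "\<And>d. d0 \<le> d \<Longrightarrow> h c d = int r" using exits_at_final[OF r(3)] by metis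
        obtain d1 where d1: "\<And>d. d1 \<le> d \<Longrightarrow> h c' d = int r'" "max d0 (t + 2) \<le> d1"
          using exits_at_final[OF r(4)] by metis
        show False using cb[of "t + 1" d1] no d0[of d1] d1(1)[of d1] d1(2) c(4) \<open>r < r'\<close>
          by (auto simp: crosses_def)
      qed
      ultimately have "(r', r) \<in> Inv" using r by (auto simp: Inv_def)
      then show "X \<in> S" unfolding S_def \<open>X = {c, c'}\<close> using r by (intro image_eqI[of _ _ "(r', r)"]) auto
    qed
    then have "card (G ` crossings D) \<le> card S"
      using SG fin by (meson card_mono finite_imageI finite_subset)
    then show "card (crossings D) = perm_length \<pi>" using card_image[OF injG] le cS by simp
  qed
qed

text \<open>The map \<open>\<phi>\<close> moves the two positions of an inversion along with the
  swapped entries if they stay in increasing order, and keeps them otherwise. It injects the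
  inversions of \<open>\<pi>\<close> into those of the product and misses \<open>(i, j)\<close>. A
  strict inequality suffices: the matching upper bound comes from counting crossings.\<close>

lemma perm_length_transpose:
  assumes pm: "\<pi> permutes {1..n::nat}" and ij: "1 \<le> i" "i < j" "\<pi> i < \<pi> j"
  shows "perm_length \<pi> < perm_length (\<pi> \<circ> transpose i j)"
proof -
  let ?t = "transpose i j" let ?s = "\<pi> \<circ> ?t"
  define I where "I = (\<lambda>\<pi>::perm. {(i, j). 1 \<le> i \<and> i < j \<and> \<pi> j < \<pi> i})"
  define \<phi> where "\<phi> = (\<lambda>(x, y). if ?t x < ?t y then (?t x, ?t y) else (x, y))"
  have fin: "finite (I \<sigma>)" if s: "\<sigma> permutes {1..m}" for \<sigma> m
  proof (rule finite_subset)
    show "I \<sigma> \<subseteq> {1..m} \<times> {1..m}"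
    proof safe
      fix a b assume "(a, b) \<in> I \<sigma>"
      then have ab: "1 \<le> a" "a < b" "\<sigma> b < \<sigma> a" by (auto simp: I_def)
      have "b \<le> m"
      proof (rule ccontr)
        assume "\<not> b \<le> m"
        then have "\<sigma> b = b" using permutes_not_in[OF s, of b] by simp
        then have "\<sigma> a > m" using ab \<open>\<not> b \<le> m\<close> by simp
        then have "\<sigma> a = a" using permutes_in_image[OF s, of a] permutes_not_in[OF s, of a] by auto
        then show False using ab \<open>\<sigma> b = b\<close> by simp
      qed
      then show "a \<in> {1..m}" "b \<in> {1..m}" using ab by auto
    qed
  qed simp
  have pm': "?s permutes {1..max n j}"
  proof (rule permutes_compose)
    show "?t permutes {1..max n j}" using ij by (intro permutes_swap_id) auto
    show "\<pi> permutes {1..max n j}" using pm by (rule permutes_subset) auto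
  qed
  have tt: "?t (?t x) = x" for x by simp
  have "\<phi> ` I \<pi> \<subseteq> I ?s - {(i, j)}"
  proof
    fix q assume "q \<in> \<phi> ` I \<pi>"
    then obtain x y where xy: "(x, y) \<in> I \<pi>" "q = \<phi> (x, y)" by auto
    then show "q \<in> I ?s - {(i, j)}"
      using ij by (auto simp: \<phi>_def I_def transpose_def split: if_splits)
  qed
  moreover have "inj_on \<phi> (I \<pi>)"
    by (rule inj_onI) (auto simp: \<phi>_def I_def split: if_splits dest: injD[OF inj_transpose])
  moreover have "(i, j) \<in> I ?s" using ij by (simp add: I_def)
  ultimately have "card (I \<pi>) < card (I ?s)"
    using fin[OF pm'] by (metis (no_types, lifting) card_Diff1_less card_image card_mono finite_Diff order_le_less_trans)
  then show ?thesis by (simp add: perm_length_def I_def)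
qed

section \<open>Bumpless pipe dreams as pipe systems\<close>

lemmas tile_defs = blank_def horizontal_def vertical_def cross_def r_elbow_def j_elbow_def bump_def

lemma bump_not_bpd_tile: "bump \<notin> {blank, horizontal, vertical, cross, r_elbow, j_elbow}"
  by (auto simp: tile_defs doubleton_eq_iff)

lemma bpd_tile_det:
  assumes "T \<in> {blank, horizontal, vertical, cross, r_elbow, j_elbow, bump}"
  shows "(e, f) \<in> T \<Longrightarrow> (e', f) \<in> T \<Longrightarrow> e = e'"
    and "(e, f) \<in> T \<Longrightarrow> (e, f') \<in> T \<Longrightarrow> f = f'"
    and "(e, f) \<in> T \<Longrightarrow> (e = West \<or> e = South) \<and> (f = East \<or> f = North)"
  using assms by (elim insertE emptyE; auto simp: tile_defs)+

lemma tile_by_segments: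
  assumes "T \<in> {blank, horizontal, vertical, cross, r_elbow, j_elbow, bump}"
  shows "(South, East) \<in> T \<longleftrightarrow> T = r_elbow \<or> T = bump"
    and "(West, North) \<in> T \<longleftrightarrow> T = j_elbow \<or> T = bump"
    and "(West, East) \<in> T \<longleftrightarrow> T = horizontal \<or> T = cross"
    and "(South, North) \<in> T \<longleftrightarrow> T = vertical \<or> T = cross"
    and "(\<exists>e. (e, East) \<in> T) \<longleftrightarrow> T = horizontal \<or> T = cross \<or> T = r_elbow \<or> T = bump"
    and "(\<exists>e. (e, North) \<in> T) \<longleftrightarrow> T = vertical \<or> T = cross \<or> T = j_elbow \<or> T = bump"
    and "(\<exists>f. (West, f) \<in> T) \<longleftrightarrow> T = horizontal \<or> T = cross \<or> T = j_elbow \<or> T = bump"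
    and "(\<exists>f. (South, f) \<in> T) \<longleftrightarrow> T = vertical \<or> T = cross \<or> T = r_elbow \<or> T = bump"
  using assms by (elim insertE emptyE; auto simp: tile_defs doubleton_eq_iff)+

lemma tile_distinct [simp]:
  "blank \<noteq> horizontal" "blank \<noteq> vertical" "blank \<noteq> cross" "blank \<noteq> r_elbow" "blank \<noteq> j_elbow" "blank \<noteq> bump"
  "horizontal \<noteq> blank" "horizontal \<noteq> vertical" "horizontal \<noteq> cross" "horizontal \<noteq> r_elbow" "horizontal \<noteq> j_elbow" "horizontal \<noteq> bump"
  "vertical \<noteq> blank" "vertical \<noteq> horizontal" "vertical \<noteq> cross" "vertical \<noteq> r_elbow" "vertical \<noteq> j_elbow" "vertical \<noteq> bump"
  "cross \<noteq> blank" "cross \<noteq> horizontal" "cross \<noteq> vertical" "cross \<noteq> r_elbow" "cross \<noteq> j_elbow" "cross \<noteq> bump"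
  "r_elbow \<noteq> blank" "r_elbow \<noteq> horizontal" "r_elbow \<noteq> vertical" "r_elbow \<noteq> cross" "r_elbow \<noteq> j_elbow" "r_elbow \<noteq> bump"
  "j_elbow \<noteq> blank" "j_elbow \<noteq> horizontal" "j_elbow \<noteq> vertical" "j_elbow \<noteq> cross" "j_elbow \<noteq> r_elbow" "j_elbow \<noteq> bump"
  "bump \<noteq> blank" "bump \<noteq> horizontal" "bump \<noteq> vertical" "bump \<noteq> cross" "bump \<noteq> r_elbow" "bump \<noteq> j_elbow"
  by (auto simp: tile_defs doubleton_eq_iff)

lemma outside_standardD: "outside_standard n D \<Longrightarrow> \<not> (i \<in> {1..n} \<and> j \<in> {1..n}) \<Longrightarrow> D (i, j) = id_tiling (i, j)"
  unfolding outside_standard_def by blast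

section \<open>Passing between tilings and pipe functions\<close>

text \<open>Matching edges give every strand a unique successor and a unique predecessor on the
  adjacent diagonals. Pipe \<open>c\<close> is obtained by iterating the successor from a vertical
  strand of column \<open>c\<close> below the window; going back from any strand ends on one of
  these.\<close>

lemma pipes_exist:
  assumes tiles: "\<And>x. D x \<in> {blank, horizontal, vertical, cross, r_elbow, j_elbow}"
    and em: "edges_match D" and out: "outside_standard n D"
  shows "\<exists>h. pipes D h"
proof -
  have tiles': "D x \<in> {blank, horizontal, vertical, cross, r_elbow, j_elbow, bump}" for x
    using tiles[of x] by blast
  note ex_det = bpd_tile_det(1)[OF tiles'] and en_det = bpd_tile_det(2)[OF tiles']
    and sides = bpd_tile_det(3)[OF tiles']
  have row0: "D (0, j) = {}" and col0: "D (i, 0) = {}" for i j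
    using outside_standardD[OF out, of 0 j] outside_standardD[OF out, of i 0] by (auto simp: id_tiling_def blank_def)
  define diag where "diag = (\<lambda>s :: strand. int (snd (fst s)) - int (fst (fst s)))"
  have in_strands: "(x, s) \<in> strands D \<longleftrightarrow> s \<in> D x" for x s by (simp add: strands_def)
  have succ: "\<exists>t. next_strand D s t" if "s \<in> strands D" for s
  proof -
    obtain i j e f where s: "s = ((i, j), (e, f))" by (metis surj_pair)
    have m: "(e, f) \<in> D (i, j)" using that s in_strands by simp
    show ?thesis
    proof (cases "f = East")
      case True
      then obtain f' where "(West, f') \<in> D (i, Suc j)" using em m unfolding edges_match_def by blast
      then show ?thesis using next_strand.east m s True by blast
    next
      case False
      then have "f = North" using sides m by blast
      moreover obtain i' where "i = Suc i'" using m row0 by (cases i) auto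
      ultimately obtain f' where "(South, f') \<in> D (i', j)" using em m unfolding edges_match_def by blast
      then show ?thesis using next_strand.north m s \<open>f = North\<close> \<open>i = Suc i'\<close> by blast
    qed
  qed
  have pred: "\<exists>r. next_strand D r s" if "s \<in> strands D" for s
  proof -
    obtain i j e f where s: "s = ((i, j), (e, f))" by (metis surj_pair)
    have m: "(e, f) \<in> D (i, j)" using that s in_strands by simp
    show ?thesis
    proof (cases "e = West")
      case True
      moreover obtain j' where "j = Suc j'" using m col0 by (cases j) auto
      ultimately obtain e' where "(e', East) \<in> D (i, j')" using em m unfolding edges_match_def by blast
      then show ?thesis using next_strand.east m s \<open>e = West\<close> \<open>j = Suc j'\<close> by blast
    next
      case False
      then have "e = South" using sides m by blast
      then obtain e' where "(e', North) \<in> D (Suc i, j)" using em m unfolding edges_match_def by blast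
      then show ?thesis using next_strand.north m s \<open>e = South\<close> by blast
    qed
  qed
  have nd: "diag t = diag s + 1" "s \<in> strands D" "t \<in> strands D" if "next_strand D s t" for s t
    using that by (auto elim!: next_strand.cases simp: diag_def in_strands)
  have next_unique: "t = t'" if "next_strand D s t" "next_strand D s t'" for s t t'
    using that by (elim next_strand.cases) (auto dest: en_det)
  have prev_unique: "r = r'" if "next_strand D r s" "next_strand D r' s" for r r' s
    using that by (elim next_strand.cases) (auto dest: ex_det)
  define nxt where "nxt = (\<lambda>s. SOME t. next_strand D s t)"
  have nxt: "next_strand D s (nxt s)" if "s \<in> strands D" for s
    unfolding nxt_def using succ[OF that] by (rule someI_ex)
  \<comment> \<open>On the diagonals up to \<open>- N\<close> every cell lies below row
    \<open>n\<close>, hence is vertical, and \<open>(n + 1 + c, c)\<close> is the cell of column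
    \<open>c\<close> on diagonal \<open>- N\<close>.\<close>
  define N where "N = int n + 1"
  define S where "S = (\<lambda>c d. if d \<le> - N then ((nat (int c - d), c), (South, North))
      else (nxt ^^ nat (d + N)) ((n + 1 + c, c), (South, North)))"
  have S0: "S c d = (nxt ^^ nat (d + N)) ((n + 1 + c, c), (South, North))" if "d \<ge> - N" for c d
    using that by (cases "d = - N") (auto simp: S_def N_def nat_add_distrib)
  have vert: "D (i, c) = vertical" if "1 \<le> c" "i > n" "i > c" for i c
    using outside_standardD[OF out, of i c] that by (auto simp: id_tiling_def)
  have S_step: "next_strand D (S c d) (S c (d + 1))" if c: "1 \<le> c" for c d
  proof (cases "d < - N")
    case True
    have *: "nat (int c - d) = Suc (nat (int c - (d + 1)))" using True N_def by simp
    have "D (nat (int c - d), c) = vertical" "D (nat (int c - (d + 1)), c) = vertical"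
      using True c by (intro vert; simp add: N_def)+
    then have "next_strand D ((Suc (nat (int c - (d + 1))), c), (South, North)) ((nat (int c - (d + 1)), c), (South, North))"
      unfolding * by (intro next_strand.north) (auto simp: vertical_def)
    then show ?thesis using True by (simp add: S_def *)
  next
    case False
    have "(nxt ^^ k) ((n + 1 + c, c), (South, North)) \<in> strands D" for k
    proof (induction k)
      case 0
      then show ?case using vert[of c "n + 1 + c"] c by (simp add: in_strands vertical_def)
    next
      case (Suc k)
      then show ?case using nd(3)[OF nxt[OF Suc]] by simp
    qed
    moreover have "nat (d + 1 + N) = Suc (nat (d + N))" using False by simp
    then have "S c (d + 1) = nxt (S c d)" using False by (simp add: S0)
    moreover have "S c d = (nxt ^^ nat (d + N)) ((n + 1 + c, c), (South, North))" using False by (simp add: S0)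
    ultimately show ?thesis using nxt by metis
  qed
  have S_diag: "diag (S c d) = d" if c: "1 \<le> c" for c d
  proof (cases "d \<le> - N")
    case True
    then show ?thesis by (simp add: S_def diag_def N_def)
  next
    case False
    have "diag (S c (- N + int k)) = - N + int k" for k
    proof (induction k)
      case 0
      then show ?case by (simp add: S_def diag_def N_def)
    next
      case (Suc k)
      then show ?case using nd(1)[OF S_step[OF c, of "- N + int k"]] by (simp add: algebra_simps)
    qed
    from this[of "nat (d + N)"] show ?thesis using False by simp
  qed
  define h where "h = (\<lambda>c d. int (fst (fst (S c d))))"
  have S_in: "S c d \<in> strands D" if "1 \<le> c" for c d using nd(2)[OF S_step[OF that]] .
  have strand: "strand_at (h c) d = S c d" if c: "1 \<le> c" for c d
  proof -
    obtain i j e f where s: "S c d = ((i, j), (e, f))" by (metis surj_pair)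
    have "next_strand D (S c (d - 1)) (S c d)" using S_step[OF c, of "d - 1"] by simp
    then have e: "e = (if h c (d - 1) = h c d then West else South)"
      by (cases rule: next_strand.cases) (auto simp: s h_def)
    have f: "f = (if h c (d + 1) = h c d then East else North)"
      using S_step[OF c, of d] by (cases rule: next_strand.cases) (auto simp: s h_def)
    have "int j = int i + d" using S_diag[OF c, of d] s by (simp add: diag_def)
    moreover have hi: "h c d = int i" by (simp add: h_def s)
    ultimately have "cell_at (h c) d = (i, j)" by (simp add: cell_at_def)
    moreover have "entry_side (h c) d = e" "exit_side (h c) d = f"
      unfolding entry_side_def exit_side_def e f by (rule refl)+
    ultimately show ?thesis unfolding strand_at_def s by simp
  qed
  have path: "pipe_path c (h c)" if c: "1 \<le> c" for c
    unfolding pipe_path_def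
  proof (intro conjI allI)
    fix d
    show "h c (d + 1) = h c d \<or> h c (d + 1) = h c d - 1"
      using S_step[OF c, of d] by (cases rule: next_strand.cases) (auto simp: h_def)
    obtain i j s where s: "S c d = ((i, j), s)" by (metis surj_pair)
    then have "i \<noteq> 0" using S_in[OF c, of d] row0 in_strands by (metis empty_iff)
    then show "1 \<le> h c d" by (simp add: h_def s)
    show "\<exists>d0. \<forall>d\<le>d0. h c d = int c - d"
      by (rule exI[of _ "- N"]) (simp add: h_def S_def N_def)
  qed
  have dis: "edge_disjoint (h c) (h c')" if c: "1 \<le> c" "1 \<le> c'" "c \<noteq> c'" for c c'
    unfolding edge_disjoint_def
  proof (intro allI notI)
    fix d assume a: "h c d = h c' d \<and> h c (d + 1) = h c' (d + 1)"
    then have "fst (strand_at (h c) d) = fst (strand_at (h c') d)"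
      "snd (snd (strand_at (h c) d)) = snd (snd (strand_at (h c') d))"
      by (auto simp: strand_at_def cell_at_def exit_side_def)
    then have same: "fst (S c d) = fst (S c' d)" "snd (snd (S c d)) = snd (snd (S c' d))"
      unfolding strand[OF c(1)] strand[OF c(2)] .
    obtain x e f where s: "S c d = (x, (e, f))" by (metis surj_pair)
    obtain x' e' f' where s': "S c' d = (x', (e', f'))" by (metis surj_pair)
    have "(e, f) \<in> D x" "(e', f') \<in> D x'"
      using S_in[OF c(1), of d] S_in[OF c(2), of d] unfolding s s' in_strands .
    then have "S c d = S c' d" using same ex_det[of e f x e'] unfolding s s' by simp
    \<comment> \<open>Two pipes with a common strand also have all earlier strands in common, but up
      to diagonal \<open>- N\<close> they are in different columns.\<close>
    then have "S c (d - int k) = S c' (d - int k)" for k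
    proof (induction k)
      case (Suc k)
      then show ?case
        using prev_unique S_step[OF c(1), of "d - int (Suc k)"] S_step[OF c(2), of "d - int (Suc k)"] by simp
    qed simp
    from this[of "nat (d + N)"] have "S c (min d (- N)) = S c' (min d (- N))"
      by (cases "d \<le> - N") (auto simp: min_def)
    then show False using c by (simp add: S_def)
  qed
  \<comment> \<open>The induction on \<open>k\<close> goes back from \<open>s\<close> to diagonal
    \<open>- N\<close>, where the column of the strand names the pipe.\<close>
  have cover: "\<exists>c\<ge>1. S c (diag s) = s" if "s \<in> strands D" "diag s \<le> - N + int k" for s k
    using that
  proof (induction k arbitrary: s)
    case 0
    obtain i j t where s: "s = ((i, j), t)" by (metis surj_pair)
    then have ij: "i > n" "i > j" using 0 by (auto simp: diag_def N_def)
    have "j \<noteq> 0" using 0 s in_strands col0 by (metis empty_iff)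
    then have "t = (South, North)" using 0 s in_strands vert[of j i] ij by (auto simp: vertical_def)
    then show ?case using \<open>j \<noteq> 0\<close> 0 ij by (intro exI[of _ j]) (auto simp: S_def s diag_def)
  next
    case (Suc k)
    obtain r where r: "next_strand D r s" using pred Suc by blast
    have "r \<in> strands D" "diag r \<le> - N + int k" using Suc.prems nd[OF r] by auto
    then obtain c where c: "1 \<le> c" "S c (diag r) = r" using Suc.IH by blast
    then have "S c (diag r + 1) = s" using S_step[OF c(1), of "diag r"] next_unique r by metis
    then show ?case using c nd(1)[OF r] by metis
  qed
  have "pipes D h"
  proof
    fix s x
    show "s \<in> D x \<longleftrightarrow> (\<exists>c\<ge>1. \<exists>d. strand_at (h c) d = (x, s))"
    proof
      assume "s \<in> D x"
      then have "(x, s) \<in> strands D" by (simp add: in_strands)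
      moreover have le: "diag (x, s) \<le> - N + int (nat (diag (x, s) + N))" by simp
      ultimately show "\<exists>c\<ge>1. \<exists>d. strand_at (h c) d = (x, s)"
        using strand cover[of "(x, s)" "nat (diag (x, s) + N)"] le by metis
    next
      assume "\<exists>c\<ge>1. \<exists>d. strand_at (h c) d = (x, s)"
      then show "s \<in> D x" using strand S_in in_strands by metis
    qed
  qed (use path dis in auto)
  then show ?thesis by blast
qed

text \<open>Column \<open>c\<close> and row \<open>c\<close> lie outside the window, where the
  tiling is standard: the pipe goes straight up to \<open>(c, c)\<close> on diagonal 0 and then
  straight to the right.\<close>

lemma (in pipes) outer_pipe:
  assumes out: "outside_standard n D" and c: "n < c"
  shows "h c d = (if d \<le> 0 then int c - d else int c)"
proof -
  have c1: "1 \<le> c" using c by simp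
  obtain d0 where d0: "\<And>d. d \<le> d0 \<Longrightarrow> h c d = int c - d" "d0 \<le> 0" using pipe_initial[OF path[OF c1]] by metis
  have low: "h c (d0 + int k) = int c - (d0 + int k)" if "d0 + int k \<le> 0" for k
    using that
  proof (induction k)
    case 0
    then show ?case using d0(1)[of d0] by simp
  next
    case (Suc k)
    let ?d = "d0 + int k"
    have hd: "h c ?d = int c - ?d" using Suc by simp
    then have "cell_at (h c) ?d = (nat (int c - ?d), c)" by (simp add: cell_at_def)
    moreover have "c < nat (int c - ?d)" using Suc by simp
    then have "D (nat (int c - ?d), c) = vertical"
      using outside_standardD[OF out, of "nat (int c - ?d)" c] c by (simp add: id_tiling_def)
    ultimately have "(entry_side (h c) ?d, exit_side (h c) ?d) \<in> vertical"
      using strand_in[OF c1, of ?d] by simp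
    then have "h c (?d + 1) = h c ?d - 1" using step[OF c1, of ?d] by (auto simp: vertical_def)
    then show ?case using hd by (simp add: algebra_simps)
  qed
  have neg: "h c d = int c - d" if "d \<le> 0" for d
    using d0 low[of "nat (d - d0)"] that by (cases "d \<le> d0") auto
  have pos: "h c (int k) = int c" for k
  proof (induction k)
    case 0
    then show ?case using neg[of 0] by simp
  next
    case (Suc k)
    let ?d = "int k"
    have "cell_at (h c) ?d = (c, c + k)" using Suc by (simp add: cell_at_def)
    then have "(entry_side (h c) ?d, exit_side (h c) ?d) \<in> id_tiling (c, c + k)"
      using strand_in[OF c1, of ?d] outside_standardD[OF out, of c "c + k"] c by auto
    then have "h c (?d + 1) = h c ?d"
      using c by (cases k) (auto simp: id_tiling_def r_elbow_def horizontal_def)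
    then show ?case using Suc by (simp add: algebra_simps)
  qed
  show ?thesis using neg pos[of "nat d"] by (cases "d \<le> 0") auto
qed

lemma (in pipes) outer_exit:
  assumes "outside_standard n D" "n < c" shows "exits_at (h c) c"
  unfolding exits_at_def using outer_pipe[OF assms] by (intro exI[of _ 1]) auto

text \<open>Together with the converse \<open>traced_bpds\<close> this replaces the strand-based
  definition: a bumpless pipe dream is a traced, reduced system without bumps.\<close>

lemma (in pipes) bpds_traced:
  assumes D: "D \<in> bpds n \<pi>" and pm: "\<pi> permutes {1..n}"
  shows "traced n D h \<pi> \<and> reduced h \<and> (\<forall>x. D x \<noteq> bump)"
proof (intro conjI)
  have out: "outside_standard n D" using D by (simp add: bpds_def)
  show "traced n D h \<pi>"
    unfolding traced_def
  proof (intro conjI allI impI)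
    show "pipes D h" by unfold_locales
    fix r :: nat assume r: "1 \<le> r"
    then have c: "1 \<le> \<pi> r" using permutes_ge_1[OF pm] by blast
    show "exits_at (h (\<pi> r)) r"
    proof (cases "\<pi> r \<in> {1..n}")
      case True
      then obtain s where s: "s \<in> strands D" "enters_column D s (\<pi> r)" "exits_row D s (inv \<pi> (\<pi> r))"
        using D unfolding bpds_def by blast
      obtain x t where "s = (x, t)" by (metis surj_pair)
      then obtain e d where e: "1 \<le> e" "s = strand_at (h e) d" using s(1) mem[of t x] by (metis case_prodD mem_Collect_eq strands_def)
      then have "e = \<pi> r" using s(2) enters_column_iff c by auto
      moreover have "inv \<pi> (\<pi> r) = r" using pm permutes_inverses by metis
      ultimately show ?thesis using s(3) exits_row_iff e by auto
    next
      case False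
      then have "n < \<pi> r" "\<pi> r = r" using c permutes_in_image[OF pm, of r] permutes_not_in[OF pm, of r] by auto
      then show ?thesis using outer_exit[OF out] by metis
    qed
  qed (use out pm in auto)
  have "\<And>x. D x \<in> {blank, horizontal, vertical, cross, r_elbow, j_elbow}" using D by (auto simp: bpds_def)
  then show "\<forall>x. D x \<noteq> bump" using bump_not_bpd_tile by metis
  show "reduced h"
    unfolding reduced_def
  proof (intro allI impI)
    fix c c' d d' assume c: "1 \<le> c" "1 \<le> c'"
      and a: "crosses (h c) (h c') d \<or> crosses (h c') (h c) d" "crosses (h c) (h c') d' \<or> crosses (h c') (h c) d'"
    have "c \<noteq> c'" using a by (auto simp: crosses_def)
    let ?s = "strand_at (h c) 0" and ?t = "strand_at (h c') 0"
    have "?s \<in> strands D" "?t \<in> strands D" using strand_in c by (auto simp: strands_def strand_at_def)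
    moreover have "\<not> same_pipe D ?s ?t" using same_pipe_iff c \<open>c \<noteq> c'\<close> by simp
    moreover have "cross_at D ?s ?t (cell_at (h c) d)" "cross_at D ?s ?t (cell_at (h c) d')"
      using cross_at_iff[OF c] a by blast+
    ultimately have "cell_at (h c) d = cell_at (h c) d'"
      using D unfolding bpds_def by blast
    then show "d = d'" using cell_at_iff[OF c(1)] by (metis surj_pair)
  qed
qed

lemma bpds_trace:
  assumes "D \<in> bpds n \<pi>" "\<pi> permutes {1..n}"
  obtains h where "traced n D h \<pi>" "reduced h" "\<And>x. D x \<noteq> bump"
proof -
  obtain h where "pipes D h" using pipes_exist[of D n] assms by (auto simp: bpds_def)
  then show ?thesis using pipes.bpds_traced[OF _ assms] that by blast
qed

lemma traced_bpds:
  assumes tr: "traced n D h \<pi>" and red: "reduced h" and nb: "\<And>x. D x \<noteq> bump"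
  shows "D \<in> bpds n \<pi>"
proof -
  interpret pipes D h using tr by (simp add: traced_def)
  have "\<exists>s\<in>strands D. enters_column D s c \<and> exits_row D s (inv \<pi> c)" if "c \<in> {1..n}" for c
  proof (rule bexI[of _ "strand_at (h c) 0"])
    have c: "1 \<le> c" using that by simp
    show "enters_column D (strand_at (h c) 0) c \<and> exits_row D (strand_at (h c) 0) (inv \<pi> c)"
      using enters_column_iff[OF c c] exits_row_iff[OF c] traced_exits[OF tr c] by simp
    show "strand_at (h c) 0 \<in> strands D" using strand_in[OF c] by (auto simp: strands_def strand_at_def)
  qed
  moreover have "x = y" if "s \<in> strands D" "t \<in> strands D" "\<not> same_pipe D s t" "cross_at D s t x" "cross_at D s t y"
    for s t x y
  proof -
    obtain c d where c: "1 \<le> c" "s = strand_at (h c) d" using \<open>s \<in> strands D\<close> by (auto simp: strands_def elim: strandE)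
    obtain c' d' where c': "1 \<le> c'" "t = strand_at (h c') d'" using \<open>t \<in> strands D\<close> by (auto simp: strands_def elim: strandE)
    show ?thesis using that(4,5) red c(1) c'(1) unfolding c(2) c'(2) cross_at_iff[OF c(1) c'(1)] reduced_def by blast
  qed
  moreover have "D x \<in> {blank, horizontal, vertical, cross, r_elbow, j_elbow}" for x
    using tile_cases[of x] nb[of x] by auto
  ultimately show ?thesis using tr edges_match unfolding bpds_def traced_def by blast
qed

section \<open>Independence of the window\<close>

lemma traced_unique:
  assumes "traced n D h \<pi>" "traced m D h \<sigma>" shows "\<pi> = \<sigma>"
proof
  fix r
  interpret pipes D h using assms by (simp add: traced_def)
  show "\<pi> r = \<sigma> r"
  proof (cases "r = 0")
    case True
    then have "r \<notin> {1..n}" "r \<notin> {1..m}" by auto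
    moreover have "\<pi> permutes {1..n}" "\<sigma> permutes {1..m}" using assms by (auto simp: traced_def)
    ultimately show ?thesis using permutes_not_in by metis
  next
    case False
    then have "1 \<le> r" by simp
    moreover from this have "1 \<le> \<pi> r" "1 \<le> \<sigma> r" using assms permutes_ge_1 by (auto simp: traced_def)
    ultimately show ?thesis
      using assms exits_at_distinct[of "\<pi> r" "\<sigma> r" r] unfolding traced_def by blast
  qed
qed

text \<open>The description is unique although the window in it is not: a permutation obtained in
  any other window has the same pipes and hence the same exits.\<close>

lemma perm_of_eq:
  assumes D: "D \<in> bpds n \<pi>" and pm: "\<pi> permutes {1..n}"
  shows "perm_of D = \<pi>"
  unfolding perm_of_def
proof (rule the_equality)
  show "\<exists>n. \<pi> permutes {1..n} \<and> D \<in> bpds n \<pi>" using assms by blast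
  fix \<sigma> assume "\<exists>n. \<sigma> permutes {1..n} \<and> D \<in> bpds n \<sigma>"
  then obtain m where m: "\<sigma> permutes {1..m}" "D \<in> bpds m \<sigma>" by blast
  obtain h where "traced n D h \<pi>" using bpds_trace[OF assms] .
  moreover from this have "traced m D h \<sigma>" using pipes.bpds_traced[OF _ m(2,1)] unfolding traced_def by blast
  ultimately show "\<sigma> = \<pi>" using traced_unique by blast
qed

lemma outside_standard_mono: "outside_standard n D \<Longrightarrow> n \<le> m \<Longrightarrow> outside_standard m D"
  unfolding outside_standard_def by (meson atLeastAtMost_iff order_trans)

lemma traced_mono: "traced n D h \<pi> \<Longrightarrow> n \<le> m \<Longrightarrow> traced m D h \<pi>"
  unfolding traced_def using outside_standard_mono permutes_subset[of \<pi> "{1..n}" "{1..m}"] by auto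

text \<open>Droops enlarge the window, so the final tiling has to be fitted back into the window of
  its permutation. If \<open>m + 1\<close> is a fixed point, pipe \<open>m + 1\<close> can neither
  rise above row \<open>m + 1\<close> nor pass to the left of column \<open>m + 1\<close>. So it
  turns at \<open>(m + 1, m + 1)\<close>, and this makes row and column \<open>m + 1\<close>
  standard.\<close>

lemma traced_shrink:
  assumes tr: "traced m D h \<pi>" and nb: "\<And>x. D x \<noteq> bump" and pm: "\<pi> permutes {1..n}" and "n \<le> m"
  shows "traced n D h \<pi>"
proof -
  interpret pipes D h using tr by (simp add: traced_def)
  have shrink1: "outside_standard m D" if out: "outside_standard (Suc m) D" and "n \<le> m" for m
  proof -
    let ?m = "Suc m"
    have m1: "1 \<le> ?m" by simp
    have "\<pi> ?m = ?m" using permutes_not_in[OF pm, of ?m] \<open>n \<le> m\<close> by auto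
    then have ex: "exits_at (h ?m) ?m" using tr m1 unfolding traced_def by metis
    have row: "int ?m \<le> h ?m d" for d using exits_at_le_row[OF path[OF m1] ex] .
    have col: "int ?m \<le> h ?m d + d" for d using col_ge[OF m1] .
    \<comment> \<open>If the pipe met diagonal 0 further down, at \<open>(q, q)\<close>, it would
      enter the r-elbow there from the south, as pipe \<open>q\<close> does.\<close>
    have h0: "h ?m 0 = int ?m"
    proof (rule ccontr)
      assume ne: "h ?m 0 \<noteq> int ?m"
      define q where "q = nat (h ?m 0)"
      have q: "?m < q" "h ?m 0 = int q" using row[of 0] ne by (auto simp: q_def)
      have "1 \<le> q" using q by simp
      have "h q 0 = int q" "h q (- 1) = int q + 1" using outer_pipe[OF out q(1), of 0] outer_pipe[OF out q(1), of "- 1"] by auto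
      moreover have "h ?m (- 1) = int q + 1"
      proof -
        have "cell_at (h ?m) 0 = (q, q)" using q by (simp add: cell_at_def)
        then have "(entry_side (h ?m) 0, exit_side (h ?m) 0) \<in> r_elbow"
          using strand_in[OF m1, of 0] outside_standardD[OF out, of q q] q by (auto simp: id_tiling_def)
        then show ?thesis using step_back[OF m1, of 0] q by (auto simp: r_elbow_def)
      qed
      ultimately show False using edge_disjointD_back[OF disjoint[OF m1 \<open>1 \<le> q\<close>], of 0] q by auto
    qed
    have "h ?m (- 1) \<noteq> h ?m 0" using col[of "- 1"] h0 by auto
    moreover have "h ?m 1 = h ?m 0" using row[of 1] step[OF m1, of 0] h0 by auto
    moreover have "cell_at (h ?m) 0 = (?m, ?m)" by (simp add: cell_at_def h0)
    ultimately have "(South, East) \<in> D (?m, ?m)"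
      using strand_in[OF m1, of 0] by (auto simp: entry_side_def exit_side_def)
    then have mm: "D (?m, ?m) = r_elbow" using tile_by_segments(1)[OF tile_cases] nb by blast
    \<comment> \<open>Row \<open>?m\<close> is settled leftwards from the corner and column
      \<open>?m\<close> upwards. Each tile is joined to the standard tile just outside the window
      and not to the tile settled before it.\<close>
    have rowm: "j + k = ?m \<Longrightarrow> 1 \<le> j \<Longrightarrow> 1 \<le> k \<Longrightarrow> D (?m, j) = vertical" for j k
    proof (induction k arbitrary: j)
      case (Suc k)
      have "D (?m, Suc j) = vertical \<or> D (?m, Suc j) = r_elbow"
      proof (cases "k = 0")
        case True then show ?thesis using mm Suc by auto
      next
        case False then show ?thesis using Suc.IH[of "Suc j"] Suc.prems by auto
      qed
      then have "\<not> (\<exists>e. (e, East) \<in> D (?m, j))" unfolding east_west by (auto simp: tile_defs)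
      moreover have "D (Suc ?m, j) = vertical" using outside_standardD[OF out, of "Suc ?m" j] Suc by (simp add: id_tiling_def)
      then have "\<exists>f. (South, f) \<in> D (?m, j)" unfolding north_south[symmetric] by (auto simp: tile_defs)
      ultimately show ?case using tile_by_segments(5,8)[OF tile_cases, of "(?m, j)"] by blast
    qed simp
    have colm: "i + k = ?m \<Longrightarrow> 1 \<le> i \<Longrightarrow> 1 \<le> k \<Longrightarrow> D (i, ?m) = horizontal" for i k
    proof (induction k arbitrary: i)
      case (Suc k)
      have "D (Suc i, ?m) = horizontal \<or> D (Suc i, ?m) = r_elbow"
      proof (cases "k = 0")
        case True then show ?thesis using mm Suc by auto
      next
        case False then show ?thesis using Suc.IH[of "Suc i"] Suc.prems by auto
      qed
      then have "\<not> (\<exists>f. (South, f) \<in> D (i, ?m))" unfolding north_south[symmetric] by (auto simp: tile_defs)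
      moreover have "D (i, Suc ?m) = horizontal" using outside_standardD[OF out, of i "Suc ?m"] Suc by (simp add: id_tiling_def)
      then have "\<exists>e. (e, East) \<in> D (i, ?m)" unfolding east_west by (auto simp: tile_defs)
      ultimately show ?case using tile_by_segments(5,8)[OF tile_cases, of "(i, ?m)"] by blast
    qed simp
    show ?thesis
      unfolding outside_standard_def
    proof (intro allI impI)
      fix i j assume nin: "\<not> (i \<in> {1..m} \<and> j \<in> {1..m})"
      show "D (i, j) = id_tiling (i, j)"
      proof (cases "i \<in> {1..?m} \<and> j \<in> {1..?m}")
        case False then show ?thesis using outside_standardD[OF out] by blast
      next
        case True
        then have "i = ?m \<or> j = ?m" using nin by auto
        then show ?thesis
          using True mm rowm[of j "?m - j"] colm[of i "?m - i"]
          by (cases "i = j") (auto simp: id_tiling_def)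
      qed
    qed
  qed
  have "outside_standard (n + k) D \<Longrightarrow> outside_standard n D" for k
    by (induction k) (use shrink1 in auto)
  from this[of "m - n"] have "outside_standard n D" using tr \<open>n \<le> m\<close> by (simp add: traced_def)
  then show ?thesis using tr pm by (simp add: traced_def)
qed

text \<open>Both candidates start in column \<open>c\<close>, and the successor of a strand is
  determined by the tiling.\<close>

lemma pipes_unique:
  assumes "pipes D h" "pipes D g" and c: "1 \<le> c"
  shows "h c = g c"
proof
  fix d
  interpret h: pipes D h by fact
  interpret g: pipes D g by fact
  obtain d0 where d0: "\<And>d. d \<le> d0 \<Longrightarrow> h c d = int c - d" "d0 \<le> d" using pipe_initial[OF h.path[OF c]] by metis
  obtain d1 where d1: "\<And>d. d \<le> d1 \<Longrightarrow> g c d = int c - d" "d1 \<le> d0" using pipe_initial[OF g.path[OF c]] by metis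
  have "strand_at (h c) (d1 - 1 + int k) = strand_at (g c) (d1 - 1 + int k)" for k
  proof (induction k)
    case 0
    then show ?case using d0 d1 by (simp add: strand_at_def cell_at_def entry_side_def exit_side_def)
  next
    case (Suc k)
    then show ?case
      using h.next_strand_step[OF c, of "d1 - 1 + int k"] g.next_strand_step[OF c, of "d1 - 1 + int k"]
        h.next_strand_unique by (metis add.assoc add.commute of_nat_Suc)
  qed
  from this[of "nat (d - d1 + 1)"] have "strand_at (h c) d = strand_at (g c) d" using d0(2) d1(2) by simp
  then have "nat (h c d) = nat (g c d)" by (simp add: strand_at_def cell_at_def)
  then show "h c d = g c d" using h.row_pos[OF c, of d] g.row_pos[OF c, of d] by linarith
qed

section \<open>Exchanging the tails of two pipes\<close>

text \<open>The transposition fixes all pipes but \<open>u\<close> and \<open>v\<close>, so one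
  formula serves for all. It is applied where the two pipes meet on diagonal \<open>t\<close>, so it
  makes no difference to which part \<open>t\<close> itself is assigned.\<close>

definition exchange :: "int \<Rightarrow> nat \<Rightarrow> nat \<Rightarrow> (nat \<Rightarrow> int \<Rightarrow> int) \<Rightarrow> nat \<Rightarrow> int \<Rightarrow> int" where
  "exchange t u v h = (\<lambda>c d. if d \<le> t then h c d else h (transpose u v c) d)"

text \<open>The effect on the tiling of exchanging tails in a cell that carries a cross or a
  bump.\<close>

definition toggle :: "tiling \<Rightarrow> cell \<Rightarrow> tiling" where
  "toggle D x = D(x := (if D x = bump then cross else bump))"

lemma exits_at_exchange: "exits_at (exchange t u v h c) r \<longleftrightarrow> exits_at (h (transpose u v c)) r"
proof
  assume "exits_at (exchange t u v h c) r"
  then obtain d0 where d0: "\<And>d. d0 \<le> d \<Longrightarrow> exchange t u v h c d = int r" by (auto simp: exits_at_def)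
  have "h (transpose u v c) d = int r" if "max d0 (t + 1) \<le> d" for d
    using d0[of d] that by (simp add: exchange_def)
  then show "exits_at (h (transpose u v c)) r" unfolding exits_at_def by blast
next
  assume "exits_at (h (transpose u v c)) r"
  then obtain d0 where d0: "\<And>d. d0 \<le> d \<Longrightarrow> h (transpose u v c) d = int r" by (auto simp: exits_at_def)
  have "exchange t u v h c d = int r" if "max d0 (t + 1) \<le> d" for d
    using d0[of d] that by (simp add: exchange_def)
  then show "exits_at (exchange t u v h c) r" unfolding exits_at_def by blast
qed

context pipes
begin

lemma meeting_tile:
  assumes "1 \<le> u" "1 \<le> v" "u \<noteq> v" "h u t = h v t"
  shows "D (cell_at (h u) t) = {(entry_side (h u) t, exit_side (h u) t), (entry_side (h v) t, exit_side (h v) t)}"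
proof -
  obtain i j where x: "cell_at (h u) t = (i, j)" by fastforce
  then have t: "t = int j - int i" "h u t = int i" using cell_at_iff assms by auto
  have "(e, f) \<in> D (i, j) \<longleftrightarrow> (e, f) \<in> {(entry_side (h u) t, exit_side (h u) t), (entry_side (h v) t, exit_side (h v) t)}"
    for e f
    unfolding mem_cell t(1)[symmetric] using at_most_two[OF assms(1,2) _ assms(3,4)] assms t(2) by auto
  then show ?thesis unfolding x by auto
qed

lemma meeting_bump_or_cross:
  assumes "1 \<le> u" "1 \<le> v" "u \<noteq> v" "h u t = h v t"
  shows "D (cell_at (h u) t) = (if crosses (h u) (h v) t \<or> crosses (h v) (h u) t then cross else bump)"
  using meeting_cases[OF path[OF assms(1)] path[OF assms(2)] disjoint[OF assms(1-3)] assms(4)]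
  unfolding meeting_tile[OF assms]
  by (auto simp: crosses_def bumps_def entry_side_def exit_side_def cross_def bump_def)

text \<open>Up to \<open>t\<close> the new pipes are the old ones, from \<open>t\<close> on they are
  the old ones with \<open>u\<close> and \<open>v\<close> renamed; both descriptions hold at
  \<open>t\<close>. So disjointness is inherited on each side, and only the tile of the meeting
  point changes.\<close>

lemma exchange_pipes:
  assumes u: "1 \<le> u" and v: "1 \<le> v" and uv: "u \<noteq> v" and eq: "h u t = h v t"
  shows "pipes (toggle D (cell_at (h u) t)) (exchange t u v h)"
proof -
  let ?s = "transpose u v" and ?h = "exchange t u v h" and ?x = "cell_at (h u) t"
  have s1: "1 \<le> ?s c" if "1 \<le> c" for c using u v that by (simp add: transpose_def)
  have at_t: "h (?s c) t = h c t" for c using eq by (simp add: transpose_def)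
  have lo: "?h c d = h c d" if "d \<le> t" for c d using that by (simp add: exchange_def)
  have hi: "?h c d = h (?s c) d" if "t \<le> d" for c d using that at_t[of c] by (cases "d = t") (auto simp: exchange_def)
  have xv: "cell_at (h v) t = ?x" using eq by (simp add: cell_at_def)
  \<comment> \<open>A strand depends on the rows on \<open>d - 1\<close>, \<open>d\<close> and
    \<open>d + 1\<close>. Only for \<open>u\<close> and \<open>v\<close> on diagonal
    \<open>t\<close> does it combine the entry of one old pipe with the exit of another.\<close>
  have str: "strand_at (?h c) d = strand_at (h (if d \<le> t then c else ?s c)) d"
    if "d \<noteq> t \<or> c \<noteq> u \<and> c \<noteq> v" for c d
  proof (cases "d < t")
    case True
    then show ?thesis by (simp add: strand_at_def cell_at_def entry_side_def exit_side_def lo)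
  next
    case False
    then have "strand_at (?h c) d = strand_at (h (?s c)) d"
      using that lo[of "d - 1" c] hi[of "d - 1" c] hi[of d c] hi[of "d + 1" c]
      by (cases "d = t") (auto simp: strand_at_def cell_at_def entry_side_def exit_side_def)
    then show ?thesis using that False by (cases "d = t") auto
  qed
  have str_t: "strand_at (?h c) t = (cell_at (h c) t, entry_side (h c) t, exit_side (h (?s c)) t)" for c
    using hi[of "t + 1" c] lo[of t c] lo[of "t - 1" c] at_t[of c]
    by (simp add: strand_at_def cell_at_def entry_side_def exit_side_def)
  show ?thesis
  proof
    fix c :: nat assume c: "1 \<le> c"
    show "pipe_path c (?h c)"
      unfolding pipe_path_def
    proof (intro conjI allI)
      fix d
      show "?h c (d + 1) = ?h c d \<or> ?h c (d + 1) = ?h c d - 1"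
        using step[OF c, of d] step[OF s1[OF c], of d] lo[of d c] lo[of "d + 1" c] hi[of d c] hi[of "d + 1" c]
        by (cases "d < t") auto
      show "1 \<le> ?h c d" using row_pos[OF c, of d] row_pos[OF s1[OF c], of d] by (simp add: exchange_def)
      obtain d0 where "\<And>d. d \<le> d0 \<Longrightarrow> h c d = int c - d" "d0 \<le> t" using pipe_initial[OF path[OF c]] by metis
      then show "\<exists>d0. \<forall>d\<le>d0. ?h c d = int c - d" by (intro exI[of _ d0]) (simp add: lo)
    qed
    fix c' :: nat assume c': "1 \<le> c'" and ne: "c \<noteq> c'"
    have ne': "?s c \<noteq> ?s c'" using ne by (auto simp: transpose_eq_iff)
    show "edge_disjoint (?h c) (?h c')"
      unfolding edge_disjoint_def
    proof (intro allI notI)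
      fix d assume a: "?h c d = ?h c' d \<and> ?h c (d + 1) = ?h c' (d + 1)"
      show False
      proof (cases "d < t")
        case True
        then show False using a edge_disjointD[OF disjoint[OF c c' ne], of d] by (simp add: lo)
      next
        case False
        then show False using a edge_disjointD[OF disjoint[OF s1[OF c] s1[OF c'] ne'], of d] by (simp add: hi)
      qed
    qed
  next
    fix s y
    show "s \<in> toggle D ?x y \<longleftrightarrow> (\<exists>c\<ge>1. \<exists>d. strand_at (?h c) d = (y, s))"
    proof (cases "y = ?x")
      case False
      then have "s \<in> toggle D ?x y \<longleftrightarrow> (\<exists>c\<ge>1. \<exists>d. strand_at (h c) d = (y, s))" by (simp add: toggle_def mem)
      also have "\<dots> \<longleftrightarrow> (\<exists>c\<ge>1. \<exists>d. strand_at (?h c) d = (y, s))"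
      proof safe
        fix c d assume c: "1 \<le> c" "strand_at (h c) d = (y, s)"
        then have "d \<noteq> t \<or> c \<noteq> u \<and> c \<noteq> v" using False xv by (auto simp: strand_at_def)
        then have "d \<noteq> t \<or> (if d \<le> t then c else ?s c) \<noteq> u \<and> (if d \<le> t then c else ?s c) \<noteq> v" by auto
        from str[OF this] have "strand_at (?h (if d \<le> t then c else ?s c)) d = (y, s)" using c by (cases "d \<le> t") auto
        moreover have "1 \<le> (if d \<le> t then c else ?s c)" using c s1 by simp
        ultimately show "\<exists>c\<ge>1. \<exists>d. strand_at (?h c) d = (y, s)" by blast
      next
        fix c d assume c: "1 \<le> c" "strand_at (?h c) d = (y, s)"
        then have "d \<noteq> t \<or> c \<noteq> u \<and> c \<noteq> v" using False xv str_t[of c] by auto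
        from str[OF this] have "strand_at (h (if d \<le> t then c else ?s c)) d = (y, s)" using c by simp
        moreover have "1 \<le> (if d \<le> t then c else ?s c)" using c s1 by simp
        ultimately show "\<exists>c\<ge>1. \<exists>d. strand_at (h c) d = (y, s)" by blast
      qed
      finally show ?thesis .
    next
      case True
      let ?T = "{(entry_side (h u) t, exit_side (h v) t), (entry_side (h v) t, exit_side (h u) t)}"
      have "toggle D ?x ?x = ?T"
        using meeting_cases[OF path[OF u] path[OF v] disjoint[OF u v uv] eq]
        unfolding toggle_def fun_upd_same meeting_tile[OF u v uv eq]
        by (elim disjE) (auto simp: crosses_def bumps_def entry_side_def exit_side_def cross_def bump_def doubleton_eq_iff)
      moreover have "(\<exists>c\<ge>1. \<exists>d. strand_at (?h c) d = (?x, s)) \<longleftrightarrow> s \<in> ?T"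
      proof
        assume "\<exists>c\<ge>1. \<exists>d. strand_at (?h c) d = (?x, s)"
        then obtain c d where c: "1 \<le> c" "strand_at (?h c) d = (?x, s)" by blast
        obtain i j where x: "?x = (i, j)" by fastforce
        then have t: "t = int j - int i" "h u t = int i" using cell_at_iff u by auto
        define e where "e = (if d \<le> t then c else ?s c)"
        have e: "1 \<le> e" using c s1 by (simp add: e_def)
        have "1 \<le> h e d" "1 \<le> h e d + d" using row_pos[OF e, of d] col_ge[OF e, of d] e by auto
        moreover have "cell_at (?h c) d = (i, j)" using c x by (simp add: strand_at_def)
        ultimately have "d = t" using t by (auto simp: e_def exchange_def cell_at_def split: if_splits)
        then have "cell_at (h c) t = ?x" using c str_t[of c] by simp
        then have "h c t = h u t" using t x cell_at_iff[OF c(1)] by metis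
        then have "c = u \<or> c = v" using at_most_two[OF u v c(1) uv eq] by simp
        then show "s \<in> ?T" using c \<open>d = t\<close> str_t[of c] by auto
      next
        assume "s \<in> ?T"
        then show "\<exists>c\<ge>1. \<exists>d. strand_at (?h c) d = (?x, s)" using str_t[of u] str_t[of v] xv u v by auto
      qed
      ultimately show ?thesis using True by simp
    qed
  qed
qed

text \<open>Without a crossing, the pipe that is north-west at the bump remains so in both
  directions; at the two ends this compares entry columns and exit rows.\<close>

lemma bump_order:
  assumes u: "1 \<le> u" and v: "1 \<le> v" and b: "bumps (h u) (h v) t"
    and no: "\<And>d. \<not> (crosses (h u) (h v) d \<or> crosses (h v) (h u) d)"
  shows "u < v" and "exits_at (h u) r \<Longrightarrow> exits_at (h v) r' \<Longrightarrow> r < r'"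
proof -
  have uv: "u \<noteq> v" using b by (auto simp: bumps_def)
  note cb1 = crossing_between[OF path[OF u] path[OF v] disjoint[OF u v uv]]
    and cb2 = crossing_between[OF path[OF v] path[OF u] disjoint[OF v u uv[symmetric]]]
  show "u < v"
  proof (rule ccontr)
    assume "\<not> u < v"
    obtain d0 where d0: "\<And>d. d \<le> d0 \<Longrightarrow> h u d = int u - d" using pipe_initial[OF path[OF u]] by metis
    obtain d1 where d1: "\<And>d. d \<le> d1 \<Longrightarrow> h v d = int v - d" "d1 \<le> min d0 (t - 2)"
      using pipe_initial[OF path[OF v]] by metis
    show False using cb2[of d1 "t - 1"] no d0[of d1] d1(1)[of d1] d1(2) b \<open>\<not> u < v\<close> uv
      by (auto simp: bumps_def)
  qed
  assume r: "exits_at (h u) r" "exits_at (h v) r'"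
  show "r < r'"
  proof (rule ccontr)
    assume "\<not> r < r'"
    then have "r' < r" using r uv exits_at_distinct[OF u v] by (metis linorder_neqE_nat)
    obtain d0 where d0: "\<And>d. d0 \<le> d \<Longrightarrow> h u d = int r" using exits_at_final[OF r(1)] by metis
    obtain d1 where d1: "\<And>d. d1 \<le> d \<Longrightarrow> h v d = int r'" "max d0 (t + 2) \<le> d1"
      using exits_at_final[OF r(2)] by metis
    show False using cb1[of "t + 1" d1] no d0[of d1] d1(1)[of d1] d1(2) b \<open>r' < r\<close>
      by (auto simp: bumps_def)
  qed
qed

text \<open>The pipe \<open>u\<close> is north-west of \<open>v\<close> right before and right after they bump. So it comes from
  the west into a later crossing and leaves an earlier one to the north.\<close>

lemma bump_cross_orientation:
  assumes u: "1 \<le> u" and v: "1 \<le> v" and b: "bumps (h u) (h v) t"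
    and red: "reduced h" and c: "crosses (h u) (h v) t' \<or> crosses (h v) (h u) t'"
  shows "t < t' \<Longrightarrow> crosses (h u) (h v) t'" and "t' < t \<Longrightarrow> crosses (h v) (h u) t'"
proof -
  have uv: "u \<noteq> v" using b by (auto simp: bumps_def)
  note cb1 = crossing_between[OF path[OF u] path[OF v] disjoint[OF u v uv]]
    and cb2 = crossing_between[OF path[OF v] path[OF u] disjoint[OF v u uv[symmetric]]]
  have only: "d = t'" if "crosses (h u) (h v) d \<or> crosses (h v) (h u) d" for d
    using red u v c that unfolding reduced_def by blast
  show "crosses (h u) (h v) t'" if "t < t'"
  proof (rule ccontr)
    assume "\<not> crosses (h u) (h v) t'"
    then have vu: "crosses (h v) (h u) t'" using c by blast
    have 1: "h u (t + 1) < h v (t + 1)" "h v (t' - 1) < h u (t' - 1)" "h u t' = h v t'"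
      using vu b by (auto simp: crosses_def bumps_def)
    \<comment> \<open>The order on \<open>t' - 1\<close> is opposite to that on
      \<open>t + 1\<close>, and on \<open>t'\<close> the pipes meet. This excludes
      \<open>t' = t + 2\<close> and \<open>t' = t + 1\<close>, so that there is an interval in which
      to find a further crossing.\<close>
    then have "t + 1 \<noteq> t' - 1" "t + 1 \<noteq> t'" by (metis less_asym, metis less_irrefl)
    then show False using cb1[of "t + 1" "t' - 1"] only 1 that by force
  qed
  show "crosses (h v) (h u) t'" if "t' < t"
  proof (rule ccontr)
    assume "\<not> crosses (h v) (h u) t'"
    then have uv': "crosses (h u) (h v) t'" using c by blast
    have 1: "h v (t' + 1) < h u (t' + 1)" "h u (t - 1) < h v (t - 1)" "h u t = h v t"
      using uv' b by (auto simp: crosses_def bumps_def)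
    then have "t' + 1 \<noteq> t - 1" "t' + 1 \<noteq> t" by (metis less_asym, metis less_irrefl)
    then show False using cb2[of "t' + 1" "t - 1"] only 1 that by force
  qed
qed

end

lemma outside_standard_update:
  assumes "outside_standard n D" "D x \<noteq> id_tiling x" shows "outside_standard n (D(x := T))"
  using assms unfolding outside_standard_def by auto

lemma id_tiling_cases: "id_tiling x \<in> {blank, horizontal, vertical, r_elbow}"
  by (cases x) (auto simp: id_tiling_def)

section \<open>States of the insertion\<close>

text \<open>With \<open>s = (South, East)\<close> this describes the tilings before a min-droop at \<open>x\<close>, with
  \<open>s = (West, North)\<close> the tilings after a min-droop that ends in \<open>x\<close>.\<close>

definition state :: "nat \<Rightarrow> nat \<Rightarrow> perm \<Rightarrow> side \<times> side \<Rightarrow> tiling \<Rightarrow> cell \<Rightarrow> bool" where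
  "state n k \<pi> s D x \<longleftrightarrow> (\<exists>h. traced n D h \<pi> \<and> reduced h) \<and> (\<forall>y. y \<noteq> x \<longrightarrow> D y \<noteq> bump) \<and>
     s \<in> D x \<and> (\<exists>r\<le>k. exits_row D (x, s) r)"

lemma stateE:
  assumes "state n k \<pi> s D x"
  obtains h where "pipes D h" "traced n D h \<pi>" "reduced h" "outside_standard n D" "\<pi> permutes {1..n}"
    "\<And>y. y \<noteq> x \<Longrightarrow> D y \<noteq> bump" "s \<in> D x" "\<exists>r\<le>k. exits_row D (x, s) r"
  using assms unfolding state_def traced_def by blast

lemma (in pipes) bump_strands:
  assumes "D x = bump"
  obtains u v t where "1 \<le> u" "1 \<le> v" "u \<noteq> v" "bumps (h u) (h v) t" "x = cell_at (h u) t" "x = cell_at (h v) t"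
    "(x, (West, North)) = strand_at (h u) t" "(x, (South, East)) = strand_at (h v) t"
proof -
  obtain i j where x: "x = (i, j)" by fastforce
  obtain u v where uv: "1 \<le> u" "1 \<le> v" "h u (int j - int i) = int i" "bumps (h u) (h v) (int j - int i)"
    using assms unfolding x bump_iff by blast
  then have "x = cell_at (h u) (int j - int i)" "x = cell_at (h v) (int j - int i)"
    by (auto simp: x cell_at_def bumps_def)
  moreover have "u \<noteq> v" using uv(4) by (auto simp: bumps_def)
  ultimately show ?thesis using that[of u v "int j - int i"] uv
    by (auto simp: strand_at_def bumps_def entry_side_def exit_side_def)
qed

text \<open>A cross-bump-swap exchanges tails at the bump and again at the crossing. The two
  exchanges cancel beyond both points, so all exits stay, and one crossing is lost while one is
  gained, so the system stays reduced. The current pipe keeps its exit but changes from one kind of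
  turn to the other. Both values of \<open>s\<close> are covered because a swap, being its own
  inverse, serves the forward and the inverse process alike.\<close>

lemma swap_state:
  assumes st: "state n k \<pi> s D x" and bx: "D x = bump" and cr: "bump_pipes_cross_at D x y"
    and s': "s' = (if s = (West, North) then (South, East) else (West, North))"
  shows "state n k \<pi> s' (cross_bump_swap D x y) y \<and> cross_bump_swap D x y y = bump \<and>
    bump_pipes_cross_at (cross_bump_swap D x y) y x \<and> x \<noteq> y \<and> D y = cross"
proof -
  obtain h where h: "pipes D h" "traced n D h \<pi>" "reduced h" "outside_standard n D" "\<pi> permutes {1..n}"
    "\<And>y. y \<noteq> x \<Longrightarrow> D y \<noteq> bump" "s \<in> D x" "\<exists>r\<le>k. exits_row D (x, s) r"
    using stateE[OF st] by metis
  interpret pipes D h by fact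
  obtain u v t where u: "1 \<le> u" and v: "1 \<le> v" and uv: "u \<noteq> v" and b: "bumps (h u) (h v) t"
    and x: "x = cell_at (h u) t" "x = cell_at (h v) t"
    and WN: "(x, (West, North)) = strand_at (h u) t" and SE: "(x, (South, East)) = strand_at (h v) t"
    using bump_strands[OF bx] by metis
  obtain t' where y: "y = cell_at (h u) t'" and c: "crosses (h u) (h v) t' \<or> crosses (h v) (h u) t'"
    using cr unfolding bump_pipes_cross_at_def WN SE cross_at_iff[OF u v] by blast
  have tt: "t \<noteq> t'" using b c by (auto simp: bumps_def crosses_def)
  have xy: "x \<noteq> y" using tt x y cell_at_iff[OF u] by (metis surj_pair)
  have eq: "h u t = h v t" "h u t' = h v t'" using b c by (auto simp: bumps_def crosses_def)
  have Dy: "D y = cross" unfolding y using meeting_bump_or_cross[OF u v uv eq(2)] c by simp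
  define h1 where "h1 = exchange t u v h"
  define D1 where "D1 = D(x := cross)"
  have p1: "pipes D1 h1" using exchange_pipes[OF u v uv eq(1)] bx x(1) unfolding h1_def D1_def toggle_def by simp
  interpret p1: pipes D1 h1 by (rule p1)
  have eq1: "h1 u t' = h1 v t'" and y1: "cell_at (h1 u) t' = y"
    using eq(2) y by (auto simp: h1_def exchange_def cell_at_def)
  define h2 where "h2 = exchange t' u v h1"
  define D2 where "D2 = cross_bump_swap D x y"
  have "D1 y = cross" using xy Dy by (simp add: D1_def)
  then have p2: "pipes D2 h2"
    using p1.exchange_pipes[OF u v uv eq1] unfolding y1 h2_def D2_def toggle_def cross_bump_swap_def D1_def by simp
  interpret p2: pipes D2 h2 by (rule p2)
  have h2: "h2 c d = (if d \<le> t' then (if d \<le> t then h c d else h (transpose u v c) d)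
      else (if d \<le> t then h (transpose u v c) d else h c d))" for c d
    unfolding h2_def h1_def exchange_def by simp
  have ex2: "exits_at (h2 c) r \<longleftrightarrow> exits_at (h c) r" for c r
    unfolding h2_def h1_def exits_at_exchange by simp
  have D2xy: "D2 x = cross" "D2 y = bump" using xy by (auto simp: D2_def cross_bump_swap_def)
  have "outside_standard n D1"
    unfolding D1_def using h(4) bx id_tiling_cases[of x] by (intro outside_standard_update) auto
  then have "outside_standard n (D1(y := bump))"
    using \<open>D1 y = cross\<close> id_tiling_cases[of y] by (intro outside_standard_update) auto
  then have out2: "outside_standard n D2" by (simp add: D2_def cross_bump_swap_def D1_def)
  have tr2: "traced n D2 h2 \<pi>" using h(2) out2 p2 unfolding traced_def ex2 by blast
  have "crossings D2 = insert x (crossings D - {y})"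
    using bx xy by (auto simp: crossings_def D2_def cross_bump_swap_def)
  moreover have "y \<in> crossings D" "x \<notin> crossings D" using Dy bx by (auto simp: crossings_def)
  moreover have "0 < card (crossings D)" using finite_crossings[OF h(4)] calculation(2) card_gt_0_iff by blast
  ultimately have "card (crossings D2) = card (crossings D)"
    using finite_crossings[OF h(4)] by simp
  then have red2: "reduced h2"
    using perm_length_eq_iff_reduced[OF h(2)] perm_length_eq_iff_reduced[OF tr2] h(3) by simp
  have eq2: "h2 u t = h2 v t" "h2 u t' = h2 v t'" using eq by (auto simp: h2)
  have "h (transpose u v c) t = h c t" for c using eq(1) by (simp add: transpose_def)
  then have mid: "h2 c d = h (transpose u v c) d" if "t \<le> d \<and> d \<le> t' \<or> t' < d \<and> d \<le> t" for c d
    using that by (cases "d = t") (auto simp: h2)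
  have outer: "h2 c d = h c d" if "d \<le> t \<and> d \<le> t' \<or> d > t \<and> d > t'" for c d
    using that by (auto simp: h2)
  have y2: "y = cell_at (h2 u) t'" "y = cell_at (h2 v) t'" using y eq eq2(2) by (auto simp: h2 cell_at_def)
  \<comment> \<open>Between the two meetings the pipes now use each other's routes. So at
    \<open>y\<close> each takes exactly one side from the other pipe, and the orientation of the old
    crossing determines the turns.\<close>
  have sides: "entry_side (h2 u) t' = South \<and> exit_side (h2 u) t' = East \<and>
      entry_side (h2 v) t' = West \<and> exit_side (h2 v) t' = North"
  proof (cases "t < t'")
    case True
    then have "crosses (h u) (h v) t'" using bump_cross_orientation(1)[OF u v b h(3) c] by simp
    then show ?thesis
      using True eq(2) mid[of "t' - 1" u] mid[of "t' - 1" v] outer[of "t' + 1" u] outer[of "t' + 1" v] mid[of t' u] mid[of t' v]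
      by (simp add: crosses_def)
  next
    case False
    then have "t' < t" using tt by simp
    then have "crosses (h v) (h u) t'" using bump_cross_orientation(2)[OF u v b h(3) c] by simp
    then show ?thesis
      using \<open>t' < t\<close> eq(2) outer[of "t' - 1" u] outer[of "t' - 1" v] mid[of "t' + 1" u] mid[of "t' + 1" v]
        outer[of t' u] outer[of t' v]
      by (simp add: crosses_def)
  qed
  then have SE2: "(y, (South, East)) = strand_at (h2 u) t'" and WN2: "(y, (West, North)) = strand_at (h2 v) t'"
    using y2 by (auto simp: strand_at_def)
  have ss: "s = (West, North) \<or> s = (South, East)" using h(7) bx by (auto simp: bump_def)
  then have "\<exists>r\<le>k. exits_row D2 (y, s') r"
  proof
    assume s: "s = (West, North)"
    have "\<exists>r\<le>k. exits_at (h u) r" using h(8) unfolding s WN exits_row_iff[OF u] .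
    moreover have s'_eq: "s' = (South, East)" using s' s by simp
    ultimately show ?thesis unfolding s'_eq SE2 p2.exits_row_iff[OF u] ex2 by simp
  next
    assume s: "s = (South, East)"
    have "\<exists>r\<le>k. exits_at (h v) r" using h(8) unfolding s SE exits_row_iff[OF v] .
    moreover have s'_eq: "s' = (West, North)" using s' s by simp
    ultimately show ?thesis unfolding s'_eq WN2 p2.exits_row_iff[OF v] ex2 by simp
  qed
  moreover have "s' \<in> D2 y" using D2xy s' by (auto simp: bump_def)
  moreover have "D2 z \<noteq> bump" if "z \<noteq> y" for z
    using that h(6)[of z] by (cases "z = x") (auto simp: D2_def cross_bump_swap_def)
  ultimately have "state n k \<pi> s' D2 y" unfolding state_def using tr2 red2 by blast
  moreover have "bump_pipes_cross_at D2 y x"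
  proof -
    have "cell_at (h2 v) t = x" "cell_at (h2 u) t = x"
      using x eq by (auto simp: h2 cell_at_def)
    moreover have "crosses (h2 v) (h2 u) t \<or> crosses (h2 u) (h2 v) t"
      using p2.meeting_bump_or_cross[OF u v uv eq2(1)] calculation D2xy(1) by (auto split: if_splits)
    ultimately show ?thesis
      unfolding bump_pipes_cross_at_def SE2 WN2 p2.cross_at_iff[OF v u] by metis
  qed
  ultimately show ?thesis using D2xy xy Dy unfolding D2_def by blast
qed

text \<open>This reverses the case in which the bumping pipes do not cross: if the pipe with the
  r-turn exits from a row at most \<open>k\<close>, so does the other one.\<close>

lemma bump_exits_order:
  assumes tr: "traced n D h \<pi>" and bx: "D x = bump" and no: "\<nexists>y. bump_pipes_cross_at D x y"
    and ex: "exits_row D (x, (South, East)) r"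
  shows "\<exists>r'<r. exits_row D (x, (West, North)) r'"
proof -
  interpret pipes D h using tr by (simp add: traced_def)
  obtain u v t where u: "1 \<le> u" and v: "1 \<le> v" and uv: "u \<noteq> v" and b: "bumps (h u) (h v) t"
    and x: "x = cell_at (h u) t" "x = cell_at (h v) t"
    and WN: "(x, (West, North)) = strand_at (h u) t" and SE: "(x, (South, East)) = strand_at (h v) t"
    using bump_strands[OF bx] by metis
  have no': "\<not> (crosses (h u) (h v) d \<or> crosses (h v) (h u) d)" for d
    using no unfolding bump_pipes_cross_at_def WN SE cross_at_iff[OF u v] by blast
  obtain r' where "exits_at (h u) r'" using exits_at_exists[OF path[OF u]] by blast
  then show ?thesis
    using bump_order(2)[OF u v b no'] ex unfolding WN SE exits_row_iff[OF u] exits_row_iff[OF v] by blast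
qed

definition stop_cond :: "nat \<Rightarrow> tiling \<Rightarrow> cell \<Rightarrow> bool" where
  "stop_cond k D x \<longleftrightarrow> D x = bump \<and> (\<nexists>y. bump_pipes_cross_at D x y) \<and>
     \<not> (\<exists>r\<le>k. exits_row D (x, (South, East)) r)"

text \<open>Replacing the bump exchanges the tails of two pipes with exits \<open>a \<le> k\<close>
  and \<open>b > k\<close>. The length grows because these pipes do not cross, and it is at most the
  new number of crossings, which is the old length plus 1. Hence it grows by exactly 1, and the
  result is both a cover and reduced.\<close>

lemma stop_result:
  assumes st: "state n k \<pi> (West, North) D x" and stop: "stop_cond k D x"
  obtains m h a b t where "1 \<le> a" "a \<le> k" "k < b" "traced m (D(x := cross)) h (\<pi> \<circ> transpose a b)"
    "reduced h" "\<And>y. (D(x := cross)) y \<noteq> bump" "k_cover k \<pi> (\<pi> \<circ> transpose a b)"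
    "1 \<le> \<pi> a" "1 \<le> \<pi> b" "crosses (h (\<pi> a)) (h (\<pi> b)) t \<or> crosses (h (\<pi> b)) (h (\<pi> a)) t" "x = cell_at (h (\<pi> a)) t"
proof -
  obtain h where h: "pipes D h" "traced n D h \<pi>" "reduced h" "outside_standard n D" "\<pi> permutes {1..n}"
    "\<And>y. y \<noteq> x \<Longrightarrow> D y \<noteq> bump" "\<exists>r\<le>k. exits_row D (x, (West, North)) r"
    using stateE[OF st] by metis
  interpret pipes D h by fact
  have bx: "D x = bump" and no: "\<nexists>y. bump_pipes_cross_at D x y" using stop by (auto simp: stop_cond_def)
  obtain u v t where u: "1 \<le> u" and v: "1 \<le> v" and uv: "u \<noteq> v" and bmp: "bumps (h u) (h v) t"
    and x: "x = cell_at (h u) t" "x = cell_at (h v) t"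
    and WN: "(x, (West, North)) = strand_at (h u) t" and SE: "(x, (South, East)) = strand_at (h v) t"
    using bump_strands[OF bx] by metis
  have no': "\<not> (crosses (h u) (h v) d \<or> crosses (h v) (h u) d)" for d
    using no unfolding bump_pipes_cross_at_def WN SE cross_at_iff[OF u v] by blast
  define a where "a = inv \<pi> u" define b where "b = inv \<pi> v"
  have ab: "1 \<le> a" "1 \<le> b" "exits_at (h u) a" "exits_at (h v) b" "\<pi> a = u" "\<pi> b = v"
    using traced_exits[OF h(2)] u v h(5) permutes_inverses unfolding a_def b_def by metis+
  have ak: "a \<le> k" using h(7) ab(3) exits_at_unique unfolding WN exits_row_iff[OF u] by blast
  have kb: "k < b" using stop ab(4) not_le unfolding stop_cond_def SE exits_row_iff[OF v] by blast
  have eq: "h u t = h v t" using bmp by (auto simp: bumps_def)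
  define h' where "h' = exchange t u v h"
  define D' where "D' = D(x := cross)"
  \<comment> \<open>The exit \<open>b\<close> may lie beyond the window, and then the new
    permutation moves it.\<close>
  define m where "m = max n b"
  define \<sigma> where "\<sigma> = \<pi> \<circ> transpose a b"
  have p': "pipes D' h'" using exchange_pipes[OF u v uv eq] bx x(1) unfolding h'_def D'_def toggle_def by simp
  have "outside_standard n D'" unfolding D'_def using h(4) bx id_tiling_cases[of x]
    by (intro outside_standard_update) auto
  then have out': "outside_standard m D'" by (rule outside_standard_mono) (simp add: m_def)
  have pm: "\<sigma> permutes {1..m}" unfolding \<sigma>_def
  proof (rule permutes_compose)
    show "transpose a b permutes {1..m}" using ab ak kb by (intro permutes_swap_id) (auto simp: m_def)
    show "\<pi> permutes {1..m}" using h(5) by (rule permutes_subset) (auto simp: m_def)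
  qed
  have "transpose u v (\<sigma> r) = \<pi> r" for r
    using ab(5,6) inj_eq[OF permutes_inj[OF h(5)]] uv by (auto simp: \<sigma>_def transpose_def)
  then have tr': "traced m D' h' \<sigma>"
    using h(2) p' out' pm unfolding traced_def h'_def exits_at_exchange by simp
  have "\<pi> a < \<pi> b" using bump_order(1)[OF u v bmp no'] ab by simp
  then have "perm_length \<pi> < perm_length \<sigma>"
    unfolding \<sigma>_def using perm_length_transpose[OF h(5)] ab ak kb by simp
  moreover have "crossings D' = insert x (crossings D)" "x \<notin> crossings D"
    using bx by (auto simp: crossings_def D'_def)
  then have "card (crossings D') = perm_length \<pi> + 1"
    using finite_crossings[OF h(4)] perm_length_eq_iff_reduced[OF h(2)] h(3) by simp
  moreover have "perm_length \<sigma> \<le> card (crossings D')" using perm_length_le_crossings[OF tr'] .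
  ultimately have len: "perm_length \<sigma> = perm_length \<pi> + 1" "card (crossings D') = perm_length \<sigma>" by auto
  have red': "reduced h'" using perm_length_eq_iff_reduced[OF tr'] len by simp
  have "k_cover k \<pi> \<sigma>" unfolding k_cover_def using ab ak kb len(1) \<sigma>_def by blast
  moreover have "D' y \<noteq> bump" for y using h(6)[of y] by (auto simp: D'_def)
  moreover have eq': "h' u t = h' v t" "x = cell_at (h' u) t" using eq x by (auto simp: h'_def exchange_def cell_at_def)
  moreover have "crosses (h' u) (h' v) t \<or> crosses (h' v) (h' u) t"
    using pipes.meeting_bump_or_cross[OF p' u v uv eq'(1)] eq'(2) by (auto simp: D'_def split: if_splits)
  ultimately show ?thesis
    using that[of a b m h' t] tr' red' ab ak kb u v unfolding D'_def \<sigma>_def by metis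
qed

text \<open>A position \<open>b > n\<close> is a fixed point, and entries larger than
  \<open>b\<close> are fixed points further right, so \<open>b\<close> cannot be the right end of an
  inversion.\<close>

lemma permutes_transpose_shrink:
  assumes s: "\<sigma> permutes {1..n::nat}" and ab: "1 \<le> a" "a < b" "\<sigma> b < \<sigma> a"
  shows "\<sigma> \<circ> transpose a b permutes {1..n}"
proof -
  have "b \<le> n"
  proof (rule ccontr)
    assume "\<not> b \<le> n"
    then have "\<sigma> b = b" using permutes_not_in[OF s, of b] by simp
    then have "n < \<sigma> a" using ab \<open>\<not> b \<le> n\<close> by simp
    then have "\<sigma> a = a" using permutes_in_image[OF s, of a] permutes_not_in[OF s, of a] by auto
    then show False using ab \<open>\<sigma> b = b\<close> by simp
  qed
  then show ?thesis using ab s by (intro permutes_compose permutes_swap_id) auto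
qed

text \<open>Going down a cover removes an inversion and hence does not leave the window. So all
  permutations in a chain live in the window of the last one.\<close>

lemma k_cover_shrink:
  assumes "\<sigma> permutes {1..n}" "k_cover k \<pi> \<sigma>"
  obtains a b where "1 \<le> a" "a \<le> k" "k < b" "\<sigma> = \<pi> \<circ> transpose a b" "\<pi> = \<sigma> \<circ> transpose a b"
    "\<sigma> b < \<sigma> a" "perm_length \<sigma> = perm_length \<pi> + 1" "\<pi> permutes {1..n}"
proof -
  obtain a b where ab: "1 \<le> a" "a \<le> k" "k < b" "\<sigma> = \<pi> \<circ> transpose a b" and len: "perm_length \<sigma> = perm_length \<pi> + 1"
    using assms(2) unfolding k_cover_def by blast
  from ab(4) have inv: "\<pi> = \<sigma> \<circ> transpose a b" by (simp add: comp_assoc)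
  have "\<sigma> a \<noteq> \<sigma> b" using inj_eq[OF permutes_inj[OF assms(1)], of a b] ab(2,3) by simp
  moreover have "\<not> \<sigma> a < \<sigma> b" using perm_length_transpose[OF assms(1), of a b] ab(1-3) len unfolding inv[symmetric] by auto
  ultimately have "\<sigma> b < \<sigma> a" by simp
  moreover from this have "\<pi> permutes {1..n}" unfolding inv using permutes_transpose_shrink[OF assms(1)] ab(1-3) by simp
  ultimately show ?thesis using that ab len inv by blast
qed

text \<open>The positions \<open>a \<le> k < b\<close> of the cover are inverted in
  \<open>\<sigma>\<close>, so the pipes exiting there cross, and only once. Turning this crossing
  into a bump exchanges their exits: the pipe with the W-N turn gets exit \<open>a\<close> and the
  one with the S-E turn gets \<open>b\<close>, which are the two conditions on exits at a
  stop.\<close>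

lemma unstop:
  assumes D: "D \<in> bpds n \<sigma>" and pm: "\<sigma> permutes {1..n}" and cov: "k_cover k \<pi> \<sigma>"
  obtains x where "state n k \<pi> (West, North) (D(x := bump)) x" "stop_cond k (D(x := bump)) x" "D x = cross"
proof -
  obtain a b where ab: "1 \<le> a" "a \<le> k" "k < b" "\<sigma> = \<pi> \<circ> transpose a b" "\<pi> = \<sigma> \<circ> transpose a b"
    "\<sigma> b < \<sigma> a" "perm_length \<sigma> = perm_length \<pi> + 1" "\<pi> permutes {1..n}"
    using k_cover_shrink[OF pm cov] by metis
  obtain h where h: "traced n D h \<sigma>" "reduced h" "\<And>x. D x \<noteq> bump" using bpds_trace[OF D pm] by metis
  interpret pipes D h using h(1) by (simp add: traced_def)
  define u where "u = \<sigma> b" define v where "v = \<sigma> a"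
  have u: "1 \<le> u" and v: "1 \<le> v" using permutes_ge_1[OF pm] ab(1-3) by (auto simp: u_def v_def)
  have uv: "u < v" "u \<noteq> v" using ab(6) by (auto simp: u_def v_def)
  have ex: "exits_at (h u) b" "exits_at (h v) a" using h(1) ab(1-3) by (auto simp: traced_def u_def v_def)
  obtain d0 where d0: "\<And>d. d \<le> d0 \<Longrightarrow> h u d = int u - d" using pipe_initial[OF path[OF u]] by metis
  obtain d1 where d1: "\<And>d. d \<le> d1 \<Longrightarrow> h v d = int v - d" "d1 \<le> d0" using pipe_initial[OF path[OF v]] by metis
  obtain e0 where e0: "\<And>d. e0 \<le> d \<Longrightarrow> h u d = int b" using exits_at_final[OF ex(1)] by metis
  obtain e1 where e1: "\<And>d. e1 \<le> d \<Longrightarrow> h v d = int a" "max e0 (d1 + 1) \<le> e1" using exits_at_final[OF ex(2)] by metis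
  obtain t where t: "crosses (h u) (h v) t"
    using crossing_between[OF path[OF u] path[OF v] disjoint[OF u v uv(2)], of d1 e1]
      d0[of d1] d1(1)[of d1] e0[of e1] e1(1)[of e1] d1(2) e1(2) uv ab(2,3) by auto
  define x where "x = cell_at (h u) t"
  have eq: "h u t = h v t" using t by (auto simp: crosses_def)
  have Dx: "D x = cross" unfolding x_def using meeting_bump_or_cross[OF u v uv(2) eq] t by simp
  define h' where "h' = exchange t u v h"
  define D' where "D' = D(x := bump)"
  have p': "pipes D' h'" using exchange_pipes[OF u v uv(2) eq] Dx unfolding h'_def D'_def toggle_def x_def by simp
  interpret p': pipes D' h' by (rule p')
  have out': "outside_standard n D'" unfolding D'_def using h(1) Dx id_tiling_cases[of x]
    by (intro outside_standard_update) (auto simp: traced_def)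
  have "transpose u v (\<pi> r) = \<sigma> r" for r
    using inj_eq[OF permutes_inj[OF pm]] uv(2) by (auto simp: ab(5) u_def v_def transpose_def)
  then have tr': "traced n D' h' \<pi>"
    using h(1) p' out' ab(8) unfolding traced_def h'_def exits_at_exchange by simp
  have "crossings D' = crossings D - {x}" "x \<in> crossings D" using Dx by (auto simp: crossings_def D'_def)
  then have "card (crossings D') = perm_length \<pi>"
    using h perm_length_eq_iff_reduced[OF h(1)] ab(7) finite_crossings[of n D] by (simp add: traced_def)
  then have red': "reduced h'" using perm_length_eq_iff_reduced[OF tr'] by simp
  have eq': "h' u t = h' v t" "cell_at (h' u) t = x" "cell_at (h' v) t = x"
    using eq by (auto simp: h'_def exchange_def cell_at_def x_def)
  have "entry_side (h' u) t = West" "exit_side (h' u) t = North" "entry_side (h' v) t = South" "exit_side (h' v) t = East"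
    using t by (auto simp: h'_def exchange_def crosses_def)
  then have WN: "(x, (West, North)) = strand_at (h' u) t" and SE: "(x, (South, East)) = strand_at (h' v) t"
    using eq' by (auto simp: strand_at_def)
  have ex': "exits_at (h' u) a" "exits_at (h' v) b" using ex unfolding h'_def exits_at_exchange by simp_all
  have D'x: "D' x = bump" by (simp add: D'_def)
  have "state n k \<pi> (West, North) D' x"
    unfolding state_def
  proof (intro conjI)
    show "\<exists>h. traced n D' h \<pi> \<and> reduced h" using tr' red' by blast
    show "\<forall>y. y \<noteq> x \<longrightarrow> D' y \<noteq> bump" using h(3) by (simp add: D'_def)
    show "(West, North) \<in> D' x" by (simp add: D'x bump_def)
    show "\<exists>r\<le>k. exits_row D' (x, (West, North)) r" unfolding WN p'.exits_row_iff[OF u] using ex' ab(2) by blast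
  qed
  moreover have "stop_cond k D' x"
    unfolding stop_cond_def
  proof (intro conjI)
    show "D' x = bump" by (simp add: D'_def)
    show "\<not> (\<exists>r\<le>k. exits_row D' (x, (South, East)) r)"
      unfolding SE p'.exits_row_iff[OF v] using ex'(2) ab(3) exits_at_unique leD by metis
    show "\<nexists>y. bump_pipes_cross_at D' x y"
    proof
      assume "\<exists>y. bump_pipes_cross_at D' x y"
      then obtain d where d: "crosses (h' u) (h' v) d \<or> crosses (h' v) (h' u) d"
        unfolding bump_pipes_cross_at_def WN SE p'.cross_at_iff[OF u v] by blast
      have "d \<noteq> t" using d \<open>exit_side (h' u) t = North\<close> \<open>entry_side (h' u) t = West\<close> by (auto simp: crosses_def)
      \<comment> \<open>Away from \<open>t\<close> the exchange only interchanges the names of the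
        two pipes, so a crossing left in \<open>D'\<close> would be a second crossing in
        \<open>D\<close>.\<close>
      have "crosses (h u) (h v) d \<or> crosses (h v) (h u) d"
      proof (cases "d < t")
        case True
        then show ?thesis using d by (simp add: crosses_def h'_def exchange_def)
      next
        case False
        then have "t < d" using \<open>d \<noteq> t\<close> by simp
        then show ?thesis using d eq by (cases "d - 1 = t") (auto simp: crosses_def h'_def exchange_def)
      qed
      then have "d = t" using h(2) u v t unfolding reduced_def by blast
      then show False using \<open>d \<noteq> t\<close> by simp
    qed
  qed
  ultimately show ?thesis using that Dx unfolding D'_def by blast
qed

text \<open>The common result has one permutation, which together with \<open>\<pi>\<close>
  determines the transposition, hence the two pipes, hence by reducedness the cell where they cross.
  This is the cell of the former bump.\<close>

lemma stop_injective:
  assumes st: "state n k \<pi> (West, North) D x" and stop: "stop_cond k D x"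
    and st': "state m k \<pi> (West, North) E y" and stop': "stop_cond k E y"
    and eq: "D(x := cross) = E(y := cross)"
  shows "D = E \<and> x = y"
proof -
  obtain m1 h a b t where h: "1 \<le> a" "a \<le> k" "k < b" "traced m1 (D(x := cross)) h (\<pi> \<circ> transpose a b)"
    "reduced h" "\<And>y. (D(x := cross)) y \<noteq> bump"
    "1 \<le> \<pi> a" "1 \<le> \<pi> b" "crosses (h (\<pi> a)) (h (\<pi> b)) t \<or> crosses (h (\<pi> b)) (h (\<pi> a)) t" "x = cell_at (h (\<pi> a)) t"
    using stop_result[OF st stop] by metis
  obtain m2 g a' b' t' where g: "1 \<le> a'" "a' \<le> k" "k < b'" "traced m2 (E(y := cross)) g (\<pi> \<circ> transpose a' b')"
    "reduced g" "\<And>z. (E(y := cross)) z \<noteq> bump"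
    "1 \<le> \<pi> a'" "1 \<le> \<pi> b'" "crosses (g (\<pi> a')) (g (\<pi> b')) t' \<or> crosses (g (\<pi> b')) (g (\<pi> a')) t'" "y = cell_at (g (\<pi> a')) t'"
    using stop_result[OF st' stop'] by metis
  have "pipes (D(x := cross)) h" "pipes (D(x := cross)) g" using h(4) g(4) eq by (auto simp: traced_def)
  then have gh: "g c = h c" if "1 \<le> c" for c using pipes_unique that by metis
  have "traced m2 (D(x := cross)) h (\<pi> \<circ> transpose a' b')"
    using g(4) eq h(4) gh permutes_ge_1[of "\<pi> \<circ> transpose a' b'" m2] unfolding traced_def by (metis (no_types, lifting))
  then have "\<pi> \<circ> transpose a b = \<pi> \<circ> transpose a' b'" using traced_unique[OF h(4)] by blast
  then have "transpose a b = transpose a' b'"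
    using st permutes_inj by (metis (no_types, lifting) fun.inj_map_strong inj_eq state_def traced_def comp_apply ext)
  then have "transpose a b a = transpose a' b' a" by simp
  \<comment> \<open>A transposition only gives an unordered pair; \<open>k\<close> separates its two
    elements.\<close>
  then have "a = a' \<and> b = b'" using h(2,3) g(2,3) by (auto simp: transpose_def split: if_splits)
  then have "t = t'" using h(5,7,8,9) g(9) gh[OF h(7)] gh[OF h(8)] unfolding reduced_def by metis
  then have xy: "x = y" using h(10) g(10) \<open>a = a' \<and> b = b'\<close> gh[OF h(7)] by simp
  have "D x = bump" "E y = bump" using stop stop' by (auto simp: stop_cond_def)
  then have "D = (D(x := cross))(x := bump)" "E = (E(y := cross))(y := bump)" by (auto simp: fun_eq_iff)
  then show ?thesis using eq xy by metis
qed

section \<open>Min-droops\<close>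

text \<open>Only the border of the rectangle is constrained, since a droop leaves the interior as it
  is. With the border in this form, the moved pipe takes free edges only, and each corner tile
  before the move determines the one after it and conversely. The mirror image
  \<open>undroop_config\<close> describes the border afterwards.\<close>

definition droop_config :: "tiling \<Rightarrow> nat \<Rightarrow> nat \<Rightarrow> nat \<Rightarrow> nat \<Rightarrow> bool" where
  "droop_config D a b a' b' \<longleftrightarrow> a < a' \<and> b < b' \<and>
     (\<forall>i. a < i \<and> i < a' \<longrightarrow> D (i, b) = cross \<and> D (i, b') = horizontal) \<and>
     (\<forall>j. b < j \<and> j < b' \<longrightarrow> D (a, j) = cross \<and> D (a', j) = vertical) \<and>
     D (a, b) \<in> {r_elbow, bump} \<and> D (a', b) \<in> {vertical, j_elbow} \<and>
     D (a, b') \<in> {horizontal, j_elbow} \<and> D (a', b') \<in> {blank, r_elbow}"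

definition undroop_config :: "tiling \<Rightarrow> nat \<Rightarrow> nat \<Rightarrow> nat \<Rightarrow> nat \<Rightarrow> bool" where
  "undroop_config D a b a' b' \<longleftrightarrow> a < a' \<and> b < b' \<and>
     (\<forall>i. a < i \<and> i < a' \<longrightarrow> D (i, b) = horizontal \<and> D (i, b') = cross) \<and>
     (\<forall>j. b < j \<and> j < b' \<longrightarrow> D (a, j) = vertical \<and> D (a', j) = cross) \<and>
     D (a, b) \<in> {blank, j_elbow} \<and> D (a', b) \<in> {r_elbow, horizontal} \<and>
     D (a, b') \<in> {r_elbow, vertical} \<and> D (a', b') \<in> {j_elbow, bump}"

text \<open>A min-droop written with names of tiles in place of operations on segments, so that
  \<open>undroop\<close> is seen to invert it corner by corner.\<close>

definition droop :: "nat \<Rightarrow> nat \<Rightarrow> nat \<Rightarrow> nat \<Rightarrow> tiling \<Rightarrow> tiling" where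
  "droop a b a' b' D = (\<lambda>(i, j).
     if (i, j) = (a, b) then if D (a, b) = r_elbow then blank else j_elbow
     else if (i, j) = (a', b) then if D (a', b) = vertical then r_elbow else horizontal
     else if (i, j) = (a, b') then if D (a, b') = horizontal then r_elbow else vertical
     else if (i, j) = (a', b') then if D (a', b') = blank then j_elbow else bump
     else if j = b \<and> a < i \<and> i < a' then horizontal
     else if i = a \<and> b < j \<and> j < b' then vertical
     else if i = a' \<and> b < j \<and> j < b' then cross
     else if j = b' \<and> a < i \<and> i < a' then cross
     else D (i, j))"

definition undroop :: "nat \<Rightarrow> nat \<Rightarrow> nat \<Rightarrow> nat \<Rightarrow> tiling \<Rightarrow> tiling" where
  "undroop a b a' b' D = (\<lambda>(i, j).
     if (i, j) = (a, b) then if D (a, b) = blank then r_elbow else bump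
     else if (i, j) = (a', b) then if D (a', b) = r_elbow then vertical else j_elbow
     else if (i, j) = (a, b') then if D (a, b') = r_elbow then horizontal else j_elbow
     else if (i, j) = (a', b') then if D (a', b') = j_elbow then blank else r_elbow
     else if j = b \<and> a < i \<and> i < a' then cross
     else if i = a \<and> b < j \<and> j < b' then cross
     else if i = a' \<and> b < j \<and> j < b' then vertical
     else if j = b' \<and> a < i \<and> i < a' then horizontal
     else D (i, j))"

lemma tile_ops:
  "r_elbow - {(South, East)} = blank" "bump - {(South, East)} = j_elbow" "bump - {(West, North)} = r_elbow"
  "vertical - {(South, North)} = blank" "horizontal - {(West, East)} = blank" "j_elbow - {(West, North)} = blank"
  "cross - {(South, North)} = horizontal" "cross - {(West, East)} = vertical"
  "blank \<union> {(South, East)} = r_elbow" "blank \<union> {(West, East)} = horizontal"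
  "blank \<union> {(South, North)} = vertical" "blank \<union> {(West, North)} = j_elbow"
  "r_elbow \<union> {(West, North)} = bump" "j_elbow \<union> {(South, East)} = bump"
  "vertical \<union> {(West, East)} = cross" "horizontal \<union> {(South, North)} = cross"
  by (auto simp: tile_defs)

lemma tile_ends:
  "(x, North) \<in> vertical \<longleftrightarrow> x = South" "(x, North) \<in> j_elbow \<longleftrightarrow> x = West"
  "(West, y) \<in> horizontal \<longleftrightarrow> y = East" "(West, y) \<in> j_elbow \<longleftrightarrow> y = North"
  "(x, East) \<in> r_elbow \<longleftrightarrow> x = South" "(x, East) \<in> horizontal \<longleftrightarrow> x = West"
  "(South, y) \<in> r_elbow \<longleftrightarrow> y = East" "(South, y) \<in> vertical \<longleftrightarrow> y = North"
  by (auto simp: tile_defs)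

lemma rectangle_cases [case_names a_b a'_b a_b' a'_b' left top bottom right other]:
  fixes a b a' b' i j :: nat
  obtains "i = a" "j = b" | "i = a'" "j = b" | "i = a" "j = b'" | "i = a'" "j = b'"
    | "j = b" "a < i" "i < a'" | "i = a" "b < j" "j < b'" | "i = a'" "b < j" "j < b'" | "j = b'" "a < i" "i < a'"
    | "(i, j) \<noteq> (a, b)" "(i, j) \<noteq> (a', b)" "(i, j) \<noteq> (a, b')" "(i, j) \<noteq> (a', b')"
        "\<not> (j = b \<and> a < i \<and> i < a')" "\<not> (i = a \<and> b < j \<and> j < b')" "\<not> (i = a' \<and> b < j \<and> j < b')"
        "\<not> (j = b' \<and> a < i \<and> i < a')"
proof (rule ccontr)
  assume n: "\<not> thesis"
  show False
    by (rule notE[OF n], rule that(9))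
      (use n that(1) in blast, use n that(2) in blast, use n that(3) in blast, use n that(4) in blast,
       use n that(5) in blast, use n that(6) in blast, use n that(7) in blast, use n that(8) in blast)
qed

lemma droop_configD:
  assumes "droop_config D a b a' b'"
  shows "a < a'" "b < b'" "D (a, b) = r_elbow \<or> D (a, b) = bump" "D (a', b) = vertical \<or> D (a', b) = j_elbow"
    "D (a, b') = horizontal \<or> D (a, b') = j_elbow" "D (a', b') = blank \<or> D (a', b') = r_elbow"
    "a < i \<Longrightarrow> i < a' \<Longrightarrow> D (i, b) = cross" "b < j \<Longrightarrow> j < b' \<Longrightarrow> D (a, j) = cross"
    "b < j \<Longrightarrow> j < b' \<Longrightarrow> D (a', j) = vertical" "a < i \<Longrightarrow> i < a' \<Longrightarrow> D (i, b') = horizontal"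
  using assms by (auto simp: droop_config_def)

lemma undroop_configD:
  assumes "undroop_config D a b a' b'"
  shows "a < a'" "b < b'" "D (a, b) = blank \<or> D (a, b) = j_elbow" "D (a', b) = r_elbow \<or> D (a', b) = horizontal"
    "D (a, b') = r_elbow \<or> D (a, b') = vertical" "D (a', b') = j_elbow \<or> D (a', b') = bump"
    "a < i \<Longrightarrow> i < a' \<Longrightarrow> D (i, b) = horizontal" "b < j \<Longrightarrow> j < b' \<Longrightarrow> D (a, j) = vertical"
    "b < j \<Longrightarrow> j < b' \<Longrightarrow> D (a', j) = cross" "a < i \<Longrightarrow> i < a' \<Longrightarrow> D (i, b') = cross"
  using assms by (auto simp: undroop_config_def)

lemma droop_vals:
  assumes "a < a'" "b < b'"
  shows "droop a b a' b' D (a, b) = (if D (a, b) = r_elbow then blank else j_elbow)"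
    "droop a b a' b' D (a', b) = (if D (a', b) = vertical then r_elbow else horizontal)"
    "droop a b a' b' D (a, b') = (if D (a, b') = horizontal then r_elbow else vertical)"
    "droop a b a' b' D (a', b') = (if D (a', b') = blank then j_elbow else bump)"
    "a < i \<Longrightarrow> i < a' \<Longrightarrow> droop a b a' b' D (i, b) = horizontal"
    "b < j \<Longrightarrow> j < b' \<Longrightarrow> droop a b a' b' D (a, j) = vertical"
    "b < j \<Longrightarrow> j < b' \<Longrightarrow> droop a b a' b' D (a', j) = cross"
    "a < i \<Longrightarrow> i < a' \<Longrightarrow> droop a b a' b' D (i, b') = cross"
  using assms by (simp_all add: droop_def)

lemma undroop_vals:
  assumes "a < a'" "b < b'"
  shows "undroop a b a' b' D (a, b) = (if D (a, b) = blank then r_elbow else bump)"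
    "undroop a b a' b' D (a', b) = (if D (a', b) = r_elbow then vertical else j_elbow)"
    "undroop a b a' b' D (a, b') = (if D (a, b') = r_elbow then horizontal else j_elbow)"
    "undroop a b a' b' D (a', b') = (if D (a', b') = j_elbow then blank else r_elbow)"
    "a < i \<Longrightarrow> i < a' \<Longrightarrow> undroop a b a' b' D (i, b) = cross"
    "b < j \<Longrightarrow> j < b' \<Longrightarrow> undroop a b a' b' D (a, j) = cross"
    "b < j \<Longrightarrow> j < b' \<Longrightarrow> undroop a b a' b' D (a', j) = vertical"
    "a < i \<Longrightarrow> i < a' \<Longrightarrow> undroop a b a' b' D (i, b') = horizontal"
  using assms by (simp_all add: undroop_def)

lemma droop_other:
  assumes "(i, j) \<noteq> (a, b)" "(i, j) \<noteq> (a', b)" "(i, j) \<noteq> (a, b')" "(i, j) \<noteq> (a', b')"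
    "\<not> (j = b \<and> a < i \<and> i < a')" "\<not> (i = a \<and> b < j \<and> j < b')" "\<not> (i = a' \<and> b < j \<and> j < b')"
    "\<not> (j = b' \<and> a < i \<and> i < a')"
  shows "droop a b a' b' D (i, j) = D (i, j)" "undroop a b a' b' D (i, j) = D (i, j)"
  unfolding droop_def undroop_def prod.case using assms by presburger+

lemma undroop_config_droop:
  assumes c: "droop_config D a b a' b'" shows "undroop_config (droop a b a' b' D) a b a' b'"
  unfolding undroop_config_def using droop_configD(1,2)[OF c]
  by (simp add: droop_vals[OF droop_configD(1,2)[OF c]])

lemma droop_config_undroop:
  assumes c: "undroop_config D a b a' b'" shows "droop_config (undroop a b a' b' D) a b a' b'"
  unfolding droop_config_def using undroop_configD(1,2)[OF c]
  by (simp add: undroop_vals[OF undroop_configD(1,2)[OF c]])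

lemma undroop_droop:
  assumes c: "droop_config D a b a' b'" shows "undroop a b a' b' (droop a b a' b' D) = D"
proof
  fix x :: cell
  obtain i j where x: "x = (i, j)" by fastforce
  note ab = droop_configD(1,2)[OF c]
  note V = droop_vals[OF ab] undroop_vals[OF ab] droop_configD(7-10)[OF c]
  show "undroop a b a' b' (droop a b a' b' D) x = D x"
    unfolding x
  proof (cases rule: rectangle_cases[of i a j b _ a' b'])
    case a_b then show "undroop a b a' b' (droop a b a' b' D) (i, j) = D (i, j)"
      using droop_configD(3)[OF c] by (elim disjE) (simp_all add: V)
  next
    case a'_b then show "undroop a b a' b' (droop a b a' b' D) (i, j) = D (i, j)"
      using droop_configD(4)[OF c] by (elim disjE) (simp_all add: V)
  next
    case a_b' then show "undroop a b a' b' (droop a b a' b' D) (i, j) = D (i, j)"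
      using droop_configD(5)[OF c] by (elim disjE) (simp_all add: V)
  next
    case a'_b' then show "undroop a b a' b' (droop a b a' b' D) (i, j) = D (i, j)"
      using droop_configD(6)[OF c] by (elim disjE) (simp_all add: V)
  next
    case other show "undroop a b a' b' (droop a b a' b' D) (i, j) = D (i, j)"
      unfolding droop_other[OF other] by (rule refl)
  qed (simp_all add: V)
qed

lemma droop_undroop:
  assumes c: "undroop_config D a b a' b'" shows "droop a b a' b' (undroop a b a' b' D) = D"
proof
  fix x :: cell
  obtain i j where x: "x = (i, j)" by fastforce
  note ab = undroop_configD(1,2)[OF c]
  note V = droop_vals[OF ab] undroop_vals[OF ab] undroop_configD(7-10)[OF c]
  show "droop a b a' b' (undroop a b a' b' D) x = D x"
    unfolding x
  proof (cases rule: rectangle_cases[of i a j b _ a' b'])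
    case a_b then show "droop a b a' b' (undroop a b a' b' D) (i, j) = D (i, j)"
      using undroop_configD(3)[OF c] by (elim disjE) (simp_all add: V)
  next
    case a'_b then show "droop a b a' b' (undroop a b a' b' D) (i, j) = D (i, j)"
      using undroop_configD(4)[OF c] by (elim disjE) (simp_all add: V)
  next
    case a_b' then show "droop a b a' b' (undroop a b a' b' D) (i, j) = D (i, j)"
      using undroop_configD(5)[OF c] by (elim disjE) (simp_all add: V)
  next
    case a'_b' then show "droop a b a' b' (undroop a b a' b' D) (i, j) = D (i, j)"
      using undroop_configD(6)[OF c] by (elim disjE) (simp_all add: V)
  next
    case other show "droop a b a' b' (undroop a b a' b' D) (i, j) = D (i, j)"
      unfolding droop_other[OF other] by (rule refl)
  qed (simp_all add: V)
qed

text \<open>The left and the top side consist of crosses and end in tiles that are not crosses, so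
  the two least distances in the move are the side lengths.\<close>

lemma min_droop_eq:
  assumes c: "droop_config D a b a' b'"
  shows "min_droop D (a, b) = (droop a b a' b' D, (a', b'))"
proof -
  note ab = droop_configD(1,2)[OF c]
  have dd: "droop_down D (a, b) = a' - a"
    unfolding droop_down_def prod.case
  proof (rule Least_equality)
    show "0 < a' - a \<and> D (a + (a' - a), b) \<noteq> cross" using ab droop_configD(4)[OF c] by auto
    fix y assume "0 < y \<and> D (a + y, b) \<noteq> cross"
    then show "a' - a \<le> y" using droop_configD(7)[OF c, of "a + y"] by linarith
  qed
  have dr: "droop_right D (a, b) = b' - b"
    unfolding droop_right_def prod.case
  proof (rule Least_equality)
    show "0 < b' - b \<and> D (a, b + (b' - b)) \<noteq> cross" using ab droop_configD(5)[OF c] by auto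
    fix y assume "0 < y \<and> D (a, b + y) \<noteq> cross"
    then show "b' - b \<le> y" using droop_configD(8)[OF c, of "b + y"] by linarith
  qed
  have aa: "a + (a' - a) = a'" "b + (b' - b) = b'" using ab by auto
  define f where "f = (\<lambda>(i, j).
         let t = D (i, j) in
         if (i, j) = (a, b) then t - {(South, East)}
         else if (i, j) = (a', b) then (\<lambda>(e, f). (e, if f = North then East else f)) ` t
         else if (i, j) = (a, b') then (\<lambda>(e, f). (if e = West then South else e, f)) ` t
         else if (i, j) = (a', b') then t \<union> {(West, North)}
         else if j = b \<and> a < i \<and> i < a' then t - {(South, North)}
         else if i = a \<and> b < j \<and> j < b' then t - {(West, East)}
         else if i = a' \<and> b < j \<and> j < b' then t \<union> {(West, East)}
         else if j = b' \<and> a < i \<and> i < a' then t \<union> {(South, North)}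
         else t)"
  have f: "f (a, b) = D (a, b) - {(South, East)}"
    "f (a', b) = (\<lambda>(e, f). (e, if f = North then East else f)) ` D (a', b)"
    "f (a, b') = (\<lambda>(e, f). (if e = West then South else e, f)) ` D (a, b')"
    "f (a', b') = D (a', b') \<union> {(West, North)}"
    "a < i \<Longrightarrow> i < a' \<Longrightarrow> f (i, b) = D (i, b) - {(South, North)}"
    "b < j \<Longrightarrow> j < b' \<Longrightarrow> f (a, j) = D (a, j) - {(West, East)}"
    "b < j \<Longrightarrow> j < b' \<Longrightarrow> f (a', j) = D (a', j) \<union> {(West, East)}"
    "a < i \<Longrightarrow> i < a' \<Longrightarrow> f (i, b') = D (i, b') \<union> {(South, North)}" for i j
    using ab by (simp_all add: f_def Let_def)
  have f_other: "f (i, j) = D (i, j)"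
    if "(i, j) \<noteq> (a, b)" "(i, j) \<noteq> (a', b)" "(i, j) \<noteq> (a, b')" "(i, j) \<noteq> (a', b')"
      "\<not> (j = b \<and> a < i \<and> i < a')" "\<not> (i = a \<and> b < j \<and> j < b')" "\<not> (i = a' \<and> b < j \<and> j < b')"
      "\<not> (j = b' \<and> a < i \<and> i < a')" for i j
    unfolding f_def prod.case Let_def using that by presburger
  have tiles: "(\<lambda>(e, f). (e, if f = North then East else f)) ` vertical = r_elbow"
    "(\<lambda>(e, f). (e, if f = North then East else f)) ` j_elbow = horizontal"
    "(\<lambda>(e, f). (if e = West then South else e, f)) ` horizontal = r_elbow"
    "(\<lambda>(e, f). (if e = West then South else e, f)) ` j_elbow = vertical"
    by (auto simp: tile_defs)
  note tiles = tiles tile_ops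
  have "f = droop a b a' b' D"
  proof
    fix x :: cell
    obtain i j where x: "x = (i, j)" by fastforce
    note V = droop_vals[OF ab] droop_configD(7-10)[OF c]
    show "f x = droop a b a' b' D x"
      unfolding x
    proof (cases rule: rectangle_cases[of i a j b _ a' b'])
      case a_b show "f (i, j) = droop a b a' b' D (i, j)" unfolding a_b f V
        using droop_configD(3)[OF c] by (elim disjE) (simp_all only: tiles tile_distinct if_True if_False simp_thms)
    next
      case a'_b show "f (i, j) = droop a b a' b' D (i, j)" unfolding a'_b f V
        using droop_configD(4)[OF c] by (elim disjE) (simp_all only: tiles tile_distinct if_True if_False simp_thms)
    next
      case a_b' show "f (i, j) = droop a b a' b' D (i, j)" unfolding a_b' f V
        using droop_configD(5)[OF c] by (elim disjE) (simp_all only: tiles tile_distinct if_True if_False simp_thms)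
    next
      case a'_b' show "f (i, j) = droop a b a' b' D (i, j)" unfolding a'_b' f V
        using droop_configD(6)[OF c] by (elim disjE) (simp_all only: tiles tile_distinct if_True if_False simp_thms)
    next
      case left then show "f (i, j) = droop a b a' b' D (i, j)" by (simp only: f V tiles)
    next
      case top then show "f (i, j) = droop a b a' b' D (i, j)" by (simp only: f V tiles)
    next
      case bottom then show "f (i, j) = droop a b a' b' D (i, j)" by (simp only: f V tiles)
    next
      case right then show "f (i, j) = droop a b a' b' D (i, j)" by (simp only: f V tiles)
    next
      case other show "f (i, j) = droop a b a' b' D (i, j)" unfolding f_other[OF other] droop_other(1)[OF other] by (rule refl)
    qed
  qed
  then show ?thesis unfolding min_droop_def prod.case Let_def dd dr aa f_def by simp
qed

lemma droop_changes:
  assumes c: "droop_config D a b a' b'"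
  shows "crossings (droop a b a' b' D) =
      (crossings D - ((\<lambda>i. (i, b)) ` {a<..<a'} \<union> (\<lambda>j. (a, j)) ` {b<..<b'})) \<union>
      ((\<lambda>i. (i, b')) ` {a<..<a'} \<union> (\<lambda>j. (a', j)) ` {b<..<b'})" (is "_ = (_ - ?L) \<union> ?R")
proof (rule set_eqI)
  fix x :: cell
  obtain i j where x: "x = (i, j)" by fastforce
  note ab = droop_configD(1,2)[OF c]
  note V = droop_vals[OF ab] droop_configD(7-10)[OF c]
  define L where "L = ?L"
  define R where "R = ?R"
  have LR: "x \<in> L \<longleftrightarrow> j = b \<and> a < i \<and> i < a' \<or> i = a \<and> b < j \<and> j < b'"
    "x \<in> R \<longleftrightarrow> j = b' \<and> a < i \<and> i < a' \<or> i = a' \<and> b < j \<and> j < b'"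
    by (auto simp: x L_def R_def)
  have nc: "D (a, b) \<noteq> cross" "D (a', b) \<noteq> cross" "D (a, b') \<noteq> cross" "D (a', b') \<noteq> cross"
    using droop_configD(3-6)[OF c] by auto
  have "droop a b a' b' D (i, j) = cross \<longleftrightarrow>
     D (i, j) = cross \<and> \<not> (j = b \<and> a < i \<and> i < a' \<or> i = a \<and> b < j \<and> j < b') \<or>
     (j = b' \<and> a < i \<and> i < a' \<or> i = a' \<and> b < j \<and> j < b')"
  proof (cases rule: rectangle_cases[of i a j b _ a' b'])
    case a_b then show ?thesis using ab nc by (simp add: V)
  next
    case a'_b then show ?thesis using ab nc by (simp add: V)
  next
    case a_b' then show ?thesis using ab nc by (simp add: V)
  next
    case a'_b' then show ?thesis using ab nc by (simp add: V)
  next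
    case left then show ?thesis using ab by (simp add: V)
  next
    case top then show ?thesis using ab by (simp add: V)
  next
    case bottom then show ?thesis using ab by (simp add: V)
  next
    case right then show ?thesis using ab by (simp add: V)
  next
    case other
    show ?thesis unfolding droop_other(1)[OF other] using other(5-8) by argo
  qed
  then show "x \<in> crossings (droop a b a' b' D) \<longleftrightarrow> x \<in> (crossings D - ?L) \<union> ?R"
    unfolding L_def[symmetric] R_def[symmetric] Un_iff Diff_iff LR by (simp add: x crossings_def)
qed

text \<open>The crosses in the interior of the left and top side disappear, and equally many appear
  inside the right and bottom side. Corners are never crosses.\<close>

lemma card_cross_shift:
  assumes c: "droop_config D a b a' b'" and fin: "finite (crossings D)"
  shows "card (crossings (droop a b a' b' D)) = card (crossings D)"
proof -
  define L where "L = (\<lambda>i. (i, b)) ` {a<..<a'} \<union> (\<lambda>j. (a, j)) ` {b<..<b'}"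
  define R where "R = (\<lambda>i. (i, b')) ` {a<..<a'} \<union> (\<lambda>j. (a', j)) ` {b<..<b'}"
  note ab = droop_configD(1,2)[OF c]
  have "crossings (droop a b a' b' D) = (crossings D - L) \<union> R"
    unfolding L_def R_def by (rule droop_changes[OF c])
  moreover have "L \<subseteq> crossings D" "R \<inter> crossings D = {}"
    unfolding L_def R_def crossings_def using droop_configD(7-10)[OF c] by auto
  moreover have "card L = (a' - a - 1) + (b' - b - 1)"
    unfolding L_def by (subst card_Un_disjoint) (auto simp: card_image inj_on_def)
  moreover have "card R = (a' - a - 1) + (b' - b - 1)"
    unfolding R_def by (subst card_Un_disjoint) (use ab in \<open>auto simp: card_image inj_on_def\<close>)
  moreover have "finite R" by (simp add: R_def)
  moreover have "(crossings D - L) \<inter> R = {}" using calculation(3) by blast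
  moreover have "card L \<le> card (crossings D)" using calculation(2) fin by (rule card_mono[rotated])
  ultimately show ?thesis
    using fin by (simp add: card_Un_disjoint card_Diff_subset finite_subset)
qed

section \<open>Rerouting one pipe along the other two sides of a rectangle\<close>

text \<open>The contribution of a single pipe to a tile. It has at most one element, because a pipe
  meets each diagonal once.\<close>

definition segs :: "(int \<Rightarrow> int) \<Rightarrow> cell \<Rightarrow> tile" where
  "segs f = (\<lambda>(i, j). if f (int j - int i) = int i
     then {(entry_side f (int j - int i), exit_side f (int j - int i))} else {})"

lemma segs_iff:
  assumes "pipe_path c f" "1 \<le> c"
  shows "(\<exists>d. strand_at f d = ((i, j), s)) \<longleftrightarrow> s \<in> segs f (i, j)"
proof -
  have "cell_at f d = (i, j) \<longleftrightarrow> d = int j - int i \<and> f d = int i" for d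
    using pipe_row_pos[OF assms(1), of d] pipe_col_ge[OF assms(1), of d] assms(2) by (auto simp: cell_at_def)
  then show ?thesis unfolding strand_at_def segs_def by auto
qed

context pipes
begin

lemma mem_segs: "s \<in> D (i, j) \<longleftrightarrow> (\<exists>c\<ge>1. s \<in> segs (h c) (i, j))"
  unfolding mem using segs_iff path by metis

lemma segs_unique: "1 \<le> c \<Longrightarrow> 1 \<le> c' \<Longrightarrow> s \<in> segs (h c) (i, j) \<Longrightarrow> s \<in> segs (h c') (i, j) \<Longrightarrow> c = c'"
  using same_entry_pipe[of c c' "int j - int i"] by (auto simp: segs_def split: if_splits)

text \<open>A segment belongs to one pipe only, so deleting the segments of \<open>p\<close> leaves
  those of all other pipes in place.\<close>

lemma reroute:
  assumes p: "1 \<le> p" and g: "pipe_path p g"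
    and dis: "\<And>c. 1 \<le> c \<Longrightarrow> c \<noteq> p \<Longrightarrow> edge_disjoint (h c) g"
    and D': "\<And>i j. D' (i, j) = (D (i, j) - segs (h p) (i, j)) \<union> segs g (i, j)"
  shows "pipes D' (h(p := g))"
proof
  fix s and x :: cell
  obtain i j where x: "x = (i, j)" by fastforce
  have "s \<in> D' x \<longleftrightarrow> (\<exists>c\<ge>1. s \<in> segs ((h(p := g)) c) (i, j))"
    unfolding x D' Un_iff Diff_iff mem_segs using segs_unique[OF p] p by (metis fun_upd_apply)
  also have "\<dots> \<longleftrightarrow> (\<exists>c\<ge>1. \<exists>d. strand_at ((h(p := g)) c) d = (x, s))"
    unfolding x using segs_iff path g p by (metis fun_upd_apply)
  finally show "s \<in> D' x \<longleftrightarrow> (\<exists>c\<ge>1. \<exists>d. strand_at ((h(p := g)) c) d = (x, s))" .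
qed (use path disjoint g dis edge_disjoint_sym in auto)

end

text \<open>In diagonal coordinates column \<open>b\<close> is the line \<open>int b - d\<close> and
  row \<open>a\<close> is constant; their maximum goes up the left side and then along the top. The
  range of \<open>d\<close> runs from the corner \<open>(a', b)\<close> to the corner
  \<open>(a, b')\<close>.\<close>

definition upper_path :: "nat \<Rightarrow> nat \<Rightarrow> nat \<Rightarrow> nat \<Rightarrow> (int \<Rightarrow> int) \<Rightarrow> bool" where
  "upper_path a b a' b' f \<longleftrightarrow> (\<forall>d. int b - int a' \<le> d \<and> d \<le> int b' - int a \<longrightarrow> f d = max (int a) (int b - d))"

definition lower_path :: "nat \<Rightarrow> nat \<Rightarrow> nat \<Rightarrow> nat \<Rightarrow> (int \<Rightarrow> int) \<Rightarrow> bool" where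
  "lower_path a b a' b' f \<longleftrightarrow> (\<forall>d. int b - int a' \<le> d \<and> d \<le> int b' - int a \<longrightarrow> f d = min (int a') (int b' - d))"

text \<open>Both routes agree in the corners \<open>(a', b)\<close> and \<open>(a, b')\<close>, so
  only the diagonals strictly between them are changed.\<close>

definition to_lower :: "nat \<Rightarrow> nat \<Rightarrow> nat \<Rightarrow> nat \<Rightarrow> (int \<Rightarrow> int) \<Rightarrow> int \<Rightarrow> int" where
  "to_lower a b a' b' f d = (if int b - int a' < d \<and> d < int b' - int a then min (int a') (int b' - d) else f d)"

definition to_upper :: "nat \<Rightarrow> nat \<Rightarrow> nat \<Rightarrow> nat \<Rightarrow> (int \<Rightarrow> int) \<Rightarrow> int \<Rightarrow> int" where
  "to_upper a b a' b' f d = (if int b - int a' < d \<and> d < int b' - int a then max (int a) (int b - d) else f d)"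

lemma lower_to_lower: "upper_path a b a' b' f \<Longrightarrow> a < a' \<Longrightarrow> b < b' \<Longrightarrow> lower_path a b a' b' (to_lower a b a' b' f)"
  unfolding upper_path_def lower_path_def to_lower_def by auto

lemma upper_to_upper: "lower_path a b a' b' f \<Longrightarrow> a < a' \<Longrightarrow> b < b' \<Longrightarrow> upper_path a b a' b' (to_upper a b a' b' f)"
  unfolding upper_path_def lower_path_def to_upper_def by auto

text \<open>In \<open>(a', b)\<close> and \<open>(a, b')\<close> one side of the segment depends on
  how the pipe continues outside the rectangle and therefore stays a parameter.\<close>

lemma upper_segs:
  assumes "upper_path a b a' b' f" "a < a'" "b < b'"
    and "int b - int a' \<le> int j - int i" "int j - int i \<le> int b' - int a"
  shows "segs f (i, j) = (if (i, j) = (a, b) then {(South, East)}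
     else if (i, j) = (a', b) then {(entry_side f (int b - int a'), North)}
     else if (i, j) = (a, b') then {(West, exit_side f (int b' - int a))}
     else if j = b \<and> a < i \<and> i < a' then {(South, North)}
     else if i = a \<and> b < j \<and> j < b' then {(West, East)}
     else {})"
proof -
  have f: "f d = max (int a) (int b - d)" if "int b - int a' \<le> d" "d \<le> int b' - int a" for d
    using assms(1) that by (simp add: upper_path_def)
  define d where "d = int j - int i"
  have fd: "f d = max (int a) (int b - d)" using f assms by (simp add: d_def)
  show ?thesis
  proof (cases "f d = int i")
    case False
    then show ?thesis using fd assms unfolding segs_def prod.case d_def[symmetric] by (auto simp: d_def max_def split: if_splits)
  next
    case True
    then have segs: "segs f (i, j) = {(entry_side f d, exit_side f d)}" by (simp add: segs_def d_def)
    have cases: "j = b \<and> a \<le> i \<and> i \<le> a' \<or> i = a \<and> b < j \<and> j \<le> b'"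
      using True fd assms(4,5) by (auto simp: d_def max_def split: if_splits)
    have en: "entry_side f d = (if j = b then South else West)" if "\<not> (j = b \<and> i = a')"
    proof -
      have "f (d - 1) = (if j = b then int i + 1 else int i)"
        using f[of "d - 1"] that cases assms(2-5) unfolding d_def by (auto simp: max_def split: if_splits)
      then show ?thesis using True by (simp add: entry_side_def)
    qed
    have ex: "exit_side f d = (if j = b \<and> i \<noteq> a then North else East)" if "\<not> (i = a \<and> j = b')"
    proof -
      have "f (d + 1) = (if j = b \<and> i \<noteq> a then int i - 1 else int i)"
        using f[of "d + 1"] that cases assms(2-5) unfolding d_def by (auto simp: max_def split: if_splits)
      then show ?thesis using True by (simp add: exit_side_def)
    qed
    show ?thesis unfolding segs using en ex cases assms(2,3) d_def by auto
  qed
qed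

lemma lower_segs:
  assumes "lower_path a b a' b' f" "a < a'" "b < b'"
    and "int b - int a' \<le> int j - int i" "int j - int i \<le> int b' - int a"
  shows "segs f (i, j) = (if (i, j) = (a', b') then {(West, North)}
     else if (i, j) = (a', b) then {(entry_side f (int b - int a'), East)}
     else if (i, j) = (a, b') then {(South, exit_side f (int b' - int a))}
     else if j = b' \<and> a < i \<and> i < a' then {(South, North)}
     else if i = a' \<and> b < j \<and> j < b' then {(West, East)}
     else {})"
proof -
  have f: "f d = min (int a') (int b' - d)" if "int b - int a' \<le> d" "d \<le> int b' - int a" for d
    using assms(1) that by (simp add: lower_path_def)
  define d where "d = int j - int i"
  have fd: "f d = min (int a') (int b' - d)" using f assms by (simp add: d_def)
  show ?thesis
  proof (cases "f d = int i")
    case False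
    then show ?thesis using fd assms unfolding segs_def prod.case d_def[symmetric] by (auto simp: d_def min_def split: if_splits)
  next
    case True
    then have segs: "segs f (i, j) = {(entry_side f d, exit_side f d)}" by (simp add: segs_def d_def)
    have cases: "j = b' \<and> a \<le> i \<and> i < a' \<or> i = a' \<and> b \<le> j \<and> j \<le> b'"
      using True fd assms(4,5) by (auto simp: d_def min_def split: if_splits)
    have en: "entry_side f d = (if i = a' then West else South)" if "\<not> (j = b \<and> i = a')"
    proof -
      have "f (d - 1) = (if i = a' then int i else int i + 1)"
        using f[of "d - 1"] that cases assms(2-5) unfolding d_def by (auto simp: min_def split: if_splits)
      then show ?thesis using True by (simp add: entry_side_def)
    qed
    have ex: "exit_side f d = (if j = b' then North else East)" if "\<not> (i = a \<and> j = b')"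
    proof -
      have "f (d + 1) = (if j = b' then int i - 1 else int i)"
        using f[of "d + 1"] that cases assms(2-5) unfolding d_def by (auto simp: min_def split: if_splits)
      then show ?thesis using True by (simp add: exit_side_def)
    qed
    show ?thesis unfolding segs using en ex cases assms(2,3) d_def by auto
  qed
qed

lemma to_lower_outside:
  assumes "a < a'" "b < b'" "\<not> (int b - int a' \<le> int j - int i \<and> int j - int i \<le> int b' - int a)"
  shows "segs (to_lower a b a' b' f) (i, j) = segs f (i, j)" "segs (to_upper a b a' b' f) (i, j) = segs f (i, j)"
proof -
  let ?d = "int j - int i"
  have "e \<in> {?d - 1, ?d, ?d + 1} \<Longrightarrow> \<not> (int b - int a' < e \<and> e < int b' - int a)" for e
    using assms by auto
  then have "e \<in> {?d - 1, ?d, ?d + 1} \<Longrightarrow> to_lower a b a' b' f e = f e \<and> to_upper a b a' b' f e = f e" for e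
    unfolding to_lower_def to_upper_def by meson
  then show "segs (to_lower a b a' b' f) (i, j) = segs f (i, j)" "segs (to_upper a b a' b' f) (i, j) = segs f (i, j)"
    by (simp_all add: segs_def entry_side_def exit_side_def)
qed

lemma to_lower_ends:
  assumes "a < a'" "b < b'"
  shows "entry_side (to_lower a b a' b' f) (int b - int a') = entry_side f (int b - int a')"
    "exit_side (to_lower a b a' b' f) (int b' - int a) = exit_side f (int b' - int a)"
    "entry_side (to_upper a b a' b' f) (int b - int a') = entry_side f (int b - int a')"
    "exit_side (to_upper a b a' b' f) (int b' - int a) = exit_side f (int b' - int a)"
  using assms unfolding to_lower_def to_upper_def entry_side_def exit_side_def by auto

lemma exits_at_local:
  assumes "\<And>d. d > m \<Longrightarrow> f d = g d" shows "exits_at f r \<longleftrightarrow> exits_at g r"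
proof -
  have "exits_at g r" if fr: "exits_at f r" and fg: "\<And>d. d > m \<Longrightarrow> f d = g d" for f g
  proof -
    obtain d0 where d0: "\<And>d. d0 \<le> d \<Longrightarrow> f d = int r" using fr unfolding exits_at_def by blast
    have "g d = int r" if "max d0 (m + 1) \<le> d" for d
      using d0[of d] fg[of d] that by simp
    then show ?thesis unfolding exits_at_def by blast
  qed
  then show ?thesis using assms by metis
qed

lemma exits_at_to_lower: "exits_at (to_lower a b a' b' f) r \<longleftrightarrow> exits_at f r"
  by (rule exits_at_local[of "int b' - int a"]) (simp add: to_lower_def)

lemma exits_at_to_upper: "exits_at (to_upper a b a' b' f) r \<longleftrightarrow> exits_at f r"
  by (rule exits_at_local[of "int b' - int a"]) (simp add: to_upper_def)

lemma pipe_path_to_lower: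
  assumes f: "pipe_path c f" and u: "upper_path a b a' b' f" and ab: "a < a'" "b < b'"
  shows "pipe_path c (to_lower a b a' b' f)"
  unfolding pipe_path_def
proof (intro conjI allI)
  fix d
  have ends: "f (int b - int a') = int a'" "f (int b' - int a) = int a"
    using u ab by (auto simp: upper_path_def)
  show "to_lower a b a' b' f (d + 1) = to_lower a b a' b' f d \<or> to_lower a b a' b' f (d + 1) = to_lower a b a' b' f d - 1"
  proof (cases "int b - int a' \<le> d \<and> d < int b' - int a")
    case True
    have l: "lower_path a b a' b' (to_lower a b a' b' f)" using lower_to_lower[OF u ab] .
    show ?thesis using True l unfolding lower_path_def by (auto simp: min_def)
  next
    case False
    then show ?thesis using pipe_step[OF f, of d] by (auto simp: to_lower_def)
  qed
  have "1 \<le> int a" using ends(2) pipe_row_pos[OF f] by metis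
  then show "1 \<le> to_lower a b a' b' f d" using pipe_row_pos[OF f, of d] ab by (auto simp: to_lower_def)
  obtain d0 where "\<And>d. d \<le> d0 \<Longrightarrow> f d = int c - d" "d0 \<le> int b - int a'" using pipe_initial[OF f] by metis
  then show "\<exists>d0. \<forall>d\<le>d0. to_lower a b a' b' f d = int c - d" by (intro exI[of _ d0]) (auto simp: to_lower_def)
qed

lemma pipe_path_to_upper:
  assumes f: "pipe_path c f" and u: "lower_path a b a' b' f" and ab: "a < a'" "b < b'"
  shows "pipe_path c (to_upper a b a' b' f)"
  unfolding pipe_path_def
proof (intro conjI allI)
  fix d
  have ends: "f (int b - int a') = int a'" "f (int b' - int a) = int a"
    using u ab by (auto simp: lower_path_def)
  show "to_upper a b a' b' f (d + 1) = to_upper a b a' b' f d \<or> to_upper a b a' b' f (d + 1) = to_upper a b a' b' f d - 1"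
  proof (cases "int b - int a' \<le> d \<and> d < int b' - int a")
    case True
    have l: "upper_path a b a' b' (to_upper a b a' b' f)" using upper_to_upper[OF u ab] .
    show ?thesis using True l unfolding upper_path_def by (auto simp: max_def)
  next
    case False
    then show ?thesis using pipe_step[OF f, of d] by (auto simp: to_upper_def)
  qed
  have "1 \<le> int a" using ends(2) pipe_row_pos[OF f] by metis
  then show "1 \<le> to_upper a b a' b' f d" using pipe_row_pos[OF f, of d] ab by (auto simp: to_upper_def)
  obtain d0 where "\<And>d. d \<le> d0 \<Longrightarrow> f d = int c - d" "d0 \<le> int b - int a'" using pipe_initial[OF f] by metis
  then show "\<exists>d0. \<forall>d\<le>d0. to_upper a b a' b' f d = int c - d" by (intro exI[of _ d0]) (auto simp: to_upper_def)
qed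

context pipes
begin

lemma exit_in: "1 \<le> c \<Longrightarrow> h c (int j - int i) = int i \<Longrightarrow> \<exists>e. (e, exit_side (h c) (int j - int i)) \<in> D (i, j)"
  unfolding mem_cell by blast

text \<open>Another pipe sharing an edge with the lower route would leave a tile of the bottom row
  to the east or a tile of the right column to the north, but the tiles required there have no such
  exits.\<close>

lemma droop_pipes:
  assumes cf: "droop_config D a b a' b'" and p: "1 \<le> p" and up: "upper_path a b a' b' (h p)"
  shows "pipes (droop a b a' b' D) (h(p := to_lower a b a' b' (h p)))"
proof (rule reroute[OF p])
  let ?g = "to_lower a b a' b' (h p)"
  have ab: "a < a'" "b < b'" using cf by (auto simp: droop_config_def)
  show "pipe_path p ?g" using pipe_path_to_lower[OF path[OF p] up ab] .
  have low: "lower_path a b a' b' ?g" using lower_to_lower[OF up ab] .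
  show "edge_disjoint (h c) ?g" if c: "1 \<le> c" "c \<noteq> p" for c
    unfolding edge_disjoint_def
  proof (intro allI notI)
    fix d assume a: "h c d = ?g d \<and> h c (d + 1) = ?g (d + 1)"
    show False
    proof (cases "int b - int a' \<le> d \<and> d < int b' - int a")
      case False
      then show ?thesis using a edge_disjointD[OF disjoint[OF c(1) p c(2)], of d] by (auto simp: to_lower_def)
    next
      case True
      then have g: "?g d = min (int a') (int b' - d)" "?g (d + 1) = min (int a') (int b' - (d + 1))"
        using low by (auto simp: lower_path_def)
      show False
      proof (cases "int a' \<le> int b' - (d + 1)")
        case True': True
        define j where "j = nat (d + int a')"
        have j: "int j - int a' = d" "b \<le> j" "j < b'" using True True' by (auto simp: j_def)
        have "D (a', j) = vertical \<or> D (a', j) = j_elbow" using j cf by (cases "j = b") (auto simp: droop_config_def)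
        moreover have "exit_side (h c) d = East" using a g True' by simp
        moreover have "h c d = int a'" using a g True' by simp
        ultimately show False
          using exit_in[OF c(1), of j a'] j(1) tile_by_segments(5)[OF tile_cases, of "(a', j)"] tile_distinct
          by metis
      next
        case False
        define i where "i = nat (int b' - d)"
        have i: "int b' - int i = d" "a < i" "i \<le> a'" using True False by (auto simp: i_def)
        have "D (i, b') \<in> {horizontal, blank, r_elbow}" using i cf by (cases "i = a'") (auto simp: droop_config_def)
        moreover have "h c d = int i" "h c (d + 1) = int i - 1" using a g False i by auto
        moreover from this have "exit_side (h c) d = North" by simp
        ultimately show False
          using exit_in[OF c(1), of b' i] i(1) tile_by_segments(6)[OF tile_cases, of "(i, b')"] tile_distinct
          by (metis insertE singletonD)
      qed
    qed
  qed
  show "droop a b a' b' D (i, j) = (D (i, j) - segs (h p) (i, j)) \<union> segs ?g (i, j)" for i j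
  proof (cases "int b - int a' \<le> int j - int i \<and> int j - int i \<le> int b' - int a")
    case False
    have "segs (h p) (i, j) \<subseteq> D (i, j)" using mem_segs p by blast
    moreover have "droop a b a' b' D (i, j) = D (i, j)"
      using False ab by (intro droop_other(1)) auto
    ultimately show ?thesis using to_lower_outside(1)[OF ab False] by auto
  next
    case True
    note S = upper_segs[OF up ab conjunct1[OF True] conjunct2[OF True]]
    note T = lower_segs[OF low ab conjunct1[OF True] conjunct2[OF True]]
    have sub: "segs (h p) (i, j) \<subseteq> D (i, j)" using mem_segs p by blast
    note cd = droop_configD[OF cf]
    note V = droop_vals[OF ab] Un_empty_right Diff_empty tile_ops to_lower_ends[OF ab] tile_distinct if_True if_False simp_thms
    show ?thesis
    proof (cases rule: rectangle_cases[of i a j b _ a' b'])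
      case a_b
      have "segs (h p) (i, j) = {(South, East)}" "segs ?g (i, j) = {}"
        unfolding S T using a_b ab by simp_all
      then show ?thesis unfolding a_b using cd(3) by (elim disjE) (simp_all only: V)
    next
      case a'_b
      have e: "segs (h p) (i, j) = {(entry_side (h p) (int b - int a'), North)}"
        "segs ?g (i, j) = {(entry_side (h p) (int b - int a'), East)}"
        unfolding S T using a'_b ab to_lower_ends[OF ab] by simp_all
      then have "(entry_side (h p) (int b - int a'), North) \<in> D (a', b)" using sub a'_b by auto
      then have "D (a', b) = vertical \<and> entry_side (h p) (int b - int a') = South \<or>
          D (a', b) = j_elbow \<and> entry_side (h p) (int b - int a') = West"
        using cd(4) tile_ends by metis
      then show ?thesis using e unfolding a'_b by (elim disjE conjE) (simp_all only: V)
    next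
      case a_b'
      have e: "segs (h p) (i, j) = {(West, exit_side (h p) (int b' - int a))}"
        "segs ?g (i, j) = {(South, exit_side (h p) (int b' - int a))}"
        unfolding S T using a_b' ab to_lower_ends[OF ab] by simp_all
      then have "(West, exit_side (h p) (int b' - int a)) \<in> D (a, b')" using sub a_b' by auto
      then have "D (a, b') = horizontal \<and> exit_side (h p) (int b' - int a) = East \<or>
          D (a, b') = j_elbow \<and> exit_side (h p) (int b' - int a) = North"
        using cd(5) tile_ends by metis
      then show ?thesis using e unfolding a_b' by (elim disjE conjE) (simp_all only: V)
    next
      case a'_b'
      have "segs (h p) (i, j) = {}" "segs ?g (i, j) = {(West, North)}"
        unfolding S T using a'_b' ab by simp_all
      then show ?thesis unfolding a'_b' using cd(6) by (elim disjE) (simp_all only: V)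
    next
      case left
      have "segs (h p) (i, j) = {(South, North)}" "segs ?g (i, j) = {}" unfolding S T using left ab by simp_all
      then show ?thesis using left by (simp only: V cd(7))
    next
      case top
      have "segs (h p) (i, j) = {(West, East)}" "segs ?g (i, j) = {}" unfolding S T using top ab by simp_all
      then show ?thesis using top by (simp only: V cd(8))
    next
      case bottom
      have "segs (h p) (i, j) = {}" "segs ?g (i, j) = {(West, East)}" unfolding S T using bottom ab by simp_all
      then show ?thesis using bottom by (simp only: V cd(9))
    next
      case right
      have "segs (h p) (i, j) = {}" "segs ?g (i, j) = {(South, North)}" unfolding S T using right ab by simp_all
      then show ?thesis using right by (simp only: V cd(10))
    next
      case other
      have "segs (h p) (i, j) = {}" "segs ?g (i, j) = {}" unfolding S T using other by simp_all
      then show ?thesis unfolding droop_other[OF other] by simp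
    qed
  qed
qed

lemma undroop_pipes:
  assumes cf: "undroop_config D a b a' b'" and p: "1 \<le> p" and lo: "lower_path a b a' b' (h p)"
  shows "pipes (undroop a b a' b' D) (h(p := to_upper a b a' b' (h p)))"
proof (rule reroute[OF p])
  let ?g = "to_upper a b a' b' (h p)"
  have ab: "a < a'" "b < b'" using cf by (auto simp: undroop_config_def)
  show "pipe_path p ?g" using pipe_path_to_upper[OF path[OF p] lo ab] .
  have up: "upper_path a b a' b' ?g" using upper_to_upper[OF lo ab] .
  show "edge_disjoint (h c) ?g" if c: "1 \<le> c" "c \<noteq> p" for c
    unfolding edge_disjoint_def
  proof (intro allI notI)
    fix d assume a: "h c d = ?g d \<and> h c (d + 1) = ?g (d + 1)"
    show False
    proof (cases "int b - int a' \<le> d \<and> d < int b' - int a")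
      case False
      then show ?thesis using a edge_disjointD[OF disjoint[OF c(1) p c(2)], of d] by (auto simp: to_upper_def)
    next
      case True
      then have g: "?g d = max (int a) (int b - d)" "?g (d + 1) = max (int a) (int b - (d + 1))"
        using up by (auto simp: upper_path_def)
      show False
      proof (cases "int b - d \<le> int a")
        case True': True
        define j where "j = nat (d + int a)"
        have j: "int j - int a = d" "b \<le> j" "j < b'" using True True' by (auto simp: j_def)
        have "D (a, j) \<in> {vertical, blank, j_elbow}" using j cf by (cases "j = b") (auto simp: undroop_config_def)
        moreover have "exit_side (h c) d = East" using a g True' by simp
        moreover have "h c d = int a" using a g True' by simp
        ultimately show False
          using exit_in[OF c(1), of j a] j(1) tile_by_segments(5)[OF tile_cases, of "(a, j)"] tile_distinct
          by (metis insertE singletonD)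
      next
        case False
        define i where "i = nat (int b - d)"
        have i: "int b - int i = d" "a < i" "i \<le> a'" using True False by (auto simp: i_def)
        have "D (i, b) = horizontal \<or> D (i, b) = r_elbow" using i cf by (cases "i = a'") (auto simp: undroop_config_def)
        moreover have "h c d = int i" "h c (d + 1) = int i - 1" using a g False i by auto
        moreover from this have "exit_side (h c) d = North" by simp
        ultimately show False
          using exit_in[OF c(1), of b i] i(1) tile_by_segments(6)[OF tile_cases, of "(i, b)"] tile_distinct
          by metis
      qed
    qed
  qed
  show "undroop a b a' b' D (i, j) = (D (i, j) - segs (h p) (i, j)) \<union> segs ?g (i, j)" for i j
  proof (cases "int b - int a' \<le> int j - int i \<and> int j - int i \<le> int b' - int a")
    case False
    have "segs (h p) (i, j) \<subseteq> D (i, j)" using mem_segs p by blast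
    moreover have "undroop a b a' b' D (i, j) = D (i, j)"
      using False ab by (intro droop_other(2)) auto
    ultimately show ?thesis using to_lower_outside(2)[OF ab False] by auto
  next
    case True
    note S = upper_segs[OF up ab conjunct1[OF True] conjunct2[OF True]]
    note T = lower_segs[OF lo ab conjunct1[OF True] conjunct2[OF True]]
    have sub: "segs (h p) (i, j) \<subseteq> D (i, j)" using mem_segs p by blast
    note cd = undroop_configD[OF cf]
    note V = undroop_vals[OF ab] Un_empty_right Diff_empty tile_ops to_lower_ends[OF ab] tile_distinct if_True if_False simp_thms
    show ?thesis
    proof (cases rule: rectangle_cases[of i a j b _ a' b'])
      case a_b
      have "segs (h p) (i, j) = {}" "segs ?g (i, j) = {(South, East)}"
        unfolding S T using a_b ab by simp_all
      then show ?thesis unfolding a_b using cd(3) by (elim disjE) (simp_all only: V)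
    next
      case a'_b
      have e: "segs (h p) (i, j) = {(entry_side (h p) (int b - int a'), East)}"
        "segs ?g (i, j) = {(entry_side (h p) (int b - int a'), North)}"
        unfolding S T using a'_b ab to_lower_ends[OF ab] by simp_all
      then have "(entry_side (h p) (int b - int a'), East) \<in> D (a', b)" using sub a'_b by auto
      then have "D (a', b) = r_elbow \<and> entry_side (h p) (int b - int a') = South \<or>
          D (a', b) = horizontal \<and> entry_side (h p) (int b - int a') = West"
        using cd(4) tile_ends by metis
      then show ?thesis using e unfolding a'_b by (elim disjE conjE) (simp_all only: V)
    next
      case a_b'
      have e: "segs (h p) (i, j) = {(South, exit_side (h p) (int b' - int a))}"
        "segs ?g (i, j) = {(West, exit_side (h p) (int b' - int a))}"
        unfolding S T using a_b' ab to_lower_ends[OF ab] by simp_all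
      then have "(South, exit_side (h p) (int b' - int a)) \<in> D (a, b')" using sub a_b' by auto
      then have "D (a, b') = r_elbow \<and> exit_side (h p) (int b' - int a) = East \<or>
          D (a, b') = vertical \<and> exit_side (h p) (int b' - int a) = North"
        using cd(5) tile_ends by metis
      then show ?thesis using e unfolding a_b' by (elim disjE conjE) (simp_all only: V)
    next
      case a'_b'
      have "segs (h p) (i, j) = {(West, North)}" "segs ?g (i, j) = {}"
        unfolding S T using a'_b' ab by simp_all
      then show ?thesis unfolding a'_b' using cd(6) by (elim disjE) (simp_all only: V)
    next
      case left
      have "segs (h p) (i, j) = {}" "segs ?g (i, j) = {(South, North)}" unfolding S T using left ab by simp_all
      then show ?thesis using left by (simp only: V cd(7))
    next
      case top
      have "segs (h p) (i, j) = {}" "segs ?g (i, j) = {(West, East)}" unfolding S T using top ab by simp_all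
      then show ?thesis using top by (simp only: V cd(8))
    next
      case bottom
      have "segs (h p) (i, j) = {(West, East)}" "segs ?g (i, j) = {}" unfolding S T using bottom ab by simp_all
      then show ?thesis using bottom by (simp only: V cd(9))
    next
      case right
      have "segs (h p) (i, j) = {(South, North)}" "segs ?g (i, j) = {}" unfolding S T using right ab by simp_all
      then show ?thesis using right by (simp only: V cd(10))
    next
      case other
      have "segs (h p) (i, j) = {}" "segs ?g (i, j) = {}" unfolding S T using other by simp_all
      then show ?thesis unfolding droop_other[OF other] by simp
    qed
  qed
qed

end

section \<open>Finding the rectangle of a min-droop\<close>

context pipes
begin

lemma cross_straight:
  assumes "1 \<le> c" "D (cell_at (h c) d) = cross"
  shows "h c (d + 1) = h c d \<longleftrightarrow> h c (d - 1) = h c d"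
  using strand_in[OF assms(1), of d] unfolding assms(2) cross_def by auto

text \<open>The definition of a min-droop looks only along the left and the top side; reducedness
  determines the rest. The interior turns out to consist of crosses, and from there the tiles of the
  right column, of the bottom row and of their common corner are read off through matching
  edges.\<close>

lemma droop_rectangle:
  assumes red: "reduced h" and x: "(South, East) \<in> D (a, b)" and nb: "\<And>y. y \<noteq> (a, b) \<Longrightarrow> D y \<noteq> bump"
    and ab: "a < a'" "b < b'"
    and L: "\<And>i. a < i \<Longrightarrow> i < a' \<Longrightarrow> D (i, b) = cross" and T: "\<And>j. b < j \<Longrightarrow> j < b' \<Longrightarrow> D (a, j) = cross"
    and ca: "D (a', b) \<noteq> cross" and cb: "D (a, b') \<noteq> cross"
  obtains p where "1 \<le> p" "((a, b), (South, East)) = strand_at (h p) (int b - int a)"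
    "upper_path a b a' b' (h p)" "droop_config D a b a' b'"
proof -
  define d0 where "d0 = int b - int a"
  obtain p where p: "1 \<le> p" "h p d0 = int a" "h p (d0 - 1) \<noteq> int a" "h p (d0 + 1) = int a"
    using x unfolding mem_cell d0_def by auto
  have down: "k < a' - a \<Longrightarrow> h p (d0 - int k - 1) = int a + int k + 1 \<and> h p (d0 - int k) = int a + int k" for k
  proof (induction k)
    case 0
    then show ?case using p step_back[OF p(1), of d0] by simp
  next
    case (Suc k)
    have eq: "h p (d0 - int (Suc k)) = int a + int (Suc k)" and eq': "h p (d0 - int k) = int a + int k"
      using Suc by (auto simp: algebra_simps)
    then have "cell_at (h p) (d0 - int (Suc k)) = (a + Suc k, b)" by (simp add: cell_at_def d0_def nat_add_distrib)
    then have "D (cell_at (h p) (d0 - int (Suc k))) = cross" using L[of "a + Suc k"] Suc.prems by simp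
    from cross_straight[OF p(1) this] have "h p (d0 - int (Suc k) - 1) \<noteq> h p (d0 - int (Suc k))"
      using eq eq' by (simp add: algebra_simps)
    then show ?case using step_back[OF p(1), of "d0 - int (Suc k)"] eq by simp
  qed
  have right: "k < b' - b \<Longrightarrow> h p (d0 + int k + 1) = int a \<and> h p (d0 + int k) = int a" for k
  proof (induction k)
    case 0
    then show ?case using p by simp
  next
    case (Suc k)
    have eq: "h p (d0 + int (Suc k)) = int a" and eq': "h p (d0 + int k) = int a"
      using Suc by (auto simp: algebra_simps)
    then have "cell_at (h p) (d0 + int (Suc k)) = (a, b + Suc k)" by (simp add: cell_at_def d0_def nat_add_distrib)
    then have "D (cell_at (h p) (d0 + int (Suc k))) = cross" using T[of "b + Suc k"] Suc.prems by simp
    from cross_straight[OF p(1) this] show ?case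
      using eq eq' by (simp add: algebra_simps)
  qed
  have up: "upper_path a b a' b' (h p)"
    unfolding upper_path_def
  proof (intro allI impI)
    fix d assume d: "int b - int a' \<le> d \<and> d \<le> int b' - int a"
    show "h p d = max (int a) (int b - d)"
    proof (cases "d < d0")
      case True
      then have "nat (d0 - d - 1) < a' - a" using d ab by (simp add: d0_def nat_less_iff of_nat_diff)
      then show ?thesis using down[of "nat (d0 - d - 1)"] True by (simp add: d0_def)
    next
      case False
      show ?thesis
      proof (cases "d = d0")
        case True
        then show ?thesis using p by (simp add: d0_def)
      next
        case ne: False
        have "nat (d - d0 - 1) < b' - b" using d ab ne False by (simp add: d0_def nat_less_iff of_nat_diff)
        then show ?thesis using right[of "nat (d - d0 - 1)"] ne False by (simp add: d0_def)
      qed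
    qed
  qed
  have hp: "h p d = max (int a) (int b - d)" if "int b - int a' \<le> d" "d \<le> int b' - int a" for d
    using up that by (simp add: upper_path_def)
  have pv: "crosses f (h p) (int b - int i)"
    if "a < i" "i < a'" "f (int b - int i) = int i" "f (int b - int i - 1) = int i" "f (int b - int i + 1) = int i" for f i
    using that hp[of "int b - int i"] hp[of "int b - int i - 1"] hp[of "int b - int i + 1"] ab
    by (auto simp: crosses_def)
  have ph: "crosses (h p) f (int j - int a)"
    if "b < j" "j < b'" "f (int j - int a) = int a" "f (int j - int a - 1) = int a + 1" "f (int j - int a + 1) = int a - 1" for f j
    using that hp[of "int j - int a"] hp[of "int j - int a - 1"] hp[of "int j - int a + 1"] ab
    by (auto simp: crosses_def)
  note tb = tile_by_segments[OF tile_cases]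
  have ca': "D (a', b) = vertical \<or> D (a', b) = j_elbow"
  proof -
    have "h p (int b - int a') = int a'" "h p (int b - int a' + 1) = int a' - 1"
      using hp[of "int b - int a'"] hp[of "int b - int a' + 1"] ab by auto
    then have "(entry_side (h p) (int b - int a'), North) \<in> D (a', b)" unfolding mem_cell using p(1) by auto
    then show ?thesis using tb(6)[of "(a', b)"] ca nb[of "(a', b)"] ab by blast
  qed
  have cb': "D (a, b') = horizontal \<or> D (a, b') = j_elbow"
  proof -
    have "h p (int b' - int a) = int a" "h p (int b' - int a - 1) = int a"
      using hp[of "int b' - int a"] hp[of "int b' - int a - 1"] ab by auto
    then have "(West, exit_side (h p) (int b' - int a)) \<in> D (a, b')" unfolding mem_cell using p(1) by auto
    then show ?thesis using tb(7)[of "(a, b')"] cb nb[of "(a, b')"] ab by blast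
  qed
  \<comment> \<open>Away from the left and top side, the neighbours above and to the left are
    crosses by induction. So there is an exit to the north and an entry from the west, and without
    bumps only a cross or a j-elbow remains.\<close>
  have inner: "D (i, j) = cross" if "a \<le> i" "i < a'" "b \<le> j" "j < b'" "(i, j) \<noteq> (a, b)" for i j
    using that
  proof (induction "i + j" arbitrary: i j rule: less_induct)
    case less
    show ?case
    proof (cases "i = a \<or> j = b")
      case True
      then show ?thesis using L[of i] T[of j] less.prems by force
    next
      case False
      then have ij: "a < i" "b < j" using less.prems by auto
      then obtain i0 j0 where 0: "i = Suc i0" "j = Suc j0" by (metis less_imp_Suc_add add_Suc_right)
      have "D (i0, j) = cross" "D (i, j0) = cross" using less.hyps[of i0 j] less.hyps[of i j0] less.prems ij unfolding 0 by auto
      then have "\<exists>e. (e, North) \<in> D (i, j)" "\<exists>f. (West, f) \<in> D (i, j)"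
        unfolding 0 north_south east_west[symmetric] tb(5,8) by simp_all
      moreover have "D (i, j) \<noteq> bump" using nb[of "(i, j)"] ij by simp
      moreover have "horizontal \<noteq> vertical" by simp
      ultimately have "D (i, j) = cross \<or> D (i, j) = j_elbow" unfolding tb(6,7) by metis
      \<comment> \<open>The pipe \<open>q\<close> of such a j-elbow runs straight through the
        crosses of row \<open>i\<close> and of column \<open>j\<close>. It thus crosses
        \<open>p\<close> on the left side and a second time on the top side.\<close>
      moreover have "False" if je: "D (i, j) = j_elbow"
      proof -
        define d where "d = int j - int i"
        obtain q where q: "1 \<le> q" "h q d = int i" "h q (d - 1) = int i" "h q (d + 1) \<noteq> int i"
          using tb(2)[of "(i, j)"] je unfolding mem_cell d_def by auto
        have bwd: "k < j - b \<Longrightarrow> h q (d - int k - 1) = int i \<and> h q (d - int k) = int i" for k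
        proof (induction k)
          case 0
          then show ?case using q by simp
        next
          case (Suc k)
          have eq: "h q (d - int (Suc k)) = int i" and eq': "h q (d - int k) = int i"
            using Suc by (auto simp: algebra_simps)
          then have "cell_at (h q) (d - int (Suc k)) = (i, j - Suc k)" using Suc.prems by (simp add: cell_at_def d_def)
          moreover have "D (i, j - Suc k) = cross" using less.hyps[of i "j - Suc k"] less.prems Suc.prems ij by auto
          ultimately have "D (cell_at (h q) (d - int (Suc k))) = cross" by simp
          from cross_straight[OF q(1) this] show ?case using eq eq' by (simp add: algebra_simps)
        qed
        have fwd: "k < i - a \<Longrightarrow> h q (d + int k + 1) = int i - int k - 1 \<and> h q (d + int k) = int i - int k" for k
        proof (induction k)
          case 0
          then show ?case using q step[OF q(1), of d] by simp
        next
          case (Suc k)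
          have eq: "h q (d + int (Suc k)) = int i - int (Suc k)" and eq': "h q (d + int k) = int i - int k"
            using Suc by (auto simp: algebra_simps)
          then have "cell_at (h q) (d + int (Suc k)) = (i - Suc k, j)" using Suc.prems by (simp add: cell_at_def d_def)
          moreover have "D (i - Suc k, j) = cross" using less.hyps[of "i - Suc k" j] less.prems Suc.prems ij by auto
          ultimately have "D (cell_at (h q) (d + int (Suc k))) = cross" by simp
          from cross_straight[OF q(1) this] have "h q (d + int (Suc k) + 1) \<noteq> h q (d + int (Suc k))"
            using eq eq' by (simp add: algebra_simps)
          then show ?case using step[OF q(1), of "d + int (Suc k)"] eq by simp
        qed
        have "d - int (j - b - 1) = int b - int i + 1" using ij by (simp add: d_def of_nat_diff)
        from bwd[of "j - b - 1", unfolded this] have A: "h q (int b - int i) = int i" "h q (int b - int i + 1) = int i"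
          using ij by simp_all
        then have "cell_at (h q) (int b - int i) = (i, b)" by (simp add: cell_at_def)
        then have "h q (int b - int i - 1) = int i"
          using cross_straight[OF q(1), of "int b - int i"] L[of i] less.prems ij A by simp
        then have X1: "crosses (h q) (h p) (int b - int i)" using pv[of i "h q"] A ij less.prems by simp
        have B: "h q (int j - int a) = int a" "h q (int j - int a - 1) = int a + 1"
          using fwd[of "i - a - 1"] ij by (simp_all add: d_def algebra_simps)
        then have "cell_at (h q) (int j - int a) = (a, j)" by (simp add: cell_at_def)
        then have "h q (int j - int a + 1) \<noteq> int a"
          using cross_straight[OF q(1), of "int j - int a"] T[of j] less.prems ij B by simp
        then have "h q (int j - int a + 1) = int a - 1" using step[OF q(1), of "int j - int a"] B by simp
        then have X2: "crosses (h p) (h q) (int j - int a)" using ph[of j "h q"] B ij less.prems by simp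
        have "int b - int i = int j - int a" using red p(1) q(1) X1 X2 unfolding reduced_def by blast
        then show False using ij by simp
      qed
      ultimately show ?thesis by blast
    qed
  qed
  have rightcol: "D (i, b') = horizontal" if "a < i" "i < a'" for i
    using that
  proof (induction i)
    case (Suc i)
    have "\<exists>f. (West, f) \<in> D (Suc i, b')"
    proof -
      obtain b0 where b0: "b' = Suc b0" using ab by (cases b') auto
      have "D (Suc i, b0) = cross" using inner[of "Suc i" b0] Suc.prems b0 ab by auto
      then show ?thesis unfolding b0 east_west[symmetric] tb(5) by simp
    qed
    moreover have "\<not> (\<exists>e. (e, North) \<in> D (Suc i, b'))"
      unfolding north_south tb(8) using Suc cb' by (cases "i = a") auto
    ultimately show ?case unfolding tb(6,7) by blast
  qed simp
  have bottom: "D (a', j) = vertical" if "b < j" "j < b'" for j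
    using that
  proof (induction j)
    case (Suc j)
    have "\<exists>e. (e, North) \<in> D (a', Suc j)"
    proof -
      obtain a0 where a0: "a' = Suc a0" using ab by (cases a') auto
      have "D (a0, Suc j) = cross" using inner[of a0 "Suc j"] Suc.prems a0 ab by auto
      then show ?thesis unfolding a0 north_south tb(8) by simp
    qed
    moreover have "\<not> (\<exists>f. (West, f) \<in> D (a', Suc j))"
      unfolding east_west[symmetric] tb(5) using Suc ca' by (cases "j = b") auto
    ultimately show ?case unfolding tb(6,7) by blast
  qed simp
  have corner: "D (a', b') = blank \<or> D (a', b') = r_elbow"
  proof -
    obtain a0 where a0: "a' = Suc a0" using ab by (cases a') auto
    obtain b0 where b0: "b' = Suc b0" using ab by (cases b') auto
    have "D (a0, b') = horizontal \<or> D (a0, b') = j_elbow"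
      using cb' rightcol[of a0] ab a0 by (cases "a0 = a") auto
    then have "\<not> (\<exists>f. (South, f) \<in> D (a0, b'))" unfolding tb(8) by auto
    then have "\<not> (\<exists>e. (e, North) \<in> D (a', b'))" unfolding a0 north_south .
    moreover have "D (a', b0) = vertical \<or> D (a', b0) = j_elbow"
      using ca' bottom[of b0] ab b0 by (cases "b0 = b") auto
    then have "\<not> (\<exists>e. (e, East) \<in> D (a', b0))" unfolding tb(5) by auto
    then have "\<not> (\<exists>f. (West, f) \<in> D (a', b'))" unfolding b0 east_west .
    ultimately show ?thesis using tile_cases[of "(a', b')"] unfolding tb(6,7) by blast
  qed
  have "D (a, b) = r_elbow \<or> D (a, b) = bump" using x tb(1) by blast
  then have "droop_config D a b a' b'"
    unfolding droop_config_def using ab L T rightcol bottom corner ca' cb' by simp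
  moreover have "((a, b), (South, East)) = strand_at (h p) (int b - int a)"
    using p unfolding d0_def by (simp add: strand_at_def cell_at_def)
  ultimately show ?thesis using that p(1) up by blast
qed

text \<open>The mirrored argument: the induction starts at \<open>(a', b')\<close>, and an r-elbow
  in the interior would belong to a pipe that crosses \<open>p\<close> on the bottom side and again
  on the right side.\<close>

lemma undroop_rectangle:
  assumes red: "reduced h" and x: "(West, North) \<in> D (a', b')" and nb: "\<And>y. y \<noteq> (a', b') \<Longrightarrow> D y \<noteq> bump"
    and ab: "a < a'" "b < b'"
    and R: "\<And>i. a < i \<Longrightarrow> i < a' \<Longrightarrow> D (i, b') = cross" and B: "\<And>j. b < j \<Longrightarrow> j < b' \<Longrightarrow> D (a', j) = cross"
    and ca: "D (a', b) \<noteq> cross" and cb: "D (a, b') \<noteq> cross"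
  obtains p where "1 \<le> p" "((a', b'), (West, North)) = strand_at (h p) (int b' - int a')"
    "lower_path a b a' b' (h p)" "undroop_config D a b a' b'"
proof -
  define d0 where "d0 = int b' - int a'"
  obtain p where p: "1 \<le> p" "h p d0 = int a'" "h p (d0 - 1) = int a'" "h p (d0 + 1) \<noteq> int a'"
    using x unfolding mem_cell d0_def by auto
  have up: "k < a' - a \<Longrightarrow> h p (d0 + int k + 1) = int a' - int k - 1 \<and> h p (d0 + int k) = int a' - int k" for k
  proof (induction k)
    case 0
    then show ?case using p step[OF p(1), of d0] by simp
  next
    case (Suc k)
    have eq: "h p (d0 + int (Suc k)) = int a' - int (Suc k)" and eq': "h p (d0 + int k) = int a' - int k"
      using Suc by (auto simp: algebra_simps)
    then have "cell_at (h p) (d0 + int (Suc k)) = (a' - Suc k, b')" using Suc.prems by (simp add: cell_at_def d0_def)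
    then have "D (cell_at (h p) (d0 + int (Suc k))) = cross" using R[of "a' - Suc k"] Suc.prems by simp
    from cross_straight[OF p(1) this] have "h p (d0 + int (Suc k) + 1) \<noteq> h p (d0 + int (Suc k))"
      using eq eq' by (simp add: algebra_simps)
    then show ?case using step[OF p(1), of "d0 + int (Suc k)"] eq by simp
  qed
  have left: "k < b' - b \<Longrightarrow> h p (d0 - int k - 1) = int a' \<and> h p (d0 - int k) = int a'" for k
  proof (induction k)
    case 0
    then show ?case using p by simp
  next
    case (Suc k)
    have eq: "h p (d0 - int (Suc k)) = int a'" and eq': "h p (d0 - int k) = int a'"
      using Suc by (auto simp: algebra_simps)
    then have "cell_at (h p) (d0 - int (Suc k)) = (a', b' - Suc k)" using Suc.prems by (simp add: cell_at_def d0_def)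
    then have "D (cell_at (h p) (d0 - int (Suc k))) = cross" using B[of "b' - Suc k"] Suc.prems by simp
    from cross_straight[OF p(1) this] show ?case
      using eq eq' by (simp add: algebra_simps)
  qed
  have low: "lower_path a b a' b' (h p)"
    unfolding lower_path_def
  proof (intro allI impI)
    fix d assume d: "int b - int a' \<le> d \<and> d \<le> int b' - int a"
    show "h p d = min (int a') (int b' - d)"
    proof (cases "d0 < d")
      case True
      then have "nat (d - d0 - 1) < a' - a" using d ab by (simp add: d0_def nat_less_iff of_nat_diff)
      then show ?thesis using up[of "nat (d - d0 - 1)"] True by (simp add: d0_def)
    next
      case False
      show ?thesis
      proof (cases "d = d0")
        case True
        then show ?thesis using p by (simp add: d0_def)
      next
        case ne: False
        have "nat (d0 - d - 1) < b' - b" using d ab ne False by (simp add: d0_def nat_less_iff of_nat_diff)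
        then show ?thesis using left[of "nat (d0 - d - 1)"] ne False by (simp add: d0_def)
      qed
    qed
  qed
  have hp: "h p d = min (int a') (int b' - d)" if "int b - int a' \<le> d" "d \<le> int b' - int a" for d
    using low that by (simp add: lower_path_def)
  have pv: "crosses f (h p) (int b' - int i)"
    if "a < i" "i < a'" "f (int b' - int i) = int i" "f (int b' - int i - 1) = int i" "f (int b' - int i + 1) = int i" for f i
    using that hp[of "int b' - int i"] hp[of "int b' - int i - 1"] hp[of "int b' - int i + 1"] ab
    by (auto simp: crosses_def)
  have ph: "crosses (h p) f (int j - int a')"
    if "b < j" "j < b'" "f (int j - int a') = int a'" "f (int j - int a' - 1) = int a' + 1" "f (int j - int a' + 1) = int a' - 1" for f j
    using that hp[of "int j - int a'"] hp[of "int j - int a' - 1"] hp[of "int j - int a' + 1"] ab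
    by (auto simp: crosses_def)
  note tb = tile_by_segments[OF tile_cases]
  have ca': "D (a', b) = r_elbow \<or> D (a', b) = horizontal"
  proof -
    have "h p (int b - int a') = int a'" "h p (int b - int a' + 1) = int a'"
      using hp[of "int b - int a'"] hp[of "int b - int a' + 1"] ab by auto
    then have "(entry_side (h p) (int b - int a'), East) \<in> D (a', b)" unfolding mem_cell using p(1) by auto
    then show ?thesis using tb(5)[of "(a', b)"] ca nb[of "(a', b)"] ab by blast
  qed
  have cb': "D (a, b') = r_elbow \<or> D (a, b') = vertical"
  proof -
    have "h p (int b' - int a) = int a" "h p (int b' - int a - 1) = int a + 1"
      using hp[of "int b' - int a"] hp[of "int b' - int a - 1"] ab by auto
    then have "(South, exit_side (h p) (int b' - int a)) \<in> D (a, b')" unfolding mem_cell using p(1) by auto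
    then show ?thesis using tb(8)[of "(a, b')"] cb nb[of "(a, b')"] ab by blast
  qed
  have inner: "D (i, j) = cross" if "a < i" "i \<le> a'" "b < j" "j \<le> b'" "(i, j) \<noteq> (a', b')" for i j
    using that
  proof (induction "(a' - i) + (b' - j)" arbitrary: i j rule: less_induct)
    case less
    show ?case
    proof (cases "i = a' \<or> j = b'")
      case True
      then show ?thesis using R[of i] B[of j] less.prems by force
    next
      case False
      then have ij: "i < a'" "j < b'" using less.prems by auto
      have "D (Suc i, j) = cross" "D (i, Suc j) = cross"
        using less.hyps[of "Suc i" j] less.hyps[of i "Suc j"] less.prems ij by auto
      then have "\<exists>e. (e, East) \<in> D (i, j)" "\<exists>f. (South, f) \<in> D (i, j)"
        unfolding north_south[symmetric] east_west tb(6,7) by simp_all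
      moreover have "D (i, j) \<noteq> bump" using nb[of "(i, j)"] ij by simp
      moreover have "horizontal \<noteq> vertical" by simp
      ultimately have "D (i, j) = cross \<or> D (i, j) = r_elbow" unfolding tb(5,8) by metis
      moreover have "False" if je: "D (i, j) = r_elbow"
      proof -
        define d where "d = int j - int i"
        obtain q where q: "1 \<le> q" "h q d = int i" "h q (d - 1) \<noteq> int i" "h q (d + 1) = int i"
          using tb(1)[of "(i, j)"] je unfolding mem_cell d_def by auto
        have fwd: "k < b' - j \<Longrightarrow> h q (d + int k + 1) = int i \<and> h q (d + int k) = int i" for k
        proof (induction k)
          case 0
          then show ?case using q by simp
        next
          case (Suc k)
          have eq: "h q (d + int (Suc k)) = int i" and eq': "h q (d + int k) = int i"
            using Suc by (auto simp: algebra_simps)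
          then have "cell_at (h q) (d + int (Suc k)) = (i, j + Suc k)" using Suc.prems by (simp add: cell_at_def d_def nat_add_distrib)
          moreover have "D (i, j + Suc k) = cross" using less.hyps[of i "j + Suc k"] less.prems Suc.prems ij by auto
          ultimately have "D (cell_at (h q) (d + int (Suc k))) = cross" by simp
          from cross_straight[OF q(1) this] show ?case using eq eq' by (simp add: algebra_simps)
        qed
        have bwd: "k < a' - i \<Longrightarrow> h q (d - int k - 1) = int i + int k + 1 \<and> h q (d - int k) = int i + int k" for k
        proof (induction k)
          case 0
          then show ?case using q step_back[OF q(1), of d] by simp
        next
          case (Suc k)
          have eq: "h q (d - int (Suc k)) = int i + int (Suc k)" and eq': "h q (d - int k) = int i + int k"
            using Suc by (auto simp: algebra_simps)
          then have "cell_at (h q) (d - int (Suc k)) = (i + Suc k, j)" using Suc.prems by (simp add: cell_at_def d_def nat_add_distrib)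
          moreover have "D (i + Suc k, j) = cross" using less.hyps[of "i + Suc k" j] less.prems Suc.prems ij by auto
          ultimately have "D (cell_at (h q) (d - int (Suc k))) = cross" by simp
          from cross_straight[OF q(1) this] have "h q (d - int (Suc k) - 1) \<noteq> h q (d - int (Suc k))"
            using eq eq' by (simp add: algebra_simps)
          then show ?case using step_back[OF q(1), of "d - int (Suc k)"] eq by simp
        qed
        have "d + int (b' - j - 1) = int b' - int i - 1" using ij by (simp add: d_def of_nat_diff)
        from fwd[of "b' - j - 1", unfolded this] have A: "h q (int b' - int i) = int i" "h q (int b' - int i - 1) = int i"
          using ij by simp_all
        then have "cell_at (h q) (int b' - int i) = (i, b')" by (simp add: cell_at_def)
        then have "h q (int b' - int i + 1) = int i"
          using cross_straight[OF q(1), of "int b' - int i"] R[of i] less.prems ij A by simp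
        then have X1: "crosses (h q) (h p) (int b' - int i)" using pv[of i "h q"] A ij less.prems by simp
        have C: "h q (int j - int a') = int a'" "h q (int j - int a' + 1) = int a' - 1"
          using bwd[of "a' - i - 1"] ij by (simp_all add: d_def algebra_simps)
        then have "cell_at (h q) (int j - int a') = (a', j)" by (simp add: cell_at_def)
        then have "h q (int j - int a' - 1) \<noteq> int a'"
          using cross_straight[OF q(1), of "int j - int a'"] B[of j] less.prems ij C by simp
        then have "h q (int j - int a' - 1) = int a' + 1" using step_back[OF q(1), of "int j - int a'"] C by simp
        then have X2: "crosses (h p) (h q) (int j - int a')" using ph[of j "h q"] C ij less.prems by simp
        have "int b' - int i = int j - int a'" using red p(1) q(1) X1 X2 unfolding reduced_def by blast
        then show False using ij by simp
      qed
      ultimately show ?thesis by blast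
    qed
  qed
  have leftcol: "i + k = a' \<Longrightarrow> 0 < k \<Longrightarrow> a < i \<Longrightarrow> D (i, b) = horizontal" for i k
  proof (induction k arbitrary: i)
    case (Suc k)
    have "D (i, Suc b) = cross" using inner[of i "Suc b"] Suc.prems ab by auto
    then have "\<exists>e. (e, East) \<in> D (i, b)" unfolding east_west tb(7) by simp
    moreover have "D (Suc i, b) = horizontal \<or> D (Suc i, b) = r_elbow"
      using Suc ca' by (cases "k = 0") auto
    then have "\<not> (\<exists>f. (South, f) \<in> D (i, b))"
      unfolding north_south[symmetric] tb(6) by auto
    ultimately show ?case unfolding tb(5,8) by blast
  qed simp
  have top: "j + k = b' \<Longrightarrow> 0 < k \<Longrightarrow> b < j \<Longrightarrow> D (a, j) = vertical" for j k
  proof (induction k arbitrary: j)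
    case (Suc k)
    have "D (Suc a, j) = cross" using inner[of "Suc a" j] Suc.prems ab by auto
    then have "\<exists>f. (South, f) \<in> D (a, j)" unfolding north_south[symmetric] tb(6) by simp
    moreover have "D (a, Suc j) = vertical \<or> D (a, Suc j) = r_elbow"
      using Suc cb' by (cases "k = 0") auto
    then have "\<not> (\<exists>e. (e, East) \<in> D (a, j))"
      unfolding east_west tb(7) by auto
    ultimately show ?case unfolding tb(5,8) by blast
  qed simp
  have left: "D (i, b) = horizontal" if "a < i" "i < a'" for i using leftcol[of i "a' - i"] that by simp
  have top': "D (a, j) = vertical" if "b < j" "j < b'" for j using top[of j "b' - j"] that by simp
  have corner: "D (a, b) = blank \<or> D (a, b) = j_elbow"
  proof -
    have "D (Suc a, b) = horizontal \<or> D (Suc a, b) = r_elbow"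
      using ca' left[of "Suc a"] ab by (cases "Suc a = a'") auto
    then have "\<not> (\<exists>f. (South, f) \<in> D (a, b))" unfolding north_south[symmetric] tb(6) by auto
    moreover have "D (a, Suc b) = vertical \<or> D (a, Suc b) = r_elbow"
      using cb' top'[of "Suc b"] ab by (cases "Suc b = b'") auto
    then have "\<not> (\<exists>e. (e, East) \<in> D (a, b))" unfolding east_west tb(7) by auto
    ultimately show ?thesis using tile_cases[of "(a, b)"] unfolding tb(5,8) by blast
  qed
  have "D (a', b') = j_elbow \<or> D (a', b') = bump" using x tb(2) by blast
  then have "undroop_config D a b a' b'"
    unfolding undroop_config_def using ab R B left top' corner ca' cb' by simp
  moreover have "((a', b'), (West, North)) = strand_at (h p) (int b' - int a')"
    using p unfolding d0_def by (simp add: strand_at_def cell_at_def)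
  ultimately show ?thesis using that p(1) low by blast
qed

end

section \<open>Min-droops as moves between states\<close>

text \<open>The exits give the same permutation and the crossings are equally many, so reducedness
  carries over without comparing pairs of pipes.\<close>

lemma traced_reroute:
  assumes tr: "traced n D h \<pi>" and red: "reduced h" and p': "pipes D' (h(p := g))"
    and ex: "\<And>r. exits_at g r \<longleftrightarrow> exits_at (h p) r" and out: "outside_standard m D'" and nm: "n \<le> m"
    and card: "card (crossings D') = card (crossings D)"
  shows "traced m D' (h(p := g)) \<pi> \<and> reduced (h(p := g))"
proof
  have "\<pi> permutes {1..m}" using tr nm permutes_subset[of \<pi> "{1..n}" "{1..m}"] by (auto simp: traced_def)
  moreover have "exits_at ((h(p := g)) (\<pi> r)) r" if "1 \<le> r" for r
    using tr that ex[of r] unfolding traced_def by (cases "\<pi> r = p") auto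
  ultimately show tr': "traced m D' (h(p := g)) \<pi>" using p' out unfolding traced_def by blast
  show "reduced (h(p := g))"
    using perm_length_eq_iff_reduced[OF tr] perm_length_eq_iff_reduced[OF tr'] card red by simp
qed

lemma rectangle_outside:
  assumes out: "outside_standard n D" and ab: "1 \<le> a" "1 \<le> b" "a < a'" "b < b'" and m: "n \<le> m" "a' \<le> m" "b' \<le> m"
  shows "outside_standard m (droop a b a' b' D)" "outside_standard m (undroop a b a' b' D)"
proof -
  have "droop a b a' b' D (i, j) = D (i, j) \<and> undroop a b a' b' D (i, j) = D (i, j)"
    if "\<not> (i \<in> {1..m} \<and> j \<in> {1..m})" for i j
    using that ab m by (intro conjI droop_other) auto
  moreover have "outside_standard m D" using outside_standard_mono[OF out m(1)] .
  ultimately show "outside_standard m (droop a b a' b' D)" "outside_standard m (undroop a b a' b' D)"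
    unfolding outside_standard_def by metis+
qed

lemma nonblank_pos: "outside_standard n D \<Longrightarrow> D (i, j) \<noteq> blank \<Longrightarrow> 1 \<le> i \<and> 1 \<le> j"
proof (rule ccontr)
  assume "outside_standard n D" "D (i, j) \<noteq> blank" and z: "\<not> (1 \<le> i \<and> 1 \<le> j)"
  then have "id_tiling (i, j) \<noteq> blank" using outside_standardD[of n D i j] by auto
  moreover have "i = 0 \<or> j = 0" using z by auto
  ultimately show False by (simp add: id_tiling_def)
qed

lemma nonstandard_window:
  assumes "outside_standard n D" "D (i, j) = cross \<or> D (i, j) = j_elbow \<or> D (i, j) = bump \<or> D (i, j) = blank" "1 \<le> i" "1 \<le> j"
  shows "i \<le> n" "j \<le> n"
proof -
  have "D (i, j) \<noteq> id_tiling (i, j)" using assms(2-4) by (auto simp: id_tiling_def)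
  then show "i \<le> n" "j \<le> n" using outside_standardD[OF assms(1), of i j] assms(3,4) by auto
qed

text \<open>The new corner may lie outside the window of size \<open>n\<close>, hence the new size
  \<open>m\<close>.\<close>

lemma droop_state:
  assumes st: "state n k \<pi> (South, East) D (a, b)"
  obtains a' b' m where "droop_config D a b a' b'" "1 \<le> a" "1 \<le> b" "state m k \<pi> (West, North) (droop a b a' b' D) (a', b')"
proof -
  obtain h where h: "pipes D h" "traced n D h \<pi>" "reduced h" "outside_standard n D" "\<pi> permutes {1..n}"
    "\<And>y. y \<noteq> (a, b) \<Longrightarrow> D y \<noteq> bump" "(South, East) \<in> D (a, b)" "\<exists>r\<le>k. exits_row D ((a, b), (South, East)) r"
    using stateE[OF st] by metis
  interpret pipes D h by fact
  have pos: "1 \<le> a" "1 \<le> b" using nonblank_pos[OF h(4), of a b] h(7) by (auto simp: blank_def)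
  define a' where "a' = a + (LEAST x. 0 < x \<and> D (a + x, b) \<noteq> cross)"
  define b' where "b' = b + (LEAST y. 0 < y \<and> D (a, b + y) \<noteq> cross)"
  \<comment> \<open>All crosses lie in the window, so the search for the ends of both sides
    succeeds.\<close>
  have nc: "D (i, j) \<noteq> cross" if "i > n \<or> j > n" for i j
    using crossings_window[OF h(4)] that by (auto simp: crossings_def)
  have "\<exists>x>0. D (a + x, b) \<noteq> cross" using nc[of "a + (n + 1)" b] by (intro exI[of _ "n + 1"]) auto
  from LeastI_ex[OF this] have a': "a < a'" "D (a', b) \<noteq> cross" by (auto simp: a'_def)
  have "\<exists>y>0. D (a, b + y) \<noteq> cross" using nc[of a "b + (n + 1)"] by (intro exI[of _ "n + 1"]) auto
  from LeastI_ex[OF this] have b': "b < b'" "D (a, b') \<noteq> cross" by (auto simp: b'_def)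
  have L: "D (i, b) = cross" if "a < i" "i < a'" for i
    using not_less_Least[of "i - a" "\<lambda>x. 0 < x \<and> D (a + x, b) \<noteq> cross"] that by (auto simp: a'_def)
  have T: "D (a, j) = cross" if "b < j" "j < b'" for j
    using not_less_Least[of "j - b" "\<lambda>y. 0 < y \<and> D (a, b + y) \<noteq> cross"] that by (auto simp: b'_def)
  obtain p where p: "1 \<le> p" "((a, b), (South, East)) = strand_at (h p) (int b - int a)"
    "upper_path a b a' b' (h p)" and cf: "droop_config D a b a' b'"
    using droop_rectangle[OF h(3,7,6) a'(1) b'(1) L T a'(2) b'(2)] by metis
  define g where "g = to_lower a b a' b' (h p)"
  define D' where "D' = droop a b a' b' D"
  define m where "m = max n (max a' b')"
  have p': "pipes D' (h(p := g))" unfolding D'_def g_def by (rule droop_pipes[OF cf p(1,3)])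
  interpret p': pipes D' "h(p := g)" by (rule p')
  have ex: "exits_at g r \<longleftrightarrow> exits_at (h p) r" for r unfolding g_def by (rule exits_at_to_lower)
  have tr': "traced m D' (h(p := g)) \<pi> \<and> reduced (h(p := g))"
  proof (rule traced_reroute[OF h(2,3) p' ex])
    show "outside_standard m D'" unfolding D'_def
      using rectangle_outside(1)[OF h(4) pos a'(1) b'(1)] by (simp add: m_def)
    show "n \<le> m" by (simp add: m_def)
    show "card (crossings D') = card (crossings D)"
      unfolding D'_def by (rule card_cross_shift[OF cf finite_crossings[OF h(4)]])
  qed
  have low: "lower_path a b a' b' g" unfolding g_def by (rule lower_to_lower[OF p(3) a'(1) b'(1)])
  have WN: "((a', b'), (West, North)) = strand_at ((h(p := g)) p) (int b' - int a')"
    using low a'(1) b'(1) unfolding p'.strand_eq_iff[OF p(1)] lower_path_def by simp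
  have "\<exists>r\<le>k. exits_row D' ((a', b'), (West, North)) r"
    using h(8) unfolding WN p'.exits_row_iff[OF p(1)] p(2) exits_row_iff[OF p(1)] using ex by simp
  moreover have "(West, North) \<in> D' (a', b')"
    using WN p'.mem p(1) by metis
  moreover have "D' y \<noteq> bump" if "y \<noteq> (a', b')" for y
  proof -
    obtain i j where y: "y = (i, j)" by fastforce
    show ?thesis
      unfolding y D'_def
    proof (cases rule: rectangle_cases[of i a j b _ a' b'])
      case a'_b'
      then show "droop a b a' b' D (i, j) \<noteq> bump" using that y by simp
    next
      case other
      show "droop a b a' b' D (i, j) \<noteq> bump" unfolding droop_other(1)[OF other] using h(6) other(1) by blast
    qed (use a'(1) b'(1) in \<open>simp_all add: droop_vals\<close>)
  qed
  ultimately have "state m k \<pi> (West, North) D' (a', b')" unfolding state_def using tr' by blast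
  then show ?thesis using that cf pos unfolding D'_def by blast
qed

text \<open>The window is kept: a W-N turn is not a standard tile, so \<open>(a', b')\<close> is in
  the window, and the other corner lies to its north-west. The measure of the inverse process relies
  on this.\<close>

lemma undroop_state:
  assumes st: "state n k \<pi> (West, North) D (a', b')"
  obtains a b where "undroop_config D a b a' b'" "1 \<le> a" "1 \<le> b" "a' \<le> n" "b' \<le> n"
    "state n k \<pi> (South, East) (undroop a b a' b' D) (a, b)"
proof -
  obtain h where h: "pipes D h" "traced n D h \<pi>" "reduced h" "outside_standard n D" "\<pi> permutes {1..n}"
    "\<And>y. y \<noteq> (a', b') \<Longrightarrow> D y \<noteq> bump" "(West, North) \<in> D (a', b')" "\<exists>r\<le>k. exits_row D ((a', b'), (West, North)) r"
    using stateE[OF st] by metis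
  interpret pipes D h by fact
  have pos': "1 \<le> a'" "1 \<le> b'" using nonblank_pos[OF h(4), of a' b'] h(7) by (auto simp: blank_def)
  have tile: "D (a', b') = j_elbow \<or> D (a', b') = bump" using tile_by_segments(2)[OF tile_cases] h(7) by blast
  then have win: "a' \<le> n" "b' \<le> n" using nonstandard_window[OF h(4) _ pos'] by auto
  have D0: "D (0, j) \<noteq> cross" "D (i, 0) \<noteq> cross" for i j
    using outside_standardD[OF h(4), of 0 j] outside_standardD[OF h(4), of i 0] by (auto simp: id_tiling_def)
  \<comment> \<open>The nearest cells above and to the left that are not crosses; the padding in row
    and column 0 provides candidates.\<close>
  let ?A = "{i. i < a' \<and> D (i, b') \<noteq> cross}" let ?B = "{j. j < b' \<and> D (a', j) \<noteq> cross}"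
  define a where "a = Max ?A" define b where "b = Max ?B"
  have "0 \<in> ?A" "0 \<in> ?B" using pos' D0 by auto
  then have "?A \<noteq> {}" "?B \<noteq> {}" by blast+
  then have "a \<in> ?A" "b \<in> ?B" unfolding a_def b_def using Max_in[of ?A] Max_in[of ?B] by simp_all
  then have ab: "a < a'" "b < b'" and ca: "D (a', b) \<noteq> cross" and cb: "D (a, b') \<noteq> cross" by auto
  have R: "D (i, b') = cross" if "a < i" "i < a'" for i
  proof (rule ccontr)
    assume "D (i, b') \<noteq> cross"
    then have "i \<le> a" unfolding a_def using that by (intro Max_ge) auto
    then show False using that by simp
  qed
  have B: "D (a', j) = cross" if "b < j" "j < b'" for j
  proof (rule ccontr)
    assume "D (a', j) \<noteq> cross"
    then have "j \<le> b" unfolding b_def using that by (intro Max_ge) auto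
    then show False using that by simp
  qed
  obtain p where p: "1 \<le> p" "((a', b'), (West, North)) = strand_at (h p) (int b' - int a')"
    "lower_path a b a' b' (h p)" and cf: "undroop_config D a b a' b'"
    using undroop_rectangle[OF h(3,7,6) ab R B ca cb] by metis
  have "D (a, b') \<noteq> blank" "D (a', b) \<noteq> blank" using undroop_configD(4,5)[OF cf] by auto
  then have pos: "1 \<le> a" "1 \<le> b" using nonblank_pos[OF h(4)] by auto
  define g where "g = to_upper a b a' b' (h p)"
  define D' where "D' = undroop a b a' b' D"
  have p': "pipes D' (h(p := g))" unfolding D'_def g_def by (rule undroop_pipes[OF cf p(1,3)])
  interpret p': pipes D' "h(p := g)" by (rule p')
  have ex: "exits_at g r \<longleftrightarrow> exits_at (h p) r" for r unfolding g_def by (rule exits_at_to_upper)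
  have out': "outside_standard n D'" unfolding D'_def using rectangle_outside(2)[OF h(4) pos ab] win by simp
  have tr': "traced n D' (h(p := g)) \<pi> \<and> reduced (h(p := g))"
  proof (rule traced_reroute[OF h(2,3) p' ex out'])
    have "droop a b a' b' D' = D" unfolding D'_def by (rule droop_undroop[OF cf])
    then show "card (crossings D') = card (crossings D)"
      using card_cross_shift[OF droop_config_undroop[OF cf]] finite_crossings[OF out'] unfolding D'_def by simp
  qed simp
  have up: "upper_path a b a' b' g" unfolding g_def by (rule upper_to_upper[OF p(3) ab])
  have SE: "((a, b), (South, East)) = strand_at ((h(p := g)) p) (int b - int a)"
    using up ab unfolding p'.strand_eq_iff[OF p(1)] upper_path_def by simp
  have "\<exists>r\<le>k. exits_row D' ((a, b), (South, East)) r"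
    using h(8) unfolding SE p'.exits_row_iff[OF p(1)] p(2) exits_row_iff[OF p(1)] using ex by simp
  moreover have "(South, East) \<in> D' (a, b)"
    using SE p'.mem p(1) by metis
  moreover have "D' y \<noteq> bump" if "y \<noteq> (a, b)" for y
  proof -
    obtain i j where y: "y = (i, j)" by fastforce
    show ?thesis
      unfolding y D'_def
    proof (cases rule: rectangle_cases[of i a j b _ a' b'])
      case a_b
      then show "undroop a b a' b' D (i, j) \<noteq> bump" using that y by simp
    next
      case other
      show "undroop a b a' b' D (i, j) \<noteq> bump" unfolding droop_other(2)[OF other] using h(6) other(4) by blast
    qed (use ab in \<open>simp_all add: undroop_vals\<close>)
  qed
  ultimately have "state n k \<pi> (South, East) D' (a, b)" unfolding state_def using tr' by blast
  then show ?thesis using that cf pos win unfolding D'_def by blast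
qed

text \<open>The right and the bottom side are runs of crosses ended by a tile that is not a cross,
  so the corner \<open>(a', b')\<close> fixes their lengths.\<close>

lemma undroop_config_unique:
  assumes c: "undroop_config D a b a' b'" and c': "undroop_config D e f a' b'"
  shows "a = e \<and> b = f"
proof
  have "\<not> u < w" if "undroop_config D u v a' b'" "undroop_config D w z a' b'" for u v w z
    using undroop_configD(10)[OF that(1), of w] undroop_configD(1,5)[OF that(2)] by auto
  then show "a = e" using c c' linorder_neqE_nat by metis
  have "\<not> v < z" if "undroop_config D u v a' b'" "undroop_config D w z a' b'" for u v w z
    using undroop_configD(9)[OF that(1), of z] undroop_configD(2,4)[OF that(2)] by auto
  then show "b = f" using c c' linorder_neqE_nat by metis
qed

section \<open>Termination measure and weights\<close>

text \<open>The sum of the columns of these cells measures the progress of the inverse process: a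
  min-droop moves the segments that leave to the north into a column further right, and a
  cross-bump-swap keeps the cells.\<close>

definition north_cells :: "nat \<Rightarrow> tiling \<Rightarrow> cell set" where
  "north_cells n D = {x \<in> {1..n} \<times> {1..n}. D x \<in> {vertical, cross, j_elbow, bump}}"

lemma finite_north_cells: "finite (north_cells n D)"
  unfolding north_cells_def by simp

lemma north_cells_droop:
  assumes c: "droop_config D a b a' b'" and pos: "1 \<le> a" "1 \<le> b" "a' \<le> n" "b' \<le> n"
  shows "(\<Sum>x\<in>north_cells n D. snd x) < (\<Sum>x\<in>north_cells n (droop a b a' b' D). snd x)"
proof -
  note ab = droop_configD(1,2)[OF c]
  \<comment> \<open>Row \<open>a'\<close> is included and row \<open>a\<close> is not: the drooping
    pipe leaves \<open>(a', b)\<close> to the north but \<open>(a, b)\<close> to the east.\<close>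
  define L where "L = (\<lambda>i. (i, b)) ` {a<..a'}"
  define R where "R = (\<lambda>i. (i, b')) ` {a<..a'}"
  let ?N = "{vertical, cross, j_elbow, bump}"
  note V = droop_vals[OF ab] droop_configD(7-10)[OF c]
  have eq: "droop a b a' b' D (i, j) \<in> ?N \<longleftrightarrow> D (i, j) \<in> ?N \<and> \<not> (j = b \<and> a < i \<and> i \<le> a') \<or> j = b' \<and> a < i \<and> i \<le> a'" for i j
  proof (cases rule: rectangle_cases[of i a j b _ a' b'])
    case a_b
    then show ?thesis using ab droop_configD(3)[OF c] by (elim disjE) (simp_all add: V)
  next
    case a'_b
    then show ?thesis using ab droop_configD(4)[OF c] by (elim disjE) (simp_all add: V)
  next
    case a_b'
    then show ?thesis using ab droop_configD(5)[OF c] by (elim disjE) (simp_all add: V)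
  next
    case a'_b'
    then show ?thesis using ab droop_configD(6)[OF c] by (elim disjE) (simp_all add: V)
  next
    case other
    have "\<not> (j = b \<and> a < i \<and> i \<le> a')" "\<not> (j = b' \<and> a < i \<and> i \<le> a')"
      using other(2,4,5,8) by auto
    then show ?thesis unfolding droop_other(1)[OF other] by metis
  qed (use ab in \<open>simp_all add: V\<close>)
  have mem: "(i, j) \<in> L \<longleftrightarrow> j = b \<and> a < i \<and> i \<le> a'" "(i, j) \<in> R \<longleftrightarrow> j = b' \<and> a < i \<and> i \<le> a'" for i j
    by (auto simp: L_def R_def)
  have Niff: "x \<in> north_cells n E \<longleftrightarrow> x \<in> {1..n} \<times> {1..n} \<and> E x \<in> ?N" for x E
    by (simp add: north_cells_def)
  have W: "L \<subseteq> {1..n} \<times> {1..n}" "R \<subseteq> {1..n} \<times> {1..n}" using pos ab by (auto simp: L_def R_def)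
  have Nd: "north_cells n (droop a b a' b' D) = (north_cells n D - L) \<union> R"
  proof (rule set_eqI)
    fix x :: cell
    obtain i j where x: "x = (i, j)" by fastforce
    show "x \<in> north_cells n (droop a b a' b' D) \<longleftrightarrow> x \<in> (north_cells n D - L) \<union> R"
      using W(2) unfolding x Un_iff Diff_iff Niff eq mem[symmetric] by blast
  qed
  have "D (i, b) \<in> ?N" if "a < i" "i \<le> a'" for i
    using that droop_configD(4)[OF c] droop_configD(7)[OF c, of i] by (cases "i = a'") auto
  then have LN: "L \<subseteq> north_cells n D" using W(1) unfolding subset_iff Niff by (metis mem(1) surj_pair)
  have "D (i, b') \<notin> ?N" if "a < i" "i \<le> a'" for i
    using that droop_configD(6)[OF c] droop_configD(10)[OF c, of i] by (cases "i = a'") auto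
  then have RN: "R \<inter> north_cells n D = {}" unfolding disjoint_iff Niff by (metis mem(2) surj_pair)
  have fin: "finite L" "finite R" by (auto simp: L_def R_def)
  have "(\<Sum>x\<in>north_cells n D. snd x) = (\<Sum>x\<in>north_cells n D - L. snd x) + (\<Sum>x\<in>L. snd x)"
    using sum.subset_diff[OF LN finite_north_cells] .
  moreover have "(\<Sum>x\<in>north_cells n (droop a b a' b' D). snd x) = (\<Sum>x\<in>north_cells n D - L. snd x) + (\<Sum>x\<in>R. snd x)"
    unfolding Nd using RN finite_north_cells fin by (intro sum.union_disjoint) auto
  moreover have "(\<Sum>x\<in>L. snd x) = (a' - a) * b" unfolding L_def by (subst sum.reindex) (auto simp: inj_on_def)
  moreover have "(\<Sum>x\<in>R. snd x) = (a' - a) * b'" unfolding R_def by (subst sum.reindex) (auto simp: inj_on_def)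
  moreover have "(a' - a) * b < (a' - a) * b'" using ab by simp
  ultimately show ?thesis by linarith
qed

section \<open>Weights\<close>

text \<open>Excluding the padding makes the set finite and independent of the window, so weights can
  be compared while the window grows.\<close>

definition blanks :: "tiling \<Rightarrow> cell set" where
  "blanks D = {x. 1 \<le> fst x \<and> 1 \<le> snd x \<and> D x = blank}"

definition blank_wt :: "tiling \<Rightarrow> int_mpoly" where
  "blank_wt D = (\<Prod>x\<in>blanks D. X (fst x))"

lemma blanks_window: "outside_standard n D \<Longrightarrow> blanks D = {x \<in> {1..n} \<times> {1..n}. D x = blank}"
  using nonstandard_window[of n D] unfolding blanks_def by fastforce

lemma bpd_wt_blank_wt: "outside_standard n D \<Longrightarrow> bpd_wt n D = blank_wt D"
  unfolding bpd_wt_def blank_wt_def by (subst blanks_window) (auto intro!: prod.cong)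

lemma finite_blanks: "outside_standard n D \<Longrightarrow> finite (blanks D)"
  by (simp add: blanks_window)

text \<open>Blanks change in two corners only: an r-elbow at \<open>(a, b)\<close> leaves a blank
  behind, and a blank at \<open>(a', b')\<close> turns into a j-elbow. The factors are placed so
  that no division occurs.\<close>

lemma blank_wt_droop:
  assumes c: "droop_config D a b a' b'" and pos: "1 \<le> a" "1 \<le> b" and fin: "finite (blanks D)"
  shows "blank_wt (droop a b a' b' D) * (if droop a b a' b' D (a', b') = j_elbow then X a' else 1) =
    blank_wt D * (if D (a, b) = r_elbow then X a else 1)"
proof -
  note ab = droop_configD(1,2)[OF c]
  define C where "C = blanks D - {(a', b')}"
  note V = droop_vals[OF ab] droop_configD(7-10)[OF c]
  have Dab: "D (a, b) \<noteq> blank" using droop_configD(3)[OF c] by auto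
  have eq: "droop a b a' b' D (i, j) = blank \<longleftrightarrow> D (i, j) = blank \<and> (i, j) \<noteq> (a', b') \<or> (i, j) = (a, b) \<and> D (a, b) = r_elbow" for i j
  proof (cases rule: rectangle_cases[of i a j b _ a' b'])
    case a_b
    then show ?thesis using ab droop_configD(3)[OF c] by (elim disjE) (simp_all add: V)
  next
    case a'_b
    then show ?thesis using ab droop_configD(4)[OF c] by (elim disjE) (simp_all add: V)
  next
    case a_b'
    then show ?thesis using ab droop_configD(5)[OF c] by (elim disjE) (simp_all add: V)
  next
    case a'_b'
    then show ?thesis using ab droop_configD(6)[OF c] by (elim disjE) (simp_all add: V)
  next
    case other
    show ?thesis unfolding droop_other(1)[OF other] using other(1,4) by metis
  qed (use ab in \<open>simp_all add: V\<close>)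
  have "blanks (droop a b a' b' D) = C \<union> (if D (a, b) = r_elbow then {(a, b)} else {})"
  proof (rule set_eqI)
    fix x :: cell
    obtain i j where x: "x = (i, j)" by fastforce
    show "x \<in> blanks (droop a b a' b' D) \<longleftrightarrow> x \<in> C \<union> (if D (a, b) = r_elbow then {(a, b)} else {})"
      using eq[of i j] pos unfolding x C_def blanks_def by auto
  qed
  moreover have "(a, b) \<notin> C" "finite C" using Dab fin by (auto simp: C_def blanks_def)
  ultimately have w1: "blank_wt (droop a b a' b' D) = (\<Prod>x\<in>C. X (fst x)) * (if D (a, b) = r_elbow then X a else 1)"
    unfolding blank_wt_def by (simp add: mult.commute)
  have w2: "blank_wt D = (\<Prod>x\<in>C. X (fst x)) * (if D (a', b') = blank then X a' else 1)"
  proof (cases "D (a', b') = blank")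
    case True
    then have "blanks D = insert (a', b') C" using pos ab by (auto simp: C_def blanks_def)
    moreover have "(a', b') \<notin> C" by (simp add: C_def)
    ultimately show ?thesis using True \<open>finite C\<close> by (simp add: blank_wt_def mult.commute)
  next
    case False
    then have "blanks D = C" by (auto simp: C_def blanks_def)
    then show ?thesis using False by (simp add: blank_wt_def)
  qed
  have "droop a b a' b' D (a', b') = j_elbow \<longleftrightarrow> D (a', b') = blank" by (simp add: V)
  then show ?thesis unfolding w1 w2 by simp
qed

section \<open>The insertion as a reversible process\<close>

context pipes
begin

text \<open>Followed to the west, a pipe can leave its row only through an r-elbow or a bump;
  without these each tile passes the connection on to its left neighbour.\<close>

lemma row_between:
  assumes W: "\<exists>f. (West, f) \<in> D (i, j\<^sub>1)" and no: "\<And>j. j\<^sub>2 < j \<Longrightarrow> j < j\<^sub>1 \<Longrightarrow> D (i, j) \<noteq> r_elbow \<and> D (i, j) \<noteq> bump"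
    and lt: "j\<^sub>2 < j\<^sub>1"
  shows "j\<^sub>2 < j \<Longrightarrow> j < j\<^sub>1 \<Longrightarrow> D (i, j) = horizontal \<or> D (i, j) = cross" and "\<exists>e. (e, East) \<in> D (i, j\<^sub>2)"
proof -
  note tb = tile_by_segments[OF tile_cases]
  have E: "j + Suc k = j\<^sub>1 \<Longrightarrow> j\<^sub>2 \<le> j \<Longrightarrow> \<exists>e. (e, East) \<in> D (i, j)" for j k
  proof (induction k arbitrary: j)
    case 0
    then show ?case using W east_west[of i j] by auto
  next
    case (Suc k)
    then have "\<exists>e. (e, East) \<in> D (i, Suc j)" by simp
    then have "D (i, Suc j) = horizontal \<or> D (i, Suc j) = cross"
      using no[of "Suc j"] Suc.prems unfolding tb(5) by auto
    then have "\<exists>f. (West, f) \<in> D (i, Suc j)" unfolding tb(7) by blast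
    then show ?case using east_west by blast
  qed
  show "\<exists>e. (e, East) \<in> D (i, j\<^sub>2)" using E[of j\<^sub>2 "j\<^sub>1 - j\<^sub>2 - 1"] lt by simp
  show "D (i, j) = horizontal \<or> D (i, j) = cross" if "j\<^sub>2 < j" "j < j\<^sub>1"
    using E[of j "j\<^sub>1 - j - 1"] no[of j] that unfolding tb(5) by auto
qed

lemma row_run:
  assumes p: "1 \<le> p" and s: "h p (int j\<^sub>2 - int i) = int i" "h p (int j\<^sub>2 - int i + 1) = int i"
    and "\<And>j. j\<^sub>2 < j \<Longrightarrow> j < j\<^sub>1 \<Longrightarrow> D (i, j) = horizontal \<or> D (i, j) = cross" "j\<^sub>2 < j\<^sub>1"
  shows "h p (int j\<^sub>1 - int i) = int i \<and> h p (int j\<^sub>1 - int i - 1) = int i"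
  using assms(4,5)
proof (induction j\<^sub>1)
  case (Suc j)
  show ?case
  proof (cases "j = j\<^sub>2")
    case True
    then show ?thesis using s by (simp add: algebra_simps)
  next
    case False
    then have j: "j\<^sub>2 < j" using Suc.prems by simp
    then have IH: "h p (int j - int i) = int i" "h p (int j - int i - 1) = int i" using Suc.IH Suc.prems(1) by auto
    have "cell_at (h p) (int j - int i) = (i, j)" using IH by (simp add: cell_at_def)
    then have "(entry_side (h p) (int j - int i), exit_side (h p) (int j - int i)) \<in> D (i, j)"
      using strand_in[OF p, of "int j - int i"] by simp
    moreover have "entry_side (h p) (int j - int i) = West" using IH by simp
    moreover have "(West, y) \<in> horizontal \<union> cross \<Longrightarrow> y = East" for y
      by (auto simp: horizontal_def cross_def)
    ultimately have "exit_side (h p) (int j - int i) = East"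
      using Suc.prems(1)[OF j] by (metis Un_iff lessI less_SucI)
    then show ?thesis using IH by (simp add: algebra_simps)
  qed
qed simp

text \<open>The r-elbow to which the insertion moves from a j-elbow lies on the same pipe, so the
  bound on the exit row is inherited.\<close>

lemma row_same_pipe:
  assumes r: "D (i, j\<^sub>2) = r_elbow" and e: "D (i, j\<^sub>1) = j_elbow" and lt: "j\<^sub>2 < j\<^sub>1"
    and bt: "\<And>j. j\<^sub>2 < j \<Longrightarrow> j < j\<^sub>1 \<Longrightarrow> D (i, j) = horizontal \<or> D (i, j) = cross"
  obtains p where "1 \<le> p" "((i, j\<^sub>2), (South, East)) = strand_at (h p) (int j\<^sub>2 - int i)"
    "((i, j\<^sub>1), (West, North)) = strand_at (h p) (int j\<^sub>1 - int i)"
proof -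
  have "(South, East) \<in> D (i, j\<^sub>2)" using r by (simp add: r_elbow_def)
  then obtain p d where p: "1 \<le> p" "((i, j\<^sub>2), (South, East)) = strand_at (h p) d" using strandE by metis
  then have s: "d = int j\<^sub>2 - int i" "h p (int j\<^sub>2 - int i) = int i" "h p (int j\<^sub>2 - int i + 1) = int i"
    unfolding strand_eq_iff[OF p(1)] by auto
  have run: "h p (int j\<^sub>1 - int i) = int i" "h p (int j\<^sub>1 - int i - 1) = int i"
    using row_run[OF p(1) s(2,3) bt lt] by auto
  have "cell_at (h p) (int j\<^sub>1 - int i) = (i, j\<^sub>1)" using run by (simp add: cell_at_def)
  then have "(entry_side (h p) (int j\<^sub>1 - int i), exit_side (h p) (int j\<^sub>1 - int i)) \<in> j_elbow"
    using strand_in[OF p(1), of "int j\<^sub>1 - int i"] e by simp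
  then have "((i, j\<^sub>1), (West, North)) = strand_at (h p) (int j\<^sub>1 - int i)"
    using run unfolding strand_eq_iff[OF p(1)] by (auto simp: j_elbow_def)
  then show ?thesis using that p s(1) by blast
qed

end

text \<open>What happens between two consecutive min-droops, apart from the final replacement.
  Separating it from the min-droops allows both to be inverted on their own.\<close>

inductive turn_step :: "nat \<Rightarrow> tiling \<times> cell \<Rightarrow> tiling \<times> cell \<Rightarrow> bool" for k where
  elbow: "\<lbrakk> D (i, j\<^sub>1) = j_elbow; j\<^sub>2 < j\<^sub>1; D (i, j\<^sub>2) = r_elbow; \<forall>j. j\<^sub>2 < j \<and> j < j\<^sub>1 \<longrightarrow> D (i, j) \<noteq> r_elbow \<rbrakk>
    \<Longrightarrow> turn_step k (D, (i, j\<^sub>1)) (D, (i, j\<^sub>2))"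
| swap: "\<lbrakk> D x = bump; bump_pipes_cross_at D x y \<rbrakk> \<Longrightarrow> turn_step k (D, x) (cross_bump_swap D x y, y)"
| pass: "\<lbrakk> D x = bump; \<not> (\<exists>y. bump_pipes_cross_at D x y); exits_row D (x, (South, East)) r; r \<le> k \<rbrakk>
    \<Longrightarrow> turn_step k (D, x) (D, x)"

definition insertion_round :: "nat \<Rightarrow> tiling \<times> cell \<Rightarrow> tiling \<times> cell \<Rightarrow> bool" where
  "insertion_round k s t \<longleftrightarrow> turn_step k (min_droop (fst s) (snd s)) t"

definition stops :: "nat \<Rightarrow> tiling \<times> cell \<Rightarrow> tiling \<Rightarrow> bool" where
  "stops k s D' \<longleftrightarrow> (\<exists>D x. min_droop (fst s) (snd s) = (D, x) \<and> stop_cond k D x \<and> D' = D(x := cross))"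

text \<open>The window is quantified away because a min-droop may enlarge it.\<close>

definition r_state :: "nat \<Rightarrow> perm \<Rightarrow> tiling \<times> cell \<Rightarrow> bool" where
  "r_state k \<pi> s \<longleftrightarrow> (\<exists>n. state n k \<pi> (South, East) (fst s) (snd s))"

definition j_state :: "nat \<Rightarrow> perm \<Rightarrow> tiling \<times> cell \<Rightarrow> bool" where
  "j_state k \<pi> s \<longleftrightarrow> (\<exists>n. state n k \<pi> (West, North) (fst s) (snd s))"

text \<open>The blank that a min-droop at an r-elbow creates and the blank that a j-elbow has used up
  are included in these weights, which makes them invariant.\<close>

definition r_wt :: "tiling \<times> cell \<Rightarrow> int_mpoly" where
  "r_wt s = blank_wt (fst s) * (if fst s (snd s) = r_elbow then X (fst (snd s)) else 1)"

definition j_wt :: "tiling \<times> cell \<Rightarrow> int_mpoly" where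
  "j_wt s = blank_wt (fst s) * (if fst s (snd s) = j_elbow then X (fst (snd s)) else 1)"

definition is_start :: "tiling \<times> cell \<Rightarrow> bool" where
  "is_start s \<longleftrightarrow> (\<exists>D i j. s = (D, (i, j)) \<and> D (i, j) = r_elbow \<and> (\<forall>j'>j. D (i, j') \<noteq> r_elbow))"

text \<open>As a path of rounds followed by a stop, a run can be extended at its front, compared
  with other runs and traversed backwards.\<close>

lemma insertion_loop_iff:
  "insertion_loop k D x D' \<longleftrightarrow> (\<exists>s. (insertion_round k)\<^sup>*\<^sup>* (D, x) s \<and> stops k s D')"
proof
  assume "insertion_loop k D x D'"
  then show "\<exists>s. (insertion_round k)\<^sup>*\<^sup>* (D, x) s \<and> stops k s D'"
  proof induction
    case (j_elbow D x D\<^sub>1 i\<^sub>1 j\<^sub>1 j\<^sub>2 D')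
    then have "insertion_round k (D, x) (D\<^sub>1, (i\<^sub>1, j\<^sub>2))" unfolding insertion_round_def by (auto intro: turn_step.elbow)
    then show ?case using j_elbow by (meson converse_rtranclp_into_rtranclp)
  next
    case (swap D x D\<^sub>1 x\<^sub>1 x\<^sub>2 D')
    then have "insertion_round k (D, x) (cross_bump_swap D\<^sub>1 x\<^sub>1 x\<^sub>2, x\<^sub>2)" unfolding insertion_round_def by (auto intro: turn_step.swap)
    then show ?case using swap by (meson converse_rtranclp_into_rtranclp)
  next
    case (continue D x D\<^sub>1 x\<^sub>1 r D')
    then have "insertion_round k (D, x) (D\<^sub>1, x\<^sub>1)" unfolding insertion_round_def by (auto intro: turn_step.pass)
    then show ?case using continue by (meson converse_rtranclp_into_rtranclp)
  next
    case (stop D x D\<^sub>1 x\<^sub>1)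
    then have "stops k (D, x) (D\<^sub>1(x\<^sub>1 := cross))" unfolding stops_def stop_cond_def by auto
    then show ?case by blast
  qed
next
  assume "\<exists>s. (insertion_round k)\<^sup>*\<^sup>* (D, x) s \<and> stops k s D'"
  then obtain s where "(insertion_round k)\<^sup>*\<^sup>* (D, x) s" "stops k s D'" by blast
  then show "insertion_loop k D x D'"
  proof (induction "(D, x)" arbitrary: D x rule: converse_rtranclp_induct)
    case base
    then show ?case unfolding stops_def stop_cond_def by (auto intro: insertion_loop.stop)
  next
    case (step t)
    obtain E y where t: "t = (E, y)" by (metis surj_pair)
    then have IH: "insertion_loop k E y D'" using step by blast
    from step(1) show ?case
      unfolding insertion_round_def fst_conv snd_conv t
    proof (cases rule: turn_step.cases)
      case (elbow i j\<^sub>1 j\<^sub>2)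
      then show ?thesis using insertion_loop.j_elbow[of D x E i j\<^sub>1 j\<^sub>2 k D'] IH by simp
    next
      case (swap D\<^sub>1 x\<^sub>1)
      then show ?thesis using insertion_loop.swap[of D x D\<^sub>1 x\<^sub>1 y k D'] IH by simp
    next
      case (pass r)
      then show ?thesis using insertion_loop.continue[of D x E y r k D'] IH by simp
    qed
  qed
qed

lemma min_droop_state:
  assumes "r_state k \<pi> s"
  shows "j_state k \<pi> (min_droop (fst s) (snd s))" "j_wt (min_droop (fst s) (snd s)) = r_wt s"
    "\<exists>D a b a' b'. s = (undroop a b a' b' D, (a, b)) \<and> min_droop (fst s) (snd s) = (D, (a', b')) \<and>
      undroop_config D a b a' b'"
proof -
  obtain D a b where s: "s = (D, (a, b))" by (metis surj_pair)
  obtain n where st: "state n k \<pi> (South, East) D (a, b)" using assms unfolding r_state_def s fst_conv snd_conv by blast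
  obtain a' b' m where cf: "droop_config D a b a' b'" and pos: "1 \<le> a" "1 \<le> b"
    and st': "state m k \<pi> (West, North) (droop a b a' b' D) (a', b')"
    using droop_state[OF st] by metis
  have md: "min_droop D (a, b) = (droop a b a' b' D, (a', b'))" by (rule min_droop_eq[OF cf])
  show "j_state k \<pi> (min_droop (fst s) (snd s))" using st' by (auto simp: s md j_state_def)
  have "outside_standard n D" using stateE[OF st] by metis
  then show "j_wt (min_droop (fst s) (snd s)) = r_wt s"
    using blank_wt_droop[OF cf pos finite_blanks] unfolding s fst_conv snd_conv md j_wt_def r_wt_def by blast
  show "\<exists>D a b a' b'. s = (undroop a b a' b' D, (a, b)) \<and> min_droop (fst s) (snd s) = (D, (a', b')) \<and>
      undroop_config D a b a' b'"
    using undroop_droop[OF cf] undroop_config_droop[OF cf] unfolding s fst_conv snd_conv md by metis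
qed

text \<open>Both states arise by \<open>undroop\<close> from the same tiling and the same corner,
  and that corner determines the rectangle.\<close>

lemma min_droop_inj:
  assumes "r_state k \<pi> s" "r_state k \<pi> t" "min_droop (fst s) (snd s) = min_droop (fst t) (snd t)"
  shows "s = t"
proof -
  obtain D a b a' b' where s: "s = (undroop a b a' b' D, (a, b))" "min_droop (fst s) (snd s) = (D, (a', b'))"
    "undroop_config D a b a' b'" using min_droop_state(3)[OF assms(1)] by blast
  obtain E e f e' f' where t: "t = (undroop e f e' f' E, (e, f))" "min_droop (fst t) (snd t) = (E, (e', f'))"
    "undroop_config E e f e' f'" using min_droop_state(3)[OF assms(2)] by blast
  have eq: "E = D" "e' = a'" "f' = b'" using s(2) t(2) assms(3) by auto
  have "a = e \<and> b = f" using undroop_config_unique[OF s(3)] t(3) unfolding eq by blast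
  then show ?thesis unfolding s(1) t(1) eq by simp
qed

lemma state_unique_crossing:
  assumes st: "state n k \<pi> s D x" and bx: "D x = bump"
    and y: "bump_pipes_cross_at D x y" "bump_pipes_cross_at D x z"
  shows "y = z"
proof -
  obtain h where h: "pipes D h" "reduced h" using stateE[OF st] by metis
  interpret pipes D h by fact
  obtain u v t where u: "1 \<le> u" and v: "1 \<le> v"
    and WN: "(x, (West, North)) = strand_at (h u) t" and SE: "(x, (South, East)) = strand_at (h v) t"
    using bump_strands[OF bx] by metis
  show ?thesis
    using y h(2) u v unfolding bump_pipes_cross_at_def WN SE cross_at_iff[OF u v] reduced_def by blast
qed

lemma blanks_swap:
  assumes "D x = bump" "D y = cross" shows "blank_wt (cross_bump_swap D x y) = blank_wt D"
proof -
  have "blanks (cross_bump_swap D x y) = blanks D"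
    using assms by (auto simp: blanks_def cross_bump_swap_def)
  then show ?thesis by (simp add: blank_wt_def)
qed

text \<open>For the weight: the passage from a j-elbow to an r-elbow stays in its row, so the
  additional factor is the same variable; at a bump neither weight has such a factor, and a swap
  changes no blank.\<close>

lemma turn_step_state:
  assumes j: "j_state k \<pi> s" and t: "turn_step k s t"
  shows "r_state k \<pi> t" "r_wt t = j_wt s"
proof -
  obtain D x where s: "s = (D, x)" by (metis surj_pair)
  obtain n where st: "state n k \<pi> (West, North) D x" using j unfolding j_state_def s fst_conv snd_conv by blast
  obtain h where h: "pipes D h" "traced n D h \<pi>" "reduced h" "outside_standard n D" "\<pi> permutes {1..n}"
    "\<And>y. y \<noteq> x \<Longrightarrow> D y \<noteq> bump" "(West, North) \<in> D x" "\<exists>r\<le>k. exits_row D (x, (West, North)) r"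
    using stateE[OF st] by metis
  interpret pipes D h by fact
  from t[unfolded s] have "r_state k \<pi> t \<and> r_wt t = j_wt s"
  proof (cases rule: turn_step.cases)
    case (elbow i j\<^sub>1 j\<^sub>2)
    have nb: "D y \<noteq> bump" for y using h(6)[of y] elbow by (cases "y = x") auto
    have "\<exists>f. (West, f) \<in> D (i, j\<^sub>1)" using elbow by (auto simp: j_elbow_def)
    then have bt: "D (i, j) = horizontal \<or> D (i, j) = cross" if "j\<^sub>2 < j" "j < j\<^sub>1" for j
      using row_between(1)[of i j\<^sub>1 j\<^sub>2 j] elbow nb that by auto
    obtain p where p: "1 \<le> p" "((i, j\<^sub>2), (South, East)) = strand_at (h p) (int j\<^sub>2 - int i)"
      "((i, j\<^sub>1), (West, North)) = strand_at (h p) (int j\<^sub>1 - int i)"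
      using row_same_pipe[OF elbow(5,3,4) bt] by blast
    have "\<exists>r\<le>k. exits_row D ((i, j\<^sub>2), (South, East)) r"
      using h(8) unfolding elbow p(2,3) exits_row_iff[OF p(1)] .
    then have "state n k \<pi> (South, East) D (i, j\<^sub>2)"
      unfolding state_def using h(2,3) nb elbow by (auto simp: r_elbow_def)
    then show ?thesis using elbow by (auto simp: s r_state_def r_wt_def j_wt_def)
  next
    case (swap y)
    have sw: "state n k \<pi> (South, East) (cross_bump_swap D x y) y \<and> cross_bump_swap D x y y = bump \<and>
      bump_pipes_cross_at (cross_bump_swap D x y) y x \<and> x \<noteq> y \<and> D y = cross"
      using swap_state[OF st] swap by simp
    then show ?thesis using swap blanks_swap[of D x y] by (auto simp: s r_state_def r_wt_def j_wt_def)
  next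
    case (pass r)
    then have "state n k \<pi> (South, East) D x"
      unfolding state_def using h(2,3,6) by (auto simp: bump_def)
    then show ?thesis using pass by (auto simp: s r_state_def r_wt_def j_wt_def)
  qed
  then show "r_state k \<pi> t" "r_wt t = j_wt s" by auto
qed

text \<open>The result reveals the turn: an r-elbow comes from a j-elbow, a bump whose pipes cross
  from a swap, a bump whose pipes do not cross from a pass. A swap is undone by swapping back at the
  only crossing of the two pipes.\<close>

lemma turn_step_inj:
  assumes j: "j_state k \<pi> s" "j_state k \<pi> s'" and t: "turn_step k s t" "turn_step k s' t"
  shows "s = s'"
proof -
  \<comment> \<open>If two j-elbows led to the same r-elbow, the nearer one would lie in the
    straight run between the r-elbow and the further one.\<close>
  have elbow_le: "\<not> j\<^sub>1 < j" if js: "j_state k \<pi> (D, (i, j))" and D: "D (i, j\<^sub>1) = j_elbow" "D (i, j) = j_elbow" "j\<^sub>2 < j\<^sub>1"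
    "\<forall>j'. j\<^sub>2 < j' \<and> j' < j \<longrightarrow> D (i, j') \<noteq> r_elbow" for D i j\<^sub>1 j\<^sub>2 j
  proof
    assume "j\<^sub>1 < j"
    obtain n where st: "state n k \<pi> (West, North) D (i, j)" using js unfolding j_state_def fst_conv snd_conv by blast
    obtain h where h: "pipes D h" "\<And>y. y \<noteq> (i, j) \<Longrightarrow> D y \<noteq> bump" using stateE[OF st] by metis
    interpret pipes D h by fact
    have "\<exists>f. (West, f) \<in> D (i, j)" using D by (auto simp: j_elbow_def)
    then have "D (i, j\<^sub>1) = horizontal \<or> D (i, j\<^sub>1) = cross"
      using row_between(1)[of i j j\<^sub>2 j\<^sub>1] D h(2) \<open>j\<^sub>1 < j\<close> by auto
    then show False using D by auto
  qed
  have sw: "cross_bump_swap D x y y = bump \<and> bump_pipes_cross_at (cross_bump_swap D x y) y x \<and>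
      (\<exists>n s. state n k \<pi> s (cross_bump_swap D x y) y) \<and> D = (cross_bump_swap D x y)(x := bump, y := cross)"
    if js: "j_state k \<pi> (D, x)" and cr: "D x = bump" "bump_pipes_cross_at D x y" for D x y
  proof -
    obtain n where st: "state n k \<pi> (West, North) D x" using js unfolding j_state_def fst_conv snd_conv by blast
    note sw = swap_state[OF st cr refl]
    then have "D = (cross_bump_swap D x y)(x := bump, y := cross)"
      using cr(1) by (auto simp: cross_bump_swap_def fun_eq_iff)
    then show ?thesis using sw by blast
  qed
  from t(1) show ?thesis
  proof (cases rule: turn_step.cases)
    case e1: (elbow D i j\<^sub>1 j\<^sub>2)
    from t(2) show ?thesis
    proof (cases rule: turn_step.cases)
      case e2: (elbow D' i' j\<^sub>1' j\<^sub>2')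
      have eq: "D' = D" "i' = i" "j\<^sub>2' = j\<^sub>2" using e1 e2 by auto
      have "\<not> j\<^sub>1 < j\<^sub>1'" using elbow_le[of D i j\<^sub>1' j\<^sub>1 j\<^sub>2] j e1 e2 unfolding eq by blast
      moreover have "\<not> j\<^sub>1' < j\<^sub>1" using elbow_le[of D i j\<^sub>1 j\<^sub>1' j\<^sub>2] j e1 e2 unfolding eq by blast
      ultimately show ?thesis using e1 e2 eq by simp
    next
      case (swap D' x y)
      then show ?thesis using sw[of D' x y] j e1 by auto
    next
      case (pass D' x r)
      then show ?thesis using e1 by auto
    qed
  next
    case s1: (swap D x y)
    note w1 = sw[of D x y]
    from t(2) show ?thesis
    proof (cases rule: turn_step.cases)
      case (elbow D' i' j\<^sub>1' j\<^sub>2')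
      then show ?thesis using w1 j s1 by auto
    next
      case s2: (swap D' x' y')
      note w2 = sw[of D' x' y']
      have eq: "y' = y" "cross_bump_swap D' x' y = cross_bump_swap D x y" using s1 s2 by auto
      let ?E = "cross_bump_swap D x y"
      have W1: "?E y = bump" "bump_pipes_cross_at ?E y x" "\<exists>n s. state n k \<pi> s ?E y" "D = ?E(x := bump, y := cross)"
        using w1 j(1) s1 by auto
      have W2: "bump_pipes_cross_at ?E y x'" "D' = ?E(x' := bump, y := cross)"
        using w2 j(2) s2 unfolding eq by auto
      have "x = x'" using state_unique_crossing W1(1,2,3) W2(1) by metis
      then show ?thesis using W1(4) W2(2) s1 s2 by simp
    next
      case (pass D' x' r)
      then have "D' = cross_bump_swap D x y" "x' = y" using s1 by auto
      then show ?thesis using w1 j s1 pass(4) by blast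
    qed
  next
    case p1: (pass D x r)
    from t(2) show ?thesis
    proof (cases rule: turn_step.cases)
      case (elbow D' i' j\<^sub>1' j\<^sub>2')
      then show ?thesis using p1 by auto
    next
      case s2: (swap D' x' y')
      then have "D = cross_bump_swap D' x' y'" "x = y'" using p1 by auto
      then show ?thesis using sw[of D' x' y'] j s2 p1(4) by blast
    next
      case (pass D' x' r')
      then show ?thesis using p1 by auto
    qed
  qed
qed

lemma turn_step_det:
  assumes j: "j_state k \<pi> s" and t: "turn_step k s t" "turn_step k s t'"
  shows "t = t'"
proof -
  obtain D x where s: "s = (D, x)" by (metis surj_pair)
  obtain n where st: "state n k \<pi> (West, North) D x" using j unfolding j_state_def s fst_conv snd_conv by blast
  from t(1) show ?thesis
    unfolding s
  proof (cases rule: turn_step.cases)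
    case e1: (elbow i j\<^sub>1 j\<^sub>2)
    from t(2) show ?thesis
      unfolding s
    proof (cases rule: turn_step.cases)
      case e2: (elbow i' j\<^sub>1' j\<^sub>2')
      then have "\<not> j\<^sub>2 < j\<^sub>2'" "\<not> j\<^sub>2' < j\<^sub>2" using e1 by auto
      then show ?thesis using e1 e2 by auto
    qed (use e1 in auto)
  next
    case s1: (swap y)
    from t(2) show ?thesis
      unfolding s
    proof (cases rule: turn_step.cases)
      case s2: (swap z)
      have "y = z" using state_unique_crossing[OF st] s1 s2 by blast
      then show ?thesis using s1 s2 by simp
    next
      case (pass r)
      then show ?thesis using s1 by blast
    qed (use s1 in auto)
  next
    case p1: (pass r)
    from t(2) show ?thesis
      unfolding s
    proof (cases rule: turn_step.cases)
      case (swap y)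
      then show ?thesis using p1 by blast
    qed (use p1 in auto)
  qed
qed

lemma turn_step_not_stop: "turn_step k s t \<Longrightarrow> \<not> stop_cond k (fst s) (snd s)"
  by (cases rule: turn_step.cases) (auto simp: stop_cond_def)

text \<open>A predecessor would be a j-elbow with no r-elbow to its right. But far to the right the
  row is horizontal, and following it back to the west gives an east exit at that j-elbow, which has
  none.\<close>

lemma start_no_predecessor:
  assumes j: "j_state k \<pi> s" and t: "turn_step k s t"
  shows "\<not> is_start t"
proof
  assume "is_start t"
  then obtain D i j where D: "t = (D, (i, j))" "D (i, j) = r_elbow" "\<forall>j'>j. D (i, j') \<noteq> r_elbow"
    unfolding is_start_def by blast
  from t show False
  proof (cases rule: turn_step.cases)
    case (elbow E i' j\<^sub>1 j\<^sub>2)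
    then have e: "D (i, j\<^sub>1) = j_elbow" "j < j\<^sub>1" "s = (D, (i, j\<^sub>1))" using D by auto
    obtain n where st: "state n k \<pi> (West, North) D (i, j\<^sub>1)" using j unfolding j_state_def e(3) fst_conv snd_conv by blast
    obtain h where h: "pipes D h" "outside_standard n D" "\<And>y. y \<noteq> (i, j\<^sub>1) \<Longrightarrow> D y \<noteq> bump" using stateE[OF st] by metis
    interpret pipes D h by fact
    have i: "1 \<le> i" using nonblank_pos[OF h(2), of i j\<^sub>1] e(1) by simp
    \<comment> \<open>A column beyond the window, the diagonal and \<open>j\<^sub>1\<close>, so that
      the tile in row \<open>i\<close> is horizontal.\<close>
    define M where "M = n + i + j\<^sub>1 + 1"
    have "D (i, M) = horizontal" using outside_standardD[OF h(2), of i M] i by (simp add: M_def id_tiling_def)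
    then have "\<exists>f. (West, f) \<in> D (i, M)" by (auto simp: horizontal_def)
    moreover have "D (i, j') \<noteq> r_elbow \<and> D (i, j') \<noteq> bump" if "j\<^sub>1 < j'" "j' < M" for j'
      using D(3) h(3) that e by auto
    moreover have "j\<^sub>1 < M" by (simp add: M_def)
    ultimately have "\<exists>e. (e, East) \<in> D (i, j\<^sub>1)" by (rule row_between(2))
    then show False using e by (auto simp: j_elbow_def)
  next
    case (swap E x y)
    then have "cross_bump_swap E x y y = bump" by (simp add: cross_bump_swap_def)
    then show False using swap D by auto
  next
    case (pass E x r)
    then show False using D by auto
  qed
qed

text \<open>To invert a turn at an r-elbow, its pipe is followed to the east. The first tile that is
  neither horizontal nor a cross is a j-elbow, and the turn came from there; if there is none, the
  r-elbow is the last one in its row. At a bump the turn was a swap or a pass according to whether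
  the two pipes cross.\<close>

lemma start_or_predecessor:
  assumes st: "state n k \<pi> (South, East) D x"
  shows "is_start (D, x) \<and> (\<forall>y. D y \<noteq> bump) \<and> 1 \<le> fst x \<and> fst x \<le> k \<or>
    (\<exists>E y. state n k \<pi> (West, North) E y \<and> turn_step k (E, y) (D, x) \<and> north_cells n E = north_cells n D)"
proof -
  obtain h where h: "pipes D h" "traced n D h \<pi>" "reduced h" "outside_standard n D" "\<pi> permutes {1..n}"
    "\<And>y. y \<noteq> x \<Longrightarrow> D y \<noteq> bump" "(South, East) \<in> D x" "\<exists>r\<le>k. exits_row D (x, (South, East)) r"
    using stateE[OF st] by metis
  interpret pipes D h by fact
  note tb = tile_by_segments[OF tile_cases]
  have "D x = r_elbow \<or> D x = bump" using h(7) tb(1) by blast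
  then show ?thesis
  proof
    assume r: "D x = r_elbow"
    obtain i j\<^sub>2 where x: "x = (i, j\<^sub>2)" by fastforce
    have nb: "D y \<noteq> bump" for y using h(6)[of y] r by (cases "y = x") auto
    obtain p d where p: "1 \<le> p" "((i, j\<^sub>2), (South, East)) = strand_at (h p) d" using h(7) strandE unfolding x by metis
    then have s: "d = int j\<^sub>2 - int i" "h p (int j\<^sub>2 - int i) = int i" "h p (int j\<^sub>2 - int i + 1) = int i"
      unfolding strand_eq_iff[OF p(1)] by auto
    show ?thesis
    proof (cases "\<exists>j>j\<^sub>2. D (i, j) \<noteq> horizontal \<and> D (i, j) \<noteq> cross")
      case True
      define j\<^sub>1 where "j\<^sub>1 = (LEAST j. j\<^sub>2 < j \<and> D (i, j) \<noteq> horizontal \<and> D (i, j) \<noteq> cross)"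
      have j1: "j\<^sub>2 < j\<^sub>1" "D (i, j\<^sub>1) \<noteq> horizontal" "D (i, j\<^sub>1) \<noteq> cross"
        using LeastI_ex[OF True] by (auto simp: j\<^sub>1_def)
      have bt: "D (i, j) = horizontal \<or> D (i, j) = cross" if "j\<^sub>2 < j" "j < j\<^sub>1" for j
        using not_less_Least[of j "\<lambda>j. j\<^sub>2 < j \<and> D (i, j) \<noteq> horizontal \<and> D (i, j) \<noteq> cross"] that
        by (auto simp: j\<^sub>1_def)
      have run: "h p (int j\<^sub>1 - int i) = int i" "h p (int j\<^sub>1 - int i - 1) = int i"
        using row_run[OF p(1) s(2,3) bt j1(1)] by auto
      then have "(West, exit_side (h p) (int j\<^sub>1 - int i)) \<in> D (i, j\<^sub>1)" unfolding mem_cell using p(1) by auto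
      then have je: "D (i, j\<^sub>1) = j_elbow" using tb(7)[of "(i, j\<^sub>1)"] j1 nb by blast
      obtain q where q: "1 \<le> q" "((i, j\<^sub>2), (South, East)) = strand_at (h q) (int j\<^sub>2 - int i)"
        "((i, j\<^sub>1), (West, North)) = strand_at (h q) (int j\<^sub>1 - int i)"
        using row_same_pipe[OF _ je j1(1) bt] r x by blast
      have "\<exists>r\<le>k. exits_row D ((i, j\<^sub>1), (West, North)) r"
        using h(8) unfolding x q(2,3) exits_row_iff[OF q(1)] .
      then have "state n k \<pi> (West, North) D (i, j\<^sub>1)"
        unfolding state_def using h(2,3) nb je by (auto simp: j_elbow_def)
      moreover have "turn_step k (D, (i, j\<^sub>1)) (D, x)"
        unfolding x using je j1(1) r x bt by (intro turn_step.elbow) force+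
      ultimately show ?thesis by blast
    next
      case False
      then have all: "D (i, j) = horizontal \<or> D (i, j) = cross" if "j\<^sub>2 < j" for j using that by blast
      have "h p e = int i" if "int j\<^sub>2 - int i < e" for e
        using row_run[OF p(1) s(2,3) all, of "nat (e + int i)"] that by simp
      \<comment> \<open>The row of a start is the exit row of its pipe; this is how the bound on
        exits becomes the bound \<open>b \<le> k\<close> of a biletter.\<close>
      then have "exits_at (h p) i" unfolding exits_at_def by (intro exI[of _ "int j\<^sub>2 - int i + 1"]) auto
      then have "i \<le> k" using h(8) exits_at_unique unfolding x p(2) exits_row_iff[OF p(1)] by blast
      moreover have "1 \<le> i" using nonblank_pos[OF h(4), of i j\<^sub>2] r x by auto
      moreover have "is_start (D, x)" unfolding is_start_def x using r x all by force
      ultimately show ?thesis using nb x by simp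
    qed
  next
    assume b: "D x = bump"
    show ?thesis
    proof (cases "\<exists>y. bump_pipes_cross_at D x y")
      case True
      then obtain y where y: "bump_pipes_cross_at D x y" by blast
      let ?E = "cross_bump_swap D x y"
      have sw: "state n k \<pi> (West, North) ?E y" "?E y = bump" "bump_pipes_cross_at ?E y x" "x \<noteq> y" "D y = cross"
        using swap_state[OF st b y] by auto
      have "cross_bump_swap ?E y x = D" using b sw(4,5) by (auto simp: cross_bump_swap_def fun_eq_iff)
      then have "turn_step k (?E, y) (D, x)" using turn_step.swap[of ?E y x k] sw by simp
      moreover have "north_cells n ?E = north_cells n D"
        using b sw(4,5) by (auto simp: north_cells_def cross_bump_swap_def)
      ultimately show ?thesis using sw(1) by blast
    next
      case False
      then obtain r where r: "r \<le> k" "exits_row D (x, (South, East)) r" using h(8) by blast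
      \<comment> \<open>Before a pass the current pipe is the one with the W-N turn. It exits above
        the other pipe, so it satisfies the bound as well.\<close>
      then obtain r' where "r' < r" "exits_row D (x, (West, North)) r'"
        using bump_exits_order[OF h(2) b False] by blast
      then have "state n k \<pi> (West, North) D x"
        unfolding state_def using h(2,3,6) b r(1) by (auto simp: bump_def intro!: exI[of _ r'])
      moreover have "turn_step k (D, x) (D, x)" using turn_step.pass[of D x r k] b False r by simp
      ultimately show ?thesis by blast
    qed
  qed
qed

section \<open>Right insertion is a bijection\<close>

text \<open>Only on legal states are rounds functional and injective; the restriction lets both
  properties be used along whole paths.\<close>

definition r_round :: "nat \<Rightarrow> perm \<Rightarrow> tiling \<times> cell \<Rightarrow> tiling \<times> cell \<Rightarrow> bool" where
  "r_round k \<pi> s t \<longleftrightarrow> r_state k \<pi> s \<and> insertion_round k s t"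

lemma r_round_state: "r_round k \<pi> s t \<Longrightarrow> r_state k \<pi> t \<and> r_wt t = r_wt s"
  unfolding r_round_def insertion_round_def using turn_step_state min_droop_state(1,2) by metis

lemma r_round_inj: "r_round k \<pi> s t \<Longrightarrow> r_round k \<pi> s' t \<Longrightarrow> s = s'"
  unfolding r_round_def insertion_round_def using turn_step_inj min_droop_state(1) min_droop_inj by metis

lemma r_round_det: "r_round k \<pi> s t \<Longrightarrow> r_round k \<pi> s t' \<Longrightarrow> t = t'"
  unfolding r_round_def insertion_round_def using turn_step_det min_droop_state(1) by metis

lemma r_round_not_start: "r_round k \<pi> s t \<Longrightarrow> \<not> is_start t"
  unfolding r_round_def insertion_round_def using start_no_predecessor min_droop_state(1) by metis

lemma r_round_not_stops: "r_round k \<pi> s t \<Longrightarrow> \<not> stops k s D'"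
  unfolding r_round_def insertion_round_def stops_def using turn_step_not_stop by fastforce

lemma insertion_round_rtranclp:
  assumes "(insertion_round k)\<^sup>*\<^sup>* s t" "r_state k \<pi> s"
  shows "(r_round k \<pi>)\<^sup>*\<^sup>* s t \<and> r_state k \<pi> t \<and> r_wt t = r_wt s"
  using assms(1)
proof (induction rule: rtranclp_induct)
  case (step y z)
  then have "r_round k \<pi> y z" by (simp add: r_round_def)
  then show ?case using step r_round_state by (metis rtranclp.rtrancl_into_rtrancl)
qed (use assms in auto)

text \<open>With unique predecessors, paths with a common end are nested. It is used for rounds to
  show injectivity and for their converse to show that the result is unique.\<close>

lemma rtranclp_comparable:
  assumes inj: "\<And>a b c. R a c \<Longrightarrow> R b c \<Longrightarrow> a = b" and "R\<^sup>*\<^sup>* s t" "R\<^sup>*\<^sup>* s' t"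
  shows "R\<^sup>*\<^sup>* s s' \<or> R\<^sup>*\<^sup>* s' s"
  using assms(2,3)
proof (induction rule: rtranclp_induct)
  case (step y z)
  from step.prems show ?case
  proof (cases rule: rtranclp.cases)
    case rtrancl_refl
    then show ?thesis using step.hyps by (metis rtranclp.rtrancl_into_rtrancl)
  next
    case (rtrancl_into_rtrancl w)
    then have "w = y" using inj step.hyps(2) by blast
    then show ?thesis using step.IH rtrancl_into_rtrancl by blast
  qed
qed auto

text \<open>Rows never increase along a pipe, so one that passes through row \<open>b\<close> exits
  from a row at most \<open>b\<close>. Here \<open>b \<le> k\<close> enters.\<close>

lemma start_state:
  assumes D: "D \<in> bpds n \<pi>" and pm: "\<pi> permutes {1..n}" and r: "D (b, j) = r_elbow" and bk: "b \<le> k"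
  shows "state n k \<pi> (South, East) D (b, j)"
proof -
  obtain h where h: "traced n D h \<pi>" "reduced h" "\<And>x. D x \<noteq> bump" using bpds_trace[OF D pm] by metis
  interpret pipes D h using h by (simp add: traced_def)
  have SE: "(South, East) \<in> D (b, j)" using r by (simp add: r_elbow_def)
  then obtain p d where p: "1 \<le> p" "((b, j), (South, East)) = strand_at (h p) d" using strandE by metis
  obtain e where e: "exits_at (h p) e" using exits_at_exists[OF path[OF p(1)]] by blast
  have "h p d = int b" using p(2) unfolding strand_eq_iff[OF p(1)] by auto
  then have "e \<le> b" using exits_at_le_row[OF path[OF p(1)] e, of d] by simp
  then have "\<exists>r\<le>k. exits_row D ((b, j), (South, East)) r"
    unfolding p(2) exits_row_iff[OF p(1)] using e bk by (meson order_trans)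
  then show ?thesis unfolding state_def using h SE by blast
qed

lemma right_insert_start:
  assumes "D \<in> bpds n \<pi>" "\<pi> permutes {1..n}" "b \<le> k" "right_insert D b k D'"
  obtains j s where "is_start (D, (b, j))" "r_state k \<pi> (D, (b, j))" "D (b, j) = r_elbow" "\<forall>j'>j. D (b, j') \<noteq> r_elbow"
    "(r_round k \<pi>)\<^sup>*\<^sup>* (D, (b, j)) s" "r_state k \<pi> s" "r_wt s = r_wt (D, (b, j))" "stops k s D'"
proof -
  obtain j where j: "D (b, j) = r_elbow" "\<forall>j'>j. D (b, j') \<noteq> r_elbow" "insertion_loop k D (b, j) D'"
    using assms(4) unfolding right_insert_def by blast
  have st: "r_state k \<pi> (D, (b, j))"
    unfolding r_state_def fst_conv snd_conv using start_state[OF assms(1,2) j(1) assms(3)] by blast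
  moreover have "is_start (D, (b, j))" unfolding is_start_def using j by blast
  moreover obtain s where "(insertion_round k)\<^sup>*\<^sup>* (D, (b, j)) s" "stops k s D'" using j(3) unfolding insertion_loop_iff by blast
  ultimately show ?thesis using that j insertion_round_rtranclp by blast
qed

text \<open>At the start the r-elbow in row \<open>b\<close> contributes the factor
  \<open>X b\<close>, the weight is invariant along the run, and at the end the factor is 1 because
  the current tile is a bump. Turning it into a cross changes no blank.\<close>

lemma right_insert_bpd:
  assumes D: "D \<in> bpds n \<pi>" "\<pi> permutes {1..n}" "b \<le> k" "right_insert D b k D'"
  obtains m \<sigma> where "\<sigma> permutes {1..m}" "D' \<in> bpds m \<sigma>" "k_cover k \<pi> \<sigma>" "blank_wt D' = blank_wt D * X b"
proof -
  obtain j s where j: "D (b, j) = r_elbow" "r_state k \<pi> s" "r_wt s = r_wt (D, (b, j))" "stops k s D'"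
    using right_insert_start[OF assms] by metis
  obtain E x where E: "min_droop (fst s) (snd s) = (E, x)" "stop_cond k E x" "D' = E(x := cross)"
    using j(4) unfolding stops_def by blast
  have "j_state k \<pi> (E, x)" "j_wt (E, x) = r_wt s" using min_droop_state[OF j(2)] E(1) by auto
  then obtain m where st: "state m k \<pi> (West, North) E x" unfolding j_state_def fst_conv snd_conv by blast
  obtain m h a c t where r: "1 \<le> a" "a \<le> k" "k < c" "traced m D' h (\<pi> \<circ> transpose a c)"
    "reduced h" "\<And>y. D' y \<noteq> bump" "k_cover k \<pi> (\<pi> \<circ> transpose a c)"
    using stop_result[OF st E(2)] unfolding E(3)[symmetric] by metis
  have bx: "E x = bump" using E(2) by (simp add: stop_cond_def)
  then have "blanks D' = blanks E" unfolding E(3) by (auto simp: blanks_def)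
  then have "blank_wt D' = j_wt (E, x)" using bx by (simp add: blank_wt_def j_wt_def)
  also have "\<dots> = blank_wt D * X b" using \<open>j_wt (E, x) = r_wt s\<close> j(1,3) by (simp add: r_wt_def)
  finally show ?thesis using that[of "\<pi> \<circ> transpose a c" m] r traced_bpds by (metis traced_def)
qed

text \<open>Two runs from the same start are nested, and a state at which the insertion stops has no
  further round.\<close>

lemma right_insert_det:
  assumes D: "D \<in> bpds n \<pi>" "\<pi> permutes {1..n}" "b \<le> k" and r: "right_insert D b k D'" "right_insert D b k D''"
  shows "D' = D''"
proof -
  obtain j s where 1: "D (b, j) = r_elbow" "\<forall>j'>j. D (b, j') \<noteq> r_elbow" "(r_round k \<pi>)\<^sup>*\<^sup>* (D, (b, j)) s" "stops k s D'"
    using right_insert_start[OF D r(1)] by metis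
  obtain j' s' where 2: "D (b, j') = r_elbow" "\<forall>j''>j'. D (b, j'') \<noteq> r_elbow" "(r_round k \<pi>)\<^sup>*\<^sup>* (D, (b, j')) s'" "stops k s' D''"
    using right_insert_start[OF D r(2)] by metis
  have jj: "j' = j" using 1(1,2) 2(1,2) by (metis linorder_neqE_nat)
  have "(r_round k \<pi>)\<inverse>\<inverse>\<^sup>*\<^sup>* s (D, (b, j))" "(r_round k \<pi>)\<inverse>\<inverse>\<^sup>*\<^sup>* s' (D, (b, j))"
    using 1(3) 2(3) unfolding jj by (simp_all add: rtranclp_conversep)
  then have "(r_round k \<pi>)\<inverse>\<inverse>\<^sup>*\<^sup>* s s' \<or> (r_round k \<pi>)\<inverse>\<inverse>\<^sup>*\<^sup>* s' s"
    using rtranclp_comparable[of "(r_round k \<pi>)\<inverse>\<inverse>"] r_round_det by (metis conversep_iff)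
  then have "(r_round k \<pi>)\<^sup>*\<^sup>* s' s \<or> (r_round k \<pi>)\<^sup>*\<^sup>* s s'" by (simp add: rtranclp_conversep)
  then have "s = s'" using 1(4) 2(4) r_round_not_stops by (metis converse_rtranclpE)
  then show ?thesis using 1(4) 2(4) by (auto simp: stops_def)
qed

text \<open>The common result determines the last state, so the two runs are nested at their ends. A
  start has no predecessor, so they begin at the same place.\<close>

lemma right_insert_inj:
  assumes D: "D \<in> bpds n \<pi>" "\<pi> permutes {1..n}" "b \<le> k" "right_insert D b k F"
    and E: "E \<in> bpds m \<pi>" "\<pi> permutes {1..m}" "c \<le> k" "right_insert E c k F"
  shows "D = E \<and> b = c"
proof -
  obtain j s where 1: "is_start (D, (b, j))" "(r_round k \<pi>)\<^sup>*\<^sup>* (D, (b, j)) s" "r_state k \<pi> s" "stops k s F"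
    using right_insert_start[OF D] by metis
  obtain j' s' where 2: "is_start (E, (c, j'))" "(r_round k \<pi>)\<^sup>*\<^sup>* (E, (c, j')) s'" "r_state k \<pi> s'" "stops k s' F"
    using right_insert_start[OF E] by metis
  obtain G x where G: "min_droop (fst s) (snd s) = (G, x)" "stop_cond k G x" "F = G(x := cross)"
    using 1(4) unfolding stops_def by blast
  obtain H y where H: "min_droop (fst s') (snd s') = (H, y)" "stop_cond k H y" "F = H(y := cross)"
    using 2(4) unfolding stops_def by blast
  obtain n1 where "state n1 k \<pi> (West, North) G x"
    using min_droop_state(1)[OF 1(3)] unfolding G(1) j_state_def fst_conv snd_conv by blast
  moreover obtain n2 where "state n2 k \<pi> (West, North) H y"
    using min_droop_state(1)[OF 2(3)] unfolding H(1) j_state_def fst_conv snd_conv by blast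
  ultimately have "G = H \<and> x = y" using stop_injective G(2,3) H(2,3) by metis
  then have "s = s'" using min_droop_inj[OF 1(3) 2(3)] G(1) H(1) by simp
  then have "(r_round k \<pi>)\<^sup>*\<^sup>* (D, (b, j)) (E, (c, j')) \<or> (r_round k \<pi>)\<^sup>*\<^sup>* (E, (c, j')) (D, (b, j))"
    using rtranclp_comparable[of "r_round k \<pi>"] r_round_inj 1(2) 2(2) by metis
  then have "(D, (b, j)) = (E, (c, j'))" using 1(1) 2(1) r_round_not_start by (metis rtranclp.cases)
  then show ?thesis by simp
qed

text \<open>\<open>P\<close> stands for a property that propagates backwards along rounds, such as
  leading to a prescribed result. Each undone min-droop lowers the sum of columns over
  \<open>north_cells\<close>, the undone turn keeps it, and the window never changes.\<close>

lemma backward_insertion: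
  assumes "state n k \<pi> (West, North) E y"
    and "\<And>s. min_droop (fst s) (snd s) = (E, y) \<Longrightarrow> P s" and "\<And>s t. insertion_round k s t \<Longrightarrow> P t \<Longrightarrow> P s"
  shows "\<exists>D x. is_start (D, x) \<and> (\<forall>z. D z \<noteq> bump) \<and> 1 \<le> fst x \<and> fst x \<le> k \<and>
    state n k \<pi> (South, East) D x \<and> P (D, x)"
  using assms(1,2)
proof (induction "\<Sum>z\<in>north_cells n E. snd z" arbitrary: E y rule: less_induct)
  case less
  obtain a' b' where y: "y = (a', b')" by fastforce
  obtain a b where cf: "undroop_config E a b a' b'" and pos: "1 \<le> a" "1 \<le> b" "a' \<le> n" "b' \<le> n"
    and st: "state n k \<pi> (South, East) (undroop a b a' b' E) (a, b)"
    using undroop_state[of n k \<pi> E a' b'] less.prems(1) unfolding y by metis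
  define D where "D = undroop a b a' b' E"
  have cf': "droop_config D a b a' b'" unfolding D_def by (rule droop_config_undroop[OF cf])
  have DE: "droop a b a' b' D = E" unfolding D_def by (rule droop_undroop[OF cf])
  have "min_droop D (a, b) = (E, y)" using min_droop_eq[OF cf'] unfolding DE y .
  then have P: "P (D, (a, b))" using less.prems(2)[of "(D, (a, b))"] by simp
  have lt: "(\<Sum>z\<in>north_cells n D. snd z) < (\<Sum>z\<in>north_cells n E. snd z)"
    using north_cells_droop[OF cf' pos] unfolding DE .
  from start_or_predecessor[OF st] show ?case
  proof
    assume "is_start (undroop a b a' b' E, a, b) \<and> (\<forall>y. undroop a b a' b' E y \<noteq> bump) \<and>
      1 \<le> fst (a, b) \<and> fst (a, b) \<le> k"
    then show ?thesis using P st unfolding D_def by blast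
  next
    assume "\<exists>F z. state n k \<pi> (West, North) F z \<and> turn_step k (F, z) (undroop a b a' b' E, a, b) \<and>
      north_cells n F = north_cells n (undroop a b a' b' E)"
    then obtain F z where F: "state n k \<pi> (West, North) F z" "turn_step k (F, z) (D, (a, b))" "north_cells n F = north_cells n D"
      unfolding D_def by blast
    have "P s" if "min_droop (fst s) (snd s) = (F, z)" for s
      using assms(3)[of s "(D, (a, b))"] P F(2) that by (simp add: insertion_round_def)
    then show ?thesis using less.hyps[of F z] F lt by simp
  qed
qed

lemma right_insert_surj:
  assumes F: "F \<in> bpds n \<sigma>" "\<sigma> permutes {1..n}" and cov: "k_cover k \<pi> \<sigma>"
  obtains D b where "D \<in> bpds n \<pi>" "1 \<le> b" "b \<le> k" "right_insert D b k F"
proof -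
  obtain x where x: "state n k \<pi> (West, North) (F(x := bump)) x" "stop_cond k (F(x := bump)) x" "F x = cross"
    using unstop[OF F cov] by metis
  \<comment> \<open>That the forward run from \<open>s\<close> ends in \<open>F\<close> is collected
    on the way back, so the start that is found comes with its run.\<close>
  define P where "P = (\<lambda>s. \<exists>t. (insertion_round k)\<^sup>*\<^sup>* s t \<and> stops k t F)"
  have "P s" if "min_droop (fst s) (snd s) = (F(x := bump), x)" for s
  proof -
    have "F = (F(x := bump))(x := cross)" using x(3) by (simp add: fun_upd_idem)
    then have "stops k s F" unfolding stops_def using that x(2) by blast
    then show ?thesis unfolding P_def by blast
  qed
  moreover have "P s" if "insertion_round k s t" "P t" for s t
    using that unfolding P_def by (meson converse_rtranclp_into_rtranclp)
  ultimately obtain D z where z: "is_start (D, z)" "\<And>y. D y \<noteq> bump" "1 \<le> fst z" "fst z \<le> k"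
    "state n k \<pi> (South, East) D z" "P (D, z)"
    using backward_insertion[OF x(1), of P] by blast
  obtain b j where bj: "z = (b, j)" by fastforce
  have "insertion_loop k D (b, j) F" unfolding insertion_loop_iff using z(6) unfolding P_def bj .
  moreover have "D (b, j) = r_elbow \<and> (\<forall>j'>j. D (b, j') \<noteq> r_elbow)" using z(1) unfolding bj is_start_def by blast
  ultimately have "right_insert D b k F" unfolding right_insert_def by blast
  moreover have "D \<in> bpds n \<pi>" using z(2,5) traced_bpds unfolding state_def by blast
  ultimately show ?thesis using that z(3,4) bj by simp
qed

section \<open>The expansion of Schubert polynomials\<close>

lemma edges_match_id_tiling: "edges_match id_tiling"
  unfolding edges_match_def by (auto simp: id_tiling_def tile_defs split: if_splits)

lemma id_tiling_bpd: "id_tiling \<in> bpds 0 id"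
proof -
  have out: "outside_standard 0 id_tiling" by (simp add: outside_standard_def)
  obtain h where "pipes id_tiling h"
    using pipes_exist[OF _ edges_match_id_tiling out] id_tiling_cases by blast
  then interpret pipes id_tiling h .
  have "exits_at (h (id r)) r" if "1 \<le> r" for r using outer_exit[OF out, of r] that by simp
  then have tr: "traced 0 id_tiling h id" unfolding traced_def using out pipes_axioms permutes_id by blast
  have "crossings id_tiling = {}" using crossings_window[OF out] by auto
  moreover have "{(i, j). 1 \<le> i \<and> i < j \<and> id j < id (i::nat)} = {}" by auto
  then have "perm_length id = 0" unfolding perm_length_def by (metis card.empty)
  ultimately have "reduced h" using perm_length_eq_iff_reduced[OF tr] by simp
  moreover have "id_tiling x \<noteq> bump" for x using id_tiling_cases[of x] by auto
  ultimately show ?thesis using traced_bpds[OF tr] by blast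
qed

lemma bpds_shrink:
  assumes "D \<in> bpds m \<pi>" "\<pi> permutes {1..n}" "n \<le> m"
  shows "D \<in> bpds n \<pi>"
proof -
  have "\<pi> permutes {1..m}" using assms(2,3) permutes_subset[of \<pi> "{1..n}" "{1..m}"] by simp
  then obtain h where h: "traced m D h \<pi>" "reduced h" "\<And>x. D x \<noteq> bump" using bpds_trace[OF assms(1)] by metis
  then show ?thesis using traced_bpds[OF traced_shrink[OF h(1,3) assms(2,3)] h(2,3)] by blast
qed

text \<open>The tiling produced by an insertion is known in some large window only; this brings it
  into the window given for the chain.\<close>

lemma bpds_change:
  assumes D: "D \<in> bpds m \<pi>" and m: "\<pi> permutes {1..m}" and n: "\<pi> permutes {1..n}"
  shows "D \<in> bpds n \<pi>"
proof (cases "n \<le> m")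
  case True
  then show ?thesis using bpds_shrink[OF D n] by blast
next
  case False
  obtain h where h: "traced m D h \<pi>" "reduced h" "\<And>x. D x \<noteq> bump" using bpds_trace[OF D m] by metis
  then show ?thesis using traced_bpds[OF traced_mono[OF h(1), of n] h(2,3)] False by simp
qed

text \<open>The identity fits into the window of size 0, and outside of that window a tiling has no
  freedom.\<close>

lemma bpds_id: "bpds n id = {id_tiling}"
proof -
  have "D = id_tiling" if "D \<in> bpds n id" for D
  proof -
    have "id permutes {1..0::nat}" "id permutes {1..n}" by (auto simp: permutes_id)
    then have "D \<in> bpds 0 id" using bpds_change[OF that] by blast
    then have "outside_standard 0 D" by (simp add: bpds_def)
    then show ?thesis by (auto simp: outside_standard_def fun_eq_iff)
  qed
  moreover have "id_tiling \<in> bpds n id" using bpds_change[OF id_tiling_bpd] permutes_id by blast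
  ultimately show ?thesis by blast
qed

lemma chain_between_snoc:
  "chain_between \<rho> (c @ [(k, \<sigma>)]) \<pi> \<longleftrightarrow> (\<exists>\<tau>. chain_between \<rho> c \<tau> \<and> k_cover k \<tau> \<sigma> \<and> \<sigma> = \<pi>)"
  by (induction c arbitrary: \<rho>) auto

lemma records_Nil_iff: "records Q D [] \<longleftrightarrow> Q = [] \<and> D = id_tiling"
  by (auto elim: records.cases intro: records.empty)

lemma records_snoc_iff:
  "records Q D (c @ [(k, \<sigma>)]) \<longleftrightarrow>
    (\<exists>Q' D' b. Q = Q' @ [(b, k)] \<and> records Q' D' c \<and> right_insert D' b k D \<and> \<sigma> = perm_of D)"
proof
  assume "records Q D (c @ [(k, \<sigma>)])"
  then show "\<exists>Q' D' b. Q = Q' @ [(b, k)] \<and> records Q' D' c \<and> right_insert D' b k D \<and> \<sigma> = perm_of D"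
    by (cases rule: records.cases) auto
qed (auto intro: records.snoc)

lemma is_biword_snoc: "is_biword (Q @ [(b, k)]) \<longleftrightarrow> is_biword Q \<and> 1 \<le> b \<and> b \<le> k"
  by (auto simp: is_biword_def)

lemma biword_wt_snoc: "biword_wt (Q @ [(b, k)]) = biword_wt Q * X b"
  by (simp add: biword_wt_def)

text \<open>The induction removes the last step of the chain and handles the four claims together.
  As \<open>records\<close> is only a relation, uniqueness of \<open>D\<close> for given
  \<open>Q\<close> has to be shown too; the claims then make it a weight-preserving
  bijection.\<close>

lemma recorded_biwords:
  assumes "mixed_chain c \<pi>" "\<pi> permutes {1..n}"
  shows "is_biword Q \<Longrightarrow> records Q D c \<Longrightarrow> D \<in> bpds n \<pi> \<and> biword_wt Q = blank_wt D"
    and "D \<in> bpds n \<pi> \<Longrightarrow> \<exists>Q. is_biword Q \<and> records Q D c"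
    and "is_biword Q \<Longrightarrow> records Q D c \<Longrightarrow> is_biword Q' \<Longrightarrow> records Q' D c \<Longrightarrow> Q = Q'"
    and "is_biword Q \<Longrightarrow> records Q D c \<Longrightarrow> records Q D' c \<Longrightarrow> D = D'"
proof -
  have "(\<forall>Q D. is_biword Q \<longrightarrow> records Q D c \<longrightarrow> D \<in> bpds n \<pi> \<and> biword_wt Q = blank_wt D) \<and>
    (\<forall>D\<in>bpds n \<pi>. \<exists>Q. is_biword Q \<and> records Q D c) \<and>
    (\<forall>Q Q' D. is_biword Q \<longrightarrow> records Q D c \<longrightarrow> is_biword Q' \<longrightarrow> records Q' D c \<longrightarrow> Q = Q') \<and>
    (\<forall>Q D D'. is_biword Q \<longrightarrow> records Q D c \<longrightarrow> records Q D' c \<longrightarrow> D = D')"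
    using assms
  proof (induction c arbitrary: \<pi> rule: rev_induct)
    case Nil
    then have "\<pi> = id" by (simp add: mixed_chain_def)
    have "blanks id_tiling = {}" by (auto simp: blanks_def id_tiling_def)
    then have "biword_wt [] = blank_wt id_tiling" by (simp add: biword_wt_def blank_wt_def)
    then show ?case unfolding \<open>\<pi> = id\<close> bpds_id records_Nil_iff by (auto simp: is_biword_def)
  next
    case (snoc p c)
    obtain k \<sigma> where p: "p = (k, \<sigma>)" by fastforce
    obtain \<rho> where \<rho>: "mixed_chain c \<rho>" "k_cover k \<rho> \<sigma>" "\<sigma> = \<pi>"
      using snoc.prems(1) unfolding mixed_chain_def p chain_between_snoc by blast
    have pm: "\<rho> permutes {1..n}" using k_cover_shrink[OF _ \<rho>(2)] snoc.prems(2) \<rho>(3) by metis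
    note IH = snoc.IH[OF \<rho>(1) pm]
    \<comment> \<open>The insertion by itself yields some cover in some window. That the chain
      records \<open>perm_of D\<close> forces this cover to be \<open>\<sigma>\<close>.\<close>
    have fwd: "D \<in> bpds n \<sigma> \<and> blank_wt D = blank_wt E * X b"
      if E: "E \<in> bpds n \<rho>" "b \<le> k" "right_insert E b k D" and perm: "\<sigma> = perm_of D" for D E b
    proof -
      obtain m \<tau> where \<tau>: "\<tau> permutes {1..m}" "D \<in> bpds m \<tau>" "blank_wt D = blank_wt E * X b"
        using right_insert_bpd[OF E(1) pm E(2,3)] by metis
      have "\<sigma> = \<tau>" using perm perm_of_eq[OF \<tau>(2,1)] by simp
      then show ?thesis using bpds_change \<tau> snoc.prems(2) \<rho>(3) by blast
    qed
    have rec: "\<exists>Q' E b. Q = Q' @ [(b, k)] \<and> is_biword Q' \<and> 1 \<le> b \<and> b \<le> k \<and> records Q' E c \<and> right_insert E b k D \<and>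
        \<sigma> = perm_of D \<and> E \<in> bpds n \<rho>"
      if "is_biword Q" "records Q D (c @ [p])" for Q D
      using that IH unfolding p records_snoc_iff by (metis is_biword_snoc)
    have A: "D \<in> bpds n \<pi> \<and> biword_wt Q = blank_wt D" if Q: "is_biword Q" "records Q D (c @ [p])" for Q D
    proof -
      obtain Q' E b where E: "Q = Q' @ [(b, k)]" "is_biword Q'" "b \<le> k" "records Q' E c" "right_insert E b k D"
        "\<sigma> = perm_of D" "E \<in> bpds n \<rho>" using rec[OF Q] by blast
      then show ?thesis using fwd[OF E(7,3,5,6)] IH \<rho>(3) by (simp add: biword_wt_snoc)
    qed
    have B: "\<exists>Q. is_biword Q \<and> records Q D (c @ [p])" if D: "D \<in> bpds n \<pi>" for D
    proof -
      obtain E b where E: "E \<in> bpds n \<rho>" "1 \<le> b" "b \<le> k" "right_insert E b k D"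
        using right_insert_surj[of D n \<sigma> k \<rho>] D snoc.prems(2) \<rho>(2,3) by metis
      obtain Q where "is_biword Q" "records Q E c" using IH E(1) by blast
      moreover have "\<sigma> = perm_of D" using perm_of_eq[OF D snoc.prems(2)] \<rho>(3) by simp
      ultimately have "is_biword (Q @ [(b, k)])" "records (Q @ [(b, k)]) D (c @ [p])"
        using E unfolding p records_snoc_iff is_biword_snoc by blast+
      then show ?thesis by blast
    qed
    have C: "Q1 = Q2" if Q: "is_biword Q1" "records Q1 D (c @ [p])" "is_biword Q2" "records Q2 D (c @ [p])" for Q1 Q2 D
    proof -
      obtain Q' E b where E: "Q1 = Q' @ [(b, k)]" "is_biword Q'" "b \<le> k" "records Q' E c" "right_insert E b k D" "E \<in> bpds n \<rho>"
        using rec[OF Q(1,2)] by blast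
      obtain Q'' F a where F: "Q2 = Q'' @ [(a, k)]" "is_biword Q''" "a \<le> k" "records Q'' F c" "right_insert F a k D" "F \<in> bpds n \<rho>"
        using rec[OF Q(3,4)] by blast
      have "E = F \<and> b = a" using right_insert_inj[OF E(6) pm E(3,5) F(6) pm F(3,5)] .
      moreover from this have "Q' = Q''" using IH E(2,4) F(2,4) by blast
      ultimately show ?thesis using E(1) F(1) by simp
    qed
    have DD: "D1 = D2" if Q: "is_biword Q" "records Q D1 (c @ [p])" "records Q D2 (c @ [p])" for Q D1 D2
    proof -
      obtain Q' E b where E: "Q = Q' @ [(b, k)]" "is_biword Q'" "b \<le> k" "records Q' E c" "right_insert E b k D1" "E \<in> bpds n \<rho>"
        using rec[OF Q(1,2)] by blast
      obtain Q'' F a where F: "Q = Q'' @ [(a, k)]" "records Q'' F c" "right_insert F a k D2"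
        using rec[OF Q(1,3)] by blast
      have "Q'' = Q'" "a = b" using E(1) F(1) by auto
      moreover from this have "F = E" using IH E(2,4) F(2) by blast
      ultimately show ?thesis using right_insert_det[OF E(6) pm E(3,5)] F(3) by blast
    qed
    show ?case using A B C DD by blast
  qed
  then show "is_biword Q \<Longrightarrow> records Q D c \<Longrightarrow> D \<in> bpds n \<pi> \<and> biword_wt Q = blank_wt D"
    and "D \<in> bpds n \<pi> \<Longrightarrow> \<exists>Q. is_biword Q \<and> records Q D c"
    and "is_biword Q \<Longrightarrow> records Q D c \<Longrightarrow> is_biword Q' \<Longrightarrow> records Q' D c \<Longrightarrow> Q = Q'"
    and "is_biword Q \<Longrightarrow> records Q D c \<Longrightarrow> records Q D' c \<Longrightarrow> D = D'"
    by blast+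
qed

theorem theorem3p11:
  fixes n :: nat and \<pi> :: perm and c :: chain
  assumes "\<pi> permutes {1..n}"
    and "mixed_chain c \<pi>"
  shows "schubert n \<pi> = (\<Sum>Q | is_biword Q \<and> (\<exists>D. records Q D c). biword_wt Q)"
proof -
  let ?S = "{Q. is_biword Q \<and> (\<exists>D. records Q D c)}"
  note R = recorded_biwords[OF assms(2,1)]
  \<comment> \<open>Well defined on the biwords in the sum by uniqueness of the recorded tiling;
    elsewhere its value is arbitrary.\<close>
  define f where "f = (\<lambda>Q. THE D. records Q D c)"
  have f: "f Q = D" if "is_biword Q" "records Q D c" for Q D
    unfolding f_def using that R(4) by blast
  have "bij_betw f ?S (bpds n \<pi>)"
    unfolding bij_betw_def
  proof
    show "inj_on f ?S"
    proof (rule inj_onI)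
      fix Q Q' assume "Q \<in> ?S" "Q' \<in> ?S" "f Q = f Q'"
      then show "Q = Q'" using f R(3) by auto
    qed
    show "f ` ?S = bpds n \<pi>"
    proof
      show "f ` ?S \<subseteq> bpds n \<pi>" using f R(1) by auto
      show "bpds n \<pi> \<subseteq> f ` ?S"
      proof
        fix D assume "D \<in> bpds n \<pi>"
        then obtain Q where "is_biword Q" "records Q D c" using R(2) by blast
        then show "D \<in> f ` ?S" using f by (intro image_eqI[of _ _ Q]) auto
      qed
    qed
  qed
  then have "schubert n \<pi> = (\<Sum>Q\<in>?S. bpd_wt n (f Q))"
    unfolding schubert_def by (simp add: sum.reindex_bij_betw)
  also have "\<dots> = (\<Sum>Q\<in>?S. biword_wt Q)"
  proof (rule sum.cong)
    fix Q assume "Q \<in> ?S"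
    then obtain D where D: "is_biword Q" "records Q D c" by blast
    then have "D \<in> bpds n \<pi>" "biword_wt Q = blank_wt D" using R(1) by blast+
    then show "bpd_wt n (f Q) = biword_wt Q" using f[OF D] bpd_wt_blank_wt[of n D] by (simp add: bpds_def)
  qed simp
  finally show ?thesis .
qed

end
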